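(* Let $X$ be a smooth manifold and let $M\to X$ be the bundle of pseudo-Riemannian metrics of a fixed signature. If a second-order tensor $T\colon J^2M\to\otimes^pTX$ is natural, then its derivative $T'\colon J^2M\to\otimes^pTX\otimes(S^2TX\otimes S^2TX)$ takes its values in the subbundle $\otimes^pTX\otimes N^2$.
   Context: $X$ is a smooth manifold; $M\to X$ is the bundle of pseudo-Riemannian metrics of a fixed signature; $J^kM$ is the bundle of $k$-jets of sections of $M$. A second-order tensor is a smooth morphism of bundles $T\colon J^2M\to\otimes^pTX$ (over the identity of $X$). It is natural if $T(\tau\cdot j^2_xg)=\tau_*T(j^2_xg)$ for every diffeomorphism $\tau\colon U\to V$ between open sets of $X$ and every metric $g$ (of the fixed signature) near $x\in U$, where $\tau\cdot j^2_xg:=j^2_{\tau(x)}(\tau_*g)$. Derivative: the fibre $\mathbb{A}_{j^1_xg}$ of $J^2_xM\to J^1_xM$ over $j^1_xg$ is an affine space modelled on $S_{2,2}:=S^2T_x^*X\otimes S^2T_x^*X$ (in a chart, adding $S$ adds $S_{ab,cd}$ to the second derivatives $g_{ab,cd}$). The derivative $T'_{j^2_xg}$ is the tangent linear map at $j^2_xg$ of $T_|\colon\mathbb{A}_{j^1_xg}\to\otimes^pT_xX$, a linear map $S_{2,2}\to\otimes^pT_xX$, regarded as an element of $\otimes^pT_xX\otimes S_{2,2}^*=\otimes^pT_xX\otimes(S^2T_xX\otimes S^2T_xX)$. $N^2\subset S^2TX\otimes S^2TX$ (contravariant normal tensors of order 2) is the kernel of the symmetrization in the last 3 indices. *)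

theory Defs
  imports "HOL-Analysis.Analysis"
begin

text \<open>On an open subset of a Euclidean space, \<open>C_on k\<close> is the usual notion of a function of
  class \<open>C\<^sup>k\<close>. Only open sets are used below.\<close>

primrec C_on :: "nat \<Rightarrow> 'a::real_normed_vector set \<Rightarrow> ('a \<Rightarrow> 'b::real_normed_vector) \<Rightarrow> bool" where
  "C_on 0 S f \<longleftrightarrow> continuous_on S f"
| "C_on (Suc k) S f \<longleftrightarrow>
     (\<forall>x\<in>S. f differentiable (at x)) \<and> (\<forall>v. C_on k S (\<lambda>x. frechet_derivative f (at x) v))"

definition smooth_on :: "'a::real_normed_vector set \<Rightarrow> ('a \<Rightarrow> 'b::real_normed_vector) \<Rightarrow> bool" where
  "smooth_on S f \<longleftrightarrow> (\<forall>k. C_on k S f)"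

definition pd :: "'n::finite \<Rightarrow> (real^'n \<Rightarrow> real) \<Rightarrow> real^'n \<Rightarrow> real" where
  "pd k f u = frechet_derivative f (at u) (axis k 1)"

text \<open>A manifold \<open>X\<close> of dimension \<open>CARD('n)\<close> is given by a smooth atlas \<open>\<A>\<close> (not necessarily a
  maximal one); its underlying set is the union of the chart domains, an open subset of the
  ambient (Hausdorff, second countable) type. The values of a chart map outside the chart
  domain are irrelevant.\<close>

type_synonym ('x, 'n) chart = "'x set \<times> ('x \<Rightarrow> real^'n)"

abbreviation cdom :: "('x, 'n) chart \<Rightarrow> 'x set" where "cdom \<equiv> fst"
abbreviation cmap :: "('x, 'n) chart \<Rightarrow> 'x \<Rightarrow> real^'n" where "cmap \<equiv> snd"

definition cinv :: "('x, 'n) chart \<Rightarrow> real^'n \<Rightarrow> 'x" where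
  "cinv c = inv_into (cdom c) (cmap c)"

text \<open>The coordinate expression of a map \<open>\<tau>\<close> in the charts \<open>c\<close> (source) and \<open>c'\<close> (target), and
  its Jacobian matrix (row index: target, column index: source) at the point \<open>x\<close>.\<close>

definition local_rep :: "('x \<Rightarrow> 'x) \<Rightarrow> ('x, 'n) chart \<Rightarrow> ('x, 'n) chart \<Rightarrow> real^'n \<Rightarrow> real^'n" where
  "local_rep \<tau> c c' = cmap c' \<circ> \<tau> \<circ> cinv c"

definition dmat :: "('x \<Rightarrow> 'x) \<Rightarrow> ('x, 'n::finite) chart \<Rightarrow> ('x, 'n) chart \<Rightarrow> 'x \<Rightarrow> real^'n^'n" where
  "dmat \<tau> c c' x = jacobian (local_rep \<tau> c c') (at (cmap c x))"

definition smooth_atlas ::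
    "('x::{t2_space, second_countable_topology}, 'n::finite) chart set \<Rightarrow> bool" where
  "smooth_atlas \<A> \<longleftrightarrow>
     (\<forall>c\<in>\<A>. open (cdom c) \<and> open (cmap c ` cdom c) \<and>
            homeomorphism (cdom c) (cmap c ` cdom c) (cmap c) (cinv c)) \<and>
     (\<forall>c\<in>\<A>. \<forall>c'\<in>\<A>. smooth_on (cmap c ` (cdom c \<inter> cdom c')) (local_rep id c c'))"

definition mcarrier :: "('x, 'n) chart set \<Rightarrow> 'x set" where
  "mcarrier \<A> = (\<Union>c\<in>\<A>. cdom c)"

definition charts_at :: "('x, 'n) chart set \<Rightarrow> 'x \<Rightarrow> ('x, 'n) chart set" where
  "charts_at \<A> x = {c\<in>\<A>. x \<in> cdom c}"

definition smooth_map ::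
    "('x, 'n::finite) chart set \<Rightarrow> 'x set \<Rightarrow> ('x \<Rightarrow> 'x) \<Rightarrow> bool" where
  "smooth_map \<A> U \<tau> \<longleftrightarrow>
     (\<forall>c\<in>\<A>. \<forall>c'\<in>\<A>. smooth_on (cmap c ` (U \<inter> cdom c \<inter> \<tau> -` cdom c')) (local_rep \<tau> c c'))"

definition local_diffeo ::
    "('x::topological_space, 'n::finite) chart set \<Rightarrow> 'x set \<Rightarrow> 'x set \<Rightarrow> ('x \<Rightarrow> 'x) \<Rightarrow> bool" where
  "local_diffeo \<A> U V \<tau> \<longleftrightarrow>
     open U \<and> U \<subseteq> mcarrier \<A> \<and> open V \<and> V \<subseteq> mcarrier \<A> \<and>
     homeomorphism U V \<tau> (inv_into U \<tau>) \<and>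
     smooth_map \<A> U \<tau> \<and> smooth_map \<A> V (inv_into U \<tau>)"

text \<open>A tensor at \<open>x\<close> is the family of its component arrays in all charts around \<open>x\<close>, subject to the
  usual transformation law. A multi-index of length \<open>p\<close> is a list of length \<open>p\<close>. For definiteness,
  components are \<open>0\<close> for charts not around \<open>x\<close> and for lists of the wrong length, so that equality
  of tensors is equality of functions.\<close>

type_synonym ('x, 'n) tens = "('x, 'n) chart \<Rightarrow> 'n list \<Rightarrow> real"

definition tensor_act :: "real^'n::finite^'n \<Rightarrow> nat \<Rightarrow> ('n list \<Rightarrow> real) \<Rightarrow> 'n list \<Rightarrow> real" where
  "tensor_act A p t I =
     (if length I = p
      then \<Sum>K | length K = p. (\<Prod>i<p. A $ (I ! i) $ (K ! i)) * t K
      else 0)"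

text \<open>\<open>ctens \<A> p x\<close> is the \<open>p\<close>-th tensor power of the tangent space at \<open>x\<close>, \<open>cotens \<A> q x\<close> the
  \<open>q\<close>-th tensor power of the cotangent space.\<close>

definition ctens :: "('x, 'n::finite) chart set \<Rightarrow> nat \<Rightarrow> 'x \<Rightarrow> ('x, 'n) tens set" where
  "ctens \<A> p x = {t.
     (\<forall>c I. c \<notin> charts_at \<A> x \<or> length I \<noteq> p \<longrightarrow> t c I = 0) \<and>
     (\<forall>c\<in>charts_at \<A> x. \<forall>c'\<in>charts_at \<A> x. t c' = tensor_act (dmat id c c' x) p (t c))}"

definition cotens :: "('x, 'n::finite) chart set \<Rightarrow> nat \<Rightarrow> 'x \<Rightarrow> ('x, 'n) tens set" where
  "cotens \<A> q x = {t.
     (\<forall>c I. c \<notin> charts_at \<A> x \<or> length I \<noteq> q \<longrightarrow> t c I = 0) \<and>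
     (\<forall>c\<in>charts_at \<A> x. \<forall>c'\<in>charts_at \<A> x.
        t c' = tensor_act (transpose (dmat id c' c x)) q (t c))}"

text \<open>Push-forward \<open>\<tau>\<^sub>*\<close> of a contravariant tensor from \<open>x\<close> to \<open>\<tau> x\<close>, computed in an arbitrary chart
  around \<open>x\<close> (the result does not depend on it).\<close>

definition some_chart :: "('x, 'n) chart set \<Rightarrow> 'x \<Rightarrow> ('x, 'n) chart" where
  "some_chart \<A> x = (SOME c. c \<in> charts_at \<A> x)"

definition push_tens ::
    "('x, 'n::finite) chart set \<Rightarrow> nat \<Rightarrow> ('x \<Rightarrow> 'x) \<Rightarrow> 'x \<Rightarrow> ('x, 'n) tens \<Rightarrow> ('x, 'n) tens" where
  "push_tens \<A> p \<tau> x t = (\<lambda>c'.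
     if c' \<in> charts_at \<A> (\<tau> x)
     then let c = some_chart \<A> x in tensor_act (dmat \<tau> c c' x) p (t c)
     else (\<lambda>_. 0))"

text \<open>The matrix \<open>H\<close> is congruent to a diagonal matrix with \<open>r\<close> entries \<open>1\<close> and \<open>s\<close> entries \<open>-1\<close>;
  this includes symmetry and non-degeneracy.\<close>

definition has_signature :: "nat \<Rightarrow> nat \<Rightarrow> real^'n::finite^'n \<Rightarrow> bool" where
  "has_signature r s H \<longleftrightarrow>
     (\<exists>(P :: real^'n^'n) (d :: 'n \<Rightarrow> real). invertible P \<and> (\<forall>i. d i = 1 \<or> d i = - 1) \<and>
        card {i. d i = 1} = r \<and> card {i. d i = - 1} = s \<and>
        transpose P ** H ** P = (\<chi> i j. if i = j then d i else 0))"

definition metric_fibre ::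
    "('x, 'n::finite) chart set \<Rightarrow> nat \<Rightarrow> nat \<Rightarrow> 'x \<Rightarrow> ('x, 'n) tens set" where
  "metric_fibre \<A> r s x =
     {h \<in> cotens \<A> 2 x. \<forall>c\<in>charts_at \<A> x. has_signature r s (\<chi> a b. h c [a, b])}"

definition metric_on ::
    "('x::topological_space, 'n::finite) chart set \<Rightarrow> nat \<Rightarrow> nat \<Rightarrow> 'x set \<Rightarrow>
     ('x \<Rightarrow> ('x, 'n) tens) \<Rightarrow> bool" where
  "metric_on \<A> r s U g \<longleftrightarrow>
     open U \<and> U \<subseteq> mcarrier \<A> \<and> (\<forall>y\<in>U. g y \<in> metric_fibre \<A> r s y) \<and>
     (\<forall>c\<in>\<A>. \<forall>a b. smooth_on (cmap c ` (U \<inter> cdom c)) (\<lambda>u. g (cinv c u) c [a, b]))"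

definition metric_near ::
    "('x::topological_space, 'n::finite) chart set \<Rightarrow> nat \<Rightarrow> nat \<Rightarrow> 'x \<Rightarrow>
     ('x \<Rightarrow> ('x, 'n) tens) \<Rightarrow> bool" where
  "metric_near \<A> r s x g \<longleftrightarrow> (\<exists>U. x \<in> U \<and> metric_on \<A> r s U g)"

text \<open>The metric \<open>\<tau>\<^sub>*g\<close>, for \<open>\<tau>\<close> a diffeomorphism defined on \<open>U\<close>. It is meaningful at the points
  \<open>\<tau> x\<close> with \<open>x \<in> U\<close> in the domain of \<open>g\<close>.\<close>

definition push_metric ::
    "('x, 'n::finite) chart set \<Rightarrow> 'x set \<Rightarrow> ('x \<Rightarrow> 'x) \<Rightarrow>
     ('x \<Rightarrow> ('x, 'n) tens) \<Rightarrow> 'x \<Rightarrow> ('x, 'n) tens" where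
  "push_metric \<A> U \<tau> g y = (\<lambda>c'.
     if c' \<in> charts_at \<A> y
     then let x = inv_into U \<tau> y; c = some_chart \<A> x
          in tensor_act (transpose (dmat (inv_into U \<tau>) c' c y)) 2 (g x c)
     else (\<lambda>_. 0))"

text \<open>\<open>(u, g\<^sub>a\<^sub>b, g\<^sub>a\<^sub>b\<^sub>,\<^sub>k, g\<^sub>a\<^sub>b\<^sub>,\<^sub>k\<^sub>l)\<close> in a chart.\<close>

type_synonym 'n jcoord =
  "(real^'n) \<times> (real^'n^'n) \<times> (real^'n^'n^'n) \<times> (real^'n^'n^'n^'n)"

definition metric_coords ::
    "('x, 'n::finite) chart \<Rightarrow> 'x \<Rightarrow> ('x \<Rightarrow> ('x, 'n) tens) \<Rightarrow> 'n jcoord" where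
  "metric_coords c x g =
     (let G = (\<lambda>a b u. g (cinv c u) c [a, b]); u = cmap c x
      in (u, \<chi> a b. G a b u, \<chi> a b k. pd k (G a b) u, \<chi> a b k l. pd l (pd k (G a b)) u))"

text \<open>A 2-jet at \<open>x\<close> is an equivalence class of metrics near \<open>x\<close>, for the relation of having the
  same derivatives up to order 2 at \<open>x\<close>; the base point is recorded.\<close>

type_synonym ('x, 'n) jet = "'x \<times> ('x \<Rightarrow> ('x, 'n) tens) set"

definition jet2 ::
    "('x::topological_space, 'n::finite) chart set \<Rightarrow> nat \<Rightarrow> nat \<Rightarrow> 'x \<Rightarrow>
     ('x \<Rightarrow> ('x, 'n) tens) \<Rightarrow> ('x, 'n) jet" where
  "jet2 \<A> r s x g =
     (x, {h. metric_near \<A> r s x h \<and>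
             (\<forall>c\<in>charts_at \<A> x. metric_coords c x h = metric_coords c x g)})"

definition J2M ::
    "('x::topological_space, 'n::finite) chart set \<Rightarrow> nat \<Rightarrow> nat \<Rightarrow> ('x, 'n) jet set" where
  "J2M \<A> r s = {jet2 \<A> r s x g | x g. metric_near \<A> r s x g}"

definition jet_coords :: "('x, 'n::finite) chart \<Rightarrow> ('x, 'n) jet \<Rightarrow> 'n jcoord" where
  "jet_coords c j = metric_coords c (fst j) (SOME g. g \<in> snd j)"

text \<open>Smoothness of \<open>T\<close>: its components are smooth functions of the coordinates of the jet. The
  coordinates are constrained by symmetry, hence range over an open subset of a proper subspace;
  smoothness there means, as usual, local extendability to a smooth function on an open set.\<close>

definition second_order_tensor ::
    "('x::topological_space, 'n::finite) chart set \<Rightarrow> nat \<Rightarrow> nat \<Rightarrow> nat \<Rightarrow>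
     (('x, 'n) jet \<Rightarrow> ('x, 'n) tens) \<Rightarrow> bool" where
  "second_order_tensor \<A> r s p T \<longleftrightarrow>
     (\<forall>j\<in>J2M \<A> r s. T j \<in> ctens \<A> p (fst j)) \<and>
     (\<forall>c\<in>\<A>. \<forall>j\<in>J2M \<A> r s. \<forall>I. fst j \<in> cdom c \<and> length I = p \<longrightarrow>
        (\<exists>W F. open W \<and> jet_coords c j \<in> W \<and> smooth_on W F \<and>
           (\<forall>j'\<in>J2M \<A> r s. fst j' \<in> cdom c \<and> jet_coords c j' \<in> W \<longrightarrow>
              T j' c I = F (jet_coords c j'))))"

definition natural_tensor ::
    "('x::topological_space, 'n::finite) chart set \<Rightarrow> nat \<Rightarrow> nat \<Rightarrow> nat \<Rightarrow>
     (('x, 'n) jet \<Rightarrow> ('x, 'n) tens) \<Rightarrow> bool" where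
  "natural_tensor \<A> r s p T \<longleftrightarrow>
     (\<forall>U V \<tau> x g. local_diffeo \<A> U V \<tau> \<and> x \<in> U \<and> metric_near \<A> r s x g \<longrightarrow>
        T (jet2 \<A> r s (\<tau> x) (push_metric \<A> U \<tau> g)) = push_tens \<A> p \<tau> x (T (jet2 \<A> r s x g)))"

definition S22 :: "('x, 'n::finite) chart set \<Rightarrow> 'x \<Rightarrow> ('x, 'n) tens set" where
  "S22 \<A> x = {S \<in> cotens \<A> 4 x. \<forall>c a b k l.
     S c [a, b, k, l] = S c [b, a, k, l] \<and> S c [a, b, k, l] = S c [a, b, l, k]}"

definition S22_dual :: "('x, 'n::finite) chart set \<Rightarrow> 'x \<Rightarrow> ('x, 'n) tens set" where
  "S22_dual \<A> x = {\<nu> \<in> ctens \<A> 4 x. \<forall>c a b k l.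
     \<nu> c [a, b, k, l] = \<nu> c [b, a, k, l] \<and> \<nu> c [a, b, k, l] = \<nu> c [a, b, l, k]}"

text \<open>The contravariant normal tensors of order 2: \<open>S22_dual\<close> is dual to \<open>S22\<close>, and \<open>N2\<close> is the
  kernel on it of the symmetrization over the last three of the four indices.\<close>

definition N2 :: "('x, 'n::finite) chart set \<Rightarrow> 'x \<Rightarrow> ('x, 'n) tens set" where
  "N2 \<A> x = {\<nu> \<in> S22_dual \<A> x. \<forall>c a b k l.
     (\<nu> c [a, b, k, l] + \<nu> c [a, b, l, k] + \<nu> c [a, k, b, l] +
      \<nu> c [a, k, l, b] + \<nu> c [a, l, b, k] + \<nu> c [a, l, k, b]) / 6 = 0}"

text \<open>For a linear subspace \<open>W\<close> of the contravariant tensors at \<open>x\<close>, the tensor product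
  of the \<open>p\<close>-th tensor power of the tangent space with \<open>W\<close>: finite sums of products \<open>t \<otimes> \<nu>\<close>.\<close>

definition tens_prod ::
    "('x, 'n::finite) chart set \<Rightarrow> nat \<Rightarrow> 'x \<Rightarrow> ('x, 'n) tens set \<Rightarrow> ('x, 'n) tens set" where
  "tens_prod \<A> p x W = {D. \<exists>ts. set ts \<subseteq> ctens \<A> p x \<times> W \<and>
     (\<forall>c L. D c L = (\<Sum>(t, \<nu>)\<leftarrow>ts. t c (take p L) * \<nu> c (drop p L)))}"

text \<open>The affine structure on the fibre of \<open>J\<^sup>2M \<rightarrow> J\<^sup>1M\<close> through \<open>j\<close>.\<close>

definition jet_add ::
    "('x::topological_space, 'n::finite) chart set \<Rightarrow> nat \<Rightarrow> nat \<Rightarrow>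
     ('x, 'n) jet \<Rightarrow> ('x, 'n) tens \<Rightarrow> ('x, 'n) jet" where
  "jet_add \<A> r s j S = (THE j'. j' \<in> J2M \<A> r s \<and> fst j' = fst j \<and>
     (\<forall>c\<in>charts_at \<A> (fst j).
        jet_coords c j' = jet_coords c j + (0, 0, 0, \<chi> a b k l. S c [a, b, k, l])))"

text \<open>The tangent linear map at \<open>j\<close> of the restriction of \<open>T\<close> to this fibre sends \<open>S\<close> to the velocity
  at \<open>0\<close> of \<open>t \<mapsto> T (j + t S)\<close>. It is regarded as a contravariant tensor \<open>D\<close> via the full contraction
  of \<open>S22_dual\<close> with \<open>S22\<close>.\<close>

definition tensor_deriv ::
    "('x::topological_space, 'n::finite) chart set \<Rightarrow> nat \<Rightarrow> nat \<Rightarrow> nat \<Rightarrow>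
     (('x, 'n) jet \<Rightarrow> ('x, 'n) tens) \<Rightarrow> ('x, 'n) jet \<Rightarrow> ('x, 'n) tens" where
  "tensor_deriv \<A> r s p T j = (THE D.
     D \<in> tens_prod \<A> p (fst j) (S22_dual \<A> (fst j)) \<and>
     (\<forall>S\<in>S22 \<A> (fst j). \<forall>c\<in>charts_at \<A> (fst j). \<forall>I. length I = p \<longrightarrow>
        ((\<lambda>t. T (jet_add \<A> r s j (\<lambda>c L. t * S c L)) c I) has_real_derivative
           (\<Sum>a\<in>UNIV. \<Sum>b\<in>UNIV. \<Sum>k\<in>UNIV. \<Sum>l\<in>UNIV.
              D c (I @ [a, b, k, l]) * S c [a, b, k, l])) (at 0)))"

end

theory Submission
  imports Defs
begin

text \<open>Let \<open>g\<close> be a metric near \<open>x\<close>, \<open>l\<close> a covector and \<open>v\<close> a vector at \<open>x\<close> with \<open>l(v) = 1\<close>. In a chart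
  centred at \<open>x\<close> the shear \<open>u \<mapsto> u + (\<phi>(l(u)) - l(u)) v\<close>, where \<open>\<phi>(z) = z + q z\<^sup>3 + \<dots>\<close>, agrees with
  the identity up to order 2. Hence it fixes every tensor at \<open>x\<close>, but pulling \<open>g\<close> back along it adds
  \<open>6 q (l\<^sub>a w\<^sub>b + l\<^sub>b w\<^sub>a) l\<^sub>k l\<^sub>l\<close> to the second derivatives \<open>g\<^sub>a\<^sub>b\<^sub>,\<^sub>k\<^sub>l\<close>, with \<open>w = g(v, -)\<close>. A natural tensor
  is therefore constant in these directions of the fibre of \<open>J\<^sup>2M \<rightarrow> J\<^sup>1M\<close>, so each component \<open>\<nu>\<close> of its
  derivative satisfies \<open>\<nu>\<^sup>a\<^sup>b\<^sup>k\<^sup>l w\<^sub>a l\<^sub>b l\<^sub>k l\<^sub>l = 0\<close>. Since this is linear in \<open>w\<close>, it holds for all \<open>w\<close> and \<open>l\<close>, and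
  polarization in \<open>l\<close> says that the symmetrization of \<open>\<nu>\<close> over its last three indices vanishes.\<close>

section \<open>Smooth functions\<close>

text \<open>The shear is the time-q flow of the vector field l(u)^3 v. As l(v) = 1, the coordinate z
  = l(u) obeys z' = z^3, so 1/z^2 falls at the constant rate 2, whence phi(z) = z (1 - 2 q
  z^2)^(-1/2). A polynomial shear u + q l(u)^3 v would need the inverse function theorem to yield a
  diffeomorphism between open sets; a flow has the explicit inverse with parameter - q. For the same
  reason, pushing forward with - q is pulling back with q.

  Invariance holds for every q, not just infinitesimally: T is constant on a whole line j + q S of
  the fibre, and differentiating a constant finishes the geometric part.

  What shapes the rest is that \<open>jet_add\<close> and \<open>tensor_deriv\<close> are definite
  descriptions. Each j + t S must be exhibited as the jet of a metric of the right signature, and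
  the derivative as a tensor that is determined by its contractions with \<open>S22\<close>.

  The condition l(v) = 1 leaves out the pairs with l(v) = 0; linearity in v recovers them, and
  non-degeneracy of g turns all v into all w.\<close>

definition dd :: "'a::real_normed_vector \<Rightarrow> ('a \<Rightarrow> 'b::real_normed_vector) \<Rightarrow> 'a \<Rightarrow> 'b" where
  "dd v f x = frechet_derivative f (at x) v"

lemma pd_eq_dd: "pd k f = dd (axis k 1) f"
  by (simp add: pd_def dd_def fun_eq_iff)

lemma dd_eqI: "(f has_derivative D) (at x) \<Longrightarrow> dd v f x = D v"
  unfolding dd_def using frechet_derivative_at by metis

lemma has_derivative_dd: "f differentiable (at x) \<Longrightarrow> (f has_derivative (\<lambda>v. dd v f x)) (at x)"
  unfolding dd_def using frechet_derivative_works by fastforce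

lemma C_on_Suc_dd:
  "C_on (Suc k) S f \<longleftrightarrow> (\<forall>x\<in>S. f differentiable (at x)) \<and> (\<forall>v. C_on k S (dd v f))"
  by (simp add: dd_def[abs_def])

declare C_on.simps(2) [simp del]

lemma has_derivative_cong_open:
  assumes "open S" "x \<in> S" "\<And>y. y \<in> S \<Longrightarrow> f y = g y"
  shows "(f has_derivative D) (at x) \<longleftrightarrow> (g has_derivative D) (at x)"
  using assms has_derivative_transform_within_open by metis

lemma dd_cong_open:
  assumes "open S" "x \<in> S" "\<And>y. y \<in> S \<Longrightarrow> f y = g y"
  shows "dd v f x = dd v g x"
  unfolding dd_def frechet_derivative_def using has_derivative_cong_open[OF assms] by simp

lemma C_on_cong:
  assumes "open S" "\<And>y. y \<in> S \<Longrightarrow> f y = g y"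
  shows "C_on k S f \<Longrightarrow> C_on k S g"
  using assms(2)
proof (induction k arbitrary: f g)
  case 0
  then show ?case using continuous_on_eq by auto
next
  case (Suc k)
  have "g differentiable (at x)" if "x \<in> S" for x
  proof -
    have "(f has_derivative (\<lambda>v. dd v f x)) (at x)"
      using Suc.prems(1) that has_derivative_dd unfolding C_on_Suc_dd by blast
    then show ?thesis
      using has_derivative_cong_open[OF assms(1) that, of f g] Suc.prems(2) differentiableI by blast
  qed
  moreover have "C_on k S (dd v g)" for v
    using Suc.IH[of "dd v f" "dd v g"] Suc.prems dd_cong_open[OF assms(1)] C_on_Suc_dd by blast
  ultimately show ?case by (auto simp: C_on_Suc_dd)
qed

lemma C_on_subset: "C_on k S f \<Longrightarrow> T \<subseteq> S \<Longrightarrow> C_on k T f"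
proof (induction k arbitrary: f)
  case 0 then show ?case using continuous_on_subset by auto
next
  case (Suc k) then show ?case unfolding C_on_Suc_dd by blast
qed

lemma C_on_SucD: "C_on (Suc k) S f \<Longrightarrow> C_on k S f"
proof (induction k arbitrary: f)
  case 0
  then show ?case unfolding C_on_Suc_dd C_on.simps(1)
    by (simp add: continuous_at_imp_continuous_on differentiable_imp_continuous_within)
next
  case (Suc k) then show ?case using C_on_Suc_dd by metis
qed

lemma C_on_const: "C_on k S (\<lambda>_. c)"
proof (induction k arbitrary: c)
  case (Suc k)
  have "dd v (\<lambda>_. c) = (\<lambda>_. 0)" for v :: 'a
    by (rule ext, rule dd_eqI) (rule has_derivative_const)
  then show ?case using Suc by (auto simp: C_on_Suc_dd)
qed auto

lemma dd_linear: "bounded_linear L \<Longrightarrow> dd v L x = L v"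
  by (rule dd_eqI) (rule bounded_linear_imp_has_derivative)

lemma C_on_linear: assumes "bounded_linear L" shows "C_on k S L"
proof (cases k)
  case 0
  then show ?thesis using assms linear_continuous_on by auto
next
  case (Suc m)
  have "dd v L = (\<lambda>_. L v)" for v using dd_linear[OF assms] by auto
  moreover have "\<forall>x\<in>S. L differentiable (at x)"
    using assms bounded_linear_imp_has_derivative differentiable_def by blast
  ultimately show ?thesis unfolding Suc C_on_Suc_dd by (simp add: C_on_const)
qed

lemma C_on_compose_linear:
  assumes "bounded_linear L" "open S"
  shows "C_on k S f \<Longrightarrow> C_on k S (\<lambda>x. L (f x))"
proof (induction k arbitrary: f)
  case 0 then show ?case
    using assms(1) bounded_linear.continuous_on by auto
next
  case (Suc k)
  have d: "((\<lambda>x. L (f x)) has_derivative (\<lambda>v. L (dd v f x))) (at x)" if "x \<in> S" for x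
    by (rule bounded_linear.has_derivative[OF assms(1) has_derivative_dd])
      (use Suc.prems that in \<open>simp_all add: C_on_Suc_dd\<close>)
  have "C_on k S (dd v (\<lambda>x. L (f x)))" for v
    by (rule C_on_cong[OF assms(2) _ Suc.IH[of "dd v f"]])
       (use Suc.prems in \<open>auto simp: C_on_Suc_dd dd_eqI[OF d]\<close>)
  moreover have "\<forall>x\<in>S. (\<lambda>x. L (f x)) differentiable (at x)" using d differentiableI by blast
  ultimately show ?case unfolding C_on_Suc_dd by simp
qed

lemma C_on_add:
  assumes "open S"
  shows "C_on k S f \<Longrightarrow> C_on k S g \<Longrightarrow> C_on k S (\<lambda>x. f x + g x)"
proof (induction k arbitrary: f g)
  case 0 then show ?case by (auto intro: continuous_intros)
next
  case (Suc k)
  have d: "((\<lambda>x. f x + g x) has_derivative (\<lambda>v. dd v f x + dd v g x)) (at x)" if "x \<in> S" for x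
    by (rule has_derivative_add[OF has_derivative_dd has_derivative_dd])
      (use Suc.prems that in \<open>simp_all add: C_on_Suc_dd\<close>)
  have "C_on k S (dd v (\<lambda>x. f x + g x))" for v
    by (rule C_on_cong[OF assms _ Suc.IH[of "dd v f" "dd v g"]])
       (use Suc.prems in \<open>auto simp: C_on_Suc_dd dd_eqI[OF d]\<close>)
  moreover have "\<forall>x\<in>S. (\<lambda>x. f x + g x) differentiable (at x)" using d differentiableI by blast
  ultimately show ?case unfolding C_on_Suc_dd by simp
qed

lemma C_on_bilinear:
  assumes "bounded_bilinear B" "open S"
  shows "C_on k S f \<Longrightarrow> C_on k S g \<Longrightarrow> C_on k S (\<lambda>x. B (f x) (g x))"
proof (induction k arbitrary: f g)
  case 0 then show ?case using bounded_bilinear.continuous_on[OF assms(1), of S f g] by simp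
next
  case (Suc k)
  have d: "((\<lambda>x. B (f x) (g x)) has_derivative (\<lambda>v. B (f x) (dd v g x) + B (dd v f x) (g x))) (at x)"
    if "x \<in> S" for x
    by (rule bounded_bilinear.FDERIV[OF assms(1) has_derivative_dd has_derivative_dd])
      (use Suc.prems that in \<open>simp_all add: C_on_Suc_dd\<close>)
  have fg: "C_on k S f" "C_on k S g" using Suc.prems C_on_SucD by auto
  have ds: "C_on k S (dd v f)" "C_on k S (dd v g)" for v using Suc.prems by (simp_all add: C_on_Suc_dd)
  have "C_on k S (dd v (\<lambda>x. B (f x) (g x)))" for v
    by (rule C_on_cong[OF assms(2) _
          C_on_add[OF assms(2) Suc.IH[OF fg(1) ds(2)[of v]] Suc.IH[OF ds(1)[of v] fg(2)]]])
       (simp add: dd_eqI[OF d])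
  moreover have "\<forall>x\<in>S. (\<lambda>x. B (f x) (g x)) differentiable (at x)" using d differentiableI by blast
  ultimately show ?case unfolding C_on_Suc_dd by simp
qed

lemma C_on_sum:
  assumes "open S" "\<And>i. i \<in> I \<Longrightarrow> C_on k S (f i)"
  shows "C_on k S (\<lambda>x. \<Sum>i\<in>I. f i x)"
  using assms(2) by (induction I rule: infinite_finite_induct) (simp_all add: C_on_const C_on_add[OF assms(1)])

lemma dd_compose:
  fixes g :: "'a::real_normed_vector \<Rightarrow> 'b::real_normed_vector"
  assumes "f differentiable (at (g x))" "g differentiable (at x)"
  shows "dd v (\<lambda>y. f (g y)) x = dd (dd v g x) f (g x)"
    and "((\<lambda>y. f (g y)) has_derivative (\<lambda>v. dd (dd v g x) f (g x))) (at x)"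
proof -
  show *: "((\<lambda>y. f (g y)) has_derivative (\<lambda>v. dd (dd v g x) f (g x))) (at x)"
    using has_derivative_compose[OF has_derivative_dd[OF assms(2)] has_derivative_dd[OF assms(1)]] .
  show "dd v (\<lambda>y. f (g y)) x = dd (dd v g x) f (g x)" by (rule dd_eqI[OF *])
qed

lemma dd_Basis:
  fixes f :: "'b::euclidean_space \<Rightarrow> 'c::real_normed_vector"
  assumes "f differentiable (at x)"
  shows "dd v f x = (\<Sum>i\<in>Basis. (v \<bullet> i) *\<^sub>R dd i f x)"
proof -
  have L: "linear (\<lambda>v. dd v f x)" using has_derivative_dd[OF assms] has_derivative_linear by blast
  have "dd v f x = dd (\<Sum>i\<in>Basis. (v \<bullet> i) *\<^sub>R i) f x" by (simp add: euclidean_representation)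
  also have "\<dots> = (\<Sum>i\<in>Basis. (v \<bullet> i) *\<^sub>R dd i f x)"
    using linear_sum[OF L, of "\<lambda>i. (v \<bullet> i) *\<^sub>R i" Basis] linear_cmul[OF L] by simp
  finally show ?thesis .
qed

text \<open>The chain rule differentiates f in the direction \<open>dd v g x\<close>, which moves
  with x, so the induction hypothesis does not apply directly. Expanding this direction in
  \<open>Basis\<close> leaves products of C^k coefficients with \<open>dd i f (g x)\<close> for
  fixed i; hence the Euclidean type in the middle.\<close>

lemma C_on_compose:
  fixes g :: "'a::real_normed_vector \<Rightarrow> 'b::euclidean_space"
  assumes "open S" "\<And>x. x \<in> S \<Longrightarrow> g x \<in> T"
  shows "C_on k T f \<Longrightarrow> C_on k S g \<Longrightarrow> C_on k S (\<lambda>x. f (g x))"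
proof (induction k arbitrary: f)
  case 0
  show ?case unfolding C_on.simps
    by (rule continuous_on_compose2[of T f S g]) (use 0 assms(2) in auto)
next
  case (Suc k)
  have df: "f differentiable (at (g x))" and dg: "g differentiable (at x)" if "x \<in> S" for x
    using Suc.prems that assms(2)[OF that] by (simp_all add: C_on_Suc_dd)
  have g: "C_on k S g" by (rule C_on_SucD[OF Suc.prems(2)])
  have eq: "dd v (\<lambda>x. f (g x)) x = (\<Sum>i\<in>Basis. (dd v g x \<bullet> i) *\<^sub>R dd i f (g x))" if "x \<in> S" for x v
    by (rule trans[OF dd_compose(1)[OF df[OF that] dg[OF that]] dd_Basis[OF df[OF that]]])
  have "C_on k S (dd v (\<lambda>x. f (g x)))" for v
  proof (rule C_on_cong[OF assms(1)])
    show "C_on k S (\<lambda>x. \<Sum>i\<in>Basis. (dd v g x \<bullet> i) *\<^sub>R dd i f (g x))"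
    proof (rule C_on_sum[OF assms(1)], rule C_on_bilinear[OF bounded_bilinear_scaleR assms(1)])
      fix i :: 'b
      show "C_on k S (\<lambda>x. dd v g x \<bullet> i)"
        by (rule C_on_compose_linear[OF bounded_linear_inner_left assms(1)])
          (use Suc.prems(2) in \<open>simp add: C_on_Suc_dd\<close>)
      show "C_on k S (\<lambda>x. dd i f (g x))"
        by (rule Suc.IH[OF _ g]) (use Suc.prems(1) in \<open>simp add: C_on_Suc_dd\<close>)
    qed
  qed (simp add: eq)
  moreover have "(\<lambda>x. f (g x)) differentiable (at x)" if "x \<in> S" for x
    by (rule differentiableI[OF dd_compose(2)[OF df[OF that] dg[OF that]]])
  ultimately show ?case unfolding C_on_Suc_dd by simp
qed

lemma smooth_on_cong:
  assumes "open S" "\<And>y. y \<in> S \<Longrightarrow> f y = g y" "smooth_on S f"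
  shows "smooth_on S g"
  using assms(3) C_on_cong[of S f g, OF assms(1,2)] unfolding smooth_on_def by simp

lemma smooth_on_subset: "smooth_on S f \<Longrightarrow> T \<subseteq> S \<Longrightarrow> smooth_on T f"
  using C_on_subset unfolding smooth_on_def by blast

lemma smooth_on_const: "smooth_on S (\<lambda>_. c)"
  using C_on_const unfolding smooth_on_def by blast

lemma smooth_on_linear: "bounded_linear L \<Longrightarrow> smooth_on S L"
  using C_on_linear unfolding smooth_on_def by blast

lemma smooth_on_id: "smooth_on S (\<lambda>x. x)"
  by (rule smooth_on_linear) (rule bounded_linear_ident)

lemma smooth_on_compose_linear:
  "bounded_linear L \<Longrightarrow> open S \<Longrightarrow> smooth_on S f \<Longrightarrow> smooth_on S (\<lambda>x. L (f x))"
  by (simp add: smooth_on_def C_on_compose_linear)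

lemma smooth_on_add: "open S \<Longrightarrow> smooth_on S f \<Longrightarrow> smooth_on S g \<Longrightarrow> smooth_on S (\<lambda>x. f x + g x)"
  by (simp add: smooth_on_def C_on_add)

lemma smooth_on_mult:
  fixes f g :: "'a::real_normed_vector \<Rightarrow> real"
  shows "open S \<Longrightarrow> smooth_on S f \<Longrightarrow> smooth_on S g \<Longrightarrow> smooth_on S (\<lambda>x. f x * g x)"
  by (simp add: smooth_on_def C_on_bilinear[OF bounded_bilinear_mult])

lemma smooth_on_scaleR:
  "open S \<Longrightarrow> smooth_on S f \<Longrightarrow> smooth_on S g \<Longrightarrow> smooth_on S (\<lambda>x. f x *\<^sub>R g x)"
  by (simp add: smooth_on_def C_on_bilinear[OF bounded_bilinear_scaleR])

lemma smooth_on_minus: "open S \<Longrightarrow> smooth_on S f \<Longrightarrow> smooth_on S g \<Longrightarrow> smooth_on S (\<lambda>x. f x - g x)"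
  using smooth_on_add[of S f "\<lambda>x. - g x"]
    smooth_on_compose_linear[OF bounded_linear_minus[OF bounded_linear_ident], of S g] by simp

lemma smooth_on_sum:
  "open S \<Longrightarrow> (\<And>i. i \<in> I \<Longrightarrow> smooth_on S (f i)) \<Longrightarrow> smooth_on S (\<lambda>x. \<Sum>i\<in>I. f i x)"
  by (simp add: smooth_on_def C_on_sum)

lemma smooth_on_compose:
  fixes g :: "'a::real_normed_vector \<Rightarrow> 'b::euclidean_space"
  assumes "open S" "\<And>x. x \<in> S \<Longrightarrow> g x \<in> T" "smooth_on T f" "smooth_on S g"
  shows "smooth_on S (\<lambda>x. f (g x))"
  unfolding smooth_on_def
proof
  fix k
  show "C_on k S (\<lambda>x. f (g x))"
    by (rule C_on_compose[OF assms(1,2)]) (use assms(3,4) in \<open>simp_all add: smooth_on_def\<close>)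
qed

lemma smooth_on_dd: "smooth_on S f \<Longrightarrow> smooth_on S (dd v f)"
  unfolding smooth_on_def using C_on_Suc_dd by blast

lemma smooth_on_differentiable: "smooth_on S f \<Longrightarrow> x \<in> S \<Longrightarrow> f differentiable (at x)"
  unfolding smooth_on_def using C_on_Suc_dd[of 0 S f] by blast

lemma smooth_on_continuous: "smooth_on S f \<Longrightarrow> continuous_on S f"
  unfolding smooth_on_def using C_on.simps(1)[of S f] by metis

text \<open>Differentiation lowers the exponent by one, so the induction runs over all exponents at
  once.\<close>

lemma C_on_powr:
  fixes f :: "'a::real_normed_vector \<Rightarrow> real"
  assumes "open S" "\<And>x. x \<in> S \<Longrightarrow> f x > 0" "C_on k S f"
  shows "C_on k S (\<lambda>x. f x powr a)"
  using assms(3)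
proof (induction k arbitrary: a)
  case 0
  have "\<forall>x\<in>S. f x \<noteq> 0" using assms(2) by force
  then show ?case using 0 continuous_on_powr[of S f "\<lambda>_. a"] by simp
next
  case (Suc k)
  have d: "((\<lambda>x. f x powr a) has_derivative (\<lambda>v. (a * f x powr (a - 1)) * dd v f x)) (at x)" if "x \<in> S" for x
  proof -
    have "((\<lambda>z. z powr a) has_derivative (\<lambda>h. h * (a * f x powr (a - 1)))) (at (f x))"
      using has_real_derivative_powr[OF assms(2)[OF that], of a]
      by (simp add: has_field_derivative_def mult.commute[of _ "a * _"])
    moreover have "(f has_derivative (\<lambda>v. dd v f x)) (at x)"
      using has_derivative_dd Suc.prems that C_on_Suc_dd by blast
    ultimately show ?thesis
      using has_derivative_compose[of f "\<lambda>v. dd v f x" x UNIV "\<lambda>z. z powr a" "\<lambda>h. h * (a * f x powr (a - 1))"]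
      by (simp only: mult.commute)
  qed
  have "C_on k S (dd v (\<lambda>x. f x powr a))" for v
  proof (rule C_on_cong[OF assms(1)])
    show "C_on k S (\<lambda>x. (a * f x powr (a - 1)) * dd v f x)"
      by (rule C_on_bilinear[OF bounded_bilinear_mult assms(1)
            C_on_bilinear[OF bounded_bilinear_mult assms(1) C_on_const Suc.IH[OF C_on_SucD[OF Suc.prems]]]])
        (use Suc.prems in \<open>simp add: C_on_Suc_dd\<close>)
  qed (simp add: dd_eqI[OF d])
  moreover have "\<forall>x\<in>S. (\<lambda>x. f x powr a) differentiable (at x)" using d differentiableI by blast
  ultimately show ?case unfolding C_on_Suc_dd by simp
qed

lemma smooth_on_powr:
  fixes f :: "'a::real_normed_vector \<Rightarrow> real"
  assumes "open S" "\<And>x. x \<in> S \<Longrightarrow> f x > 0" "smooth_on S f"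
  shows "smooth_on S (\<lambda>x. f x powr a)"
  using C_on_powr[where f = f, OF assms(1,2)] assms(3) unfolding smooth_on_def by simp

lemma smooth_on_vec_nth:
  fixes f :: "'a::real_normed_vector \<Rightarrow> real^'n"
  shows "open S \<Longrightarrow> smooth_on S f \<Longrightarrow> smooth_on S (\<lambda>x. f x $ i)"
  by (rule smooth_on_compose_linear[OF bounded_linear_vec_nth])

section \<open>Rules for directional derivatives\<close>

lemma dd_add:
  assumes "f differentiable (at x)" "g differentiable (at x)"
  shows "dd v (\<lambda>x. f x + g x) x = dd v f x + dd v g x"
  by (rule dd_eqI[OF has_derivative_add[OF has_derivative_dd has_derivative_dd]]) fact+

lemma dd_minus:
  assumes "f differentiable (at x)" "g differentiable (at x)"
  shows "dd v (\<lambda>x. f x - g x) x = dd v f x - dd v g x"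
  by (rule dd_eqI[OF has_derivative_diff[OF has_derivative_dd has_derivative_dd]]) fact+

lemma dd_mult:
  fixes f g :: "'a::real_normed_vector \<Rightarrow> real"
  assumes "f differentiable (at x)" "g differentiable (at x)"
  shows "dd v (\<lambda>x. f x * g x) x = f x * dd v g x + dd v f x * g x"
  by (rule dd_eqI[OF has_derivative_mult[OF has_derivative_dd has_derivative_dd]]) fact+

lemma dd_const: "dd v (\<lambda>_. c) x = 0"
  by (rule dd_eqI) (rule has_derivative_const)

lemma dd_add_vec:
  assumes "f differentiable (at x)"
  shows "dd (v + w) f x = dd v f x + dd w f x" and "dd (c *\<^sub>R v) f x = c *\<^sub>R dd v f x"
proof -
  have L: "linear (\<lambda>v. dd v f x)" using has_derivative_dd[OF assms] has_derivative_linear by blast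
  show "dd (v + w) f x = dd v f x + dd w f x" "dd (c *\<^sub>R v) f x = c *\<^sub>R dd v f x"
    using linear_add[OF L] linear_cmul[OF L] by auto
qed

section \<open>Second-order contact\<close>

text \<open>Smoothness of a germ. Coordinate expressions of transported fields agree with explicit
  formulas only near a point, so identities are used as eventual equalities at
  \<open>nhds u\<close>, and smoothness has to be just as local.\<close>

definition smooth_near :: "'a::real_normed_vector \<Rightarrow> ('a \<Rightarrow> 'b::real_normed_vector) \<Rightarrow> bool" where
  "smooth_near u f \<longleftrightarrow> (\<exists>S. open S \<and> u \<in> S \<and> smooth_on S f)"

lemma smooth_nearI: "open S \<Longrightarrow> u \<in> S \<Longrightarrow> smooth_on S f \<Longrightarrow> smooth_near u f"
  unfolding smooth_near_def by blast

lemma smooth_near2E: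
  assumes "smooth_near u f" "smooth_near u g"
  obtains S where "open S" "u \<in> S" "smooth_on S f" "smooth_on S g"
proof -
  obtain S T where "open S" "u \<in> S" "smooth_on S f" "open T" "u \<in> T" "smooth_on T g"
    using assms unfolding smooth_near_def by blast
  then show thesis
    using that[of "S \<inter> T"] smooth_on_subset[of S f "S \<inter> T"] smooth_on_subset[of T g "S \<inter> T"] by auto
qed

lemma smooth_near_const: "smooth_near u (\<lambda>_. c)"
  using smooth_nearI[OF open_UNIV UNIV_I smooth_on_const] .

lemma smooth_near_add: "smooth_near u f \<Longrightarrow> smooth_near u g \<Longrightarrow> smooth_near u (\<lambda>x. f x + g x)"
  by (erule (1) smooth_near2E) (rule smooth_nearI, assumption, assumption, rule smooth_on_add)

lemma smooth_near_minus: "smooth_near u f \<Longrightarrow> smooth_near u g \<Longrightarrow> smooth_near u (\<lambda>x. f x - g x)"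
  by (erule (1) smooth_near2E) (rule smooth_nearI, assumption, assumption, rule smooth_on_minus)

lemma smooth_near_mult:
  fixes f g :: "'a::real_normed_vector \<Rightarrow> real"
  shows "smooth_near u f \<Longrightarrow> smooth_near u g \<Longrightarrow> smooth_near u (\<lambda>x. f x * g x)"
  by (erule (1) smooth_near2E) (rule smooth_nearI, assumption, assumption, rule smooth_on_mult)

lemma smooth_near_sum:
  "(\<And>i. i \<in> I \<Longrightarrow> smooth_near u (f i)) \<Longrightarrow> smooth_near u (\<lambda>x. \<Sum>i\<in>I. f i x)"
  by (induction I rule: infinite_finite_induct) (simp_all add: smooth_near_const smooth_near_add)

lemma smooth_near_dd: "smooth_near u f \<Longrightarrow> smooth_near u (dd v f)"
  unfolding smooth_near_def using smooth_on_dd[of _ f v] by blast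

lemma smooth_near_differentiable: "smooth_near u f \<Longrightarrow> f differentiable (at u)"
  unfolding smooth_near_def using smooth_on_differentiable[of _ f u] by blast

lemma smooth_near_compose:
  fixes g :: "'a::real_normed_vector \<Rightarrow> 'b::euclidean_space"
  assumes "smooth_near (g u) f" "smooth_near u g"
  shows "smooth_near u (\<lambda>x. f (g x))"
proof -
  obtain S T where S: "open S" "u \<in> S" "smooth_on S g" and T: "open T" "g u \<in> T" "smooth_on T f"
    using assms unfolding smooth_near_def by blast
  have o: "open (S \<inter> g -` T)"
    using continuous_open_preimage[OF smooth_on_continuous[OF S(3)] S(1) T(1)] .
  have "smooth_on (S \<inter> g -` T) (\<lambda>x. f (g x))"
    by (rule smooth_on_compose[OF o _ T(3) smooth_on_subset[OF S(3)]]) auto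
  then show ?thesis using o S(2) T(2) smooth_nearI[of "S \<inter> g -` T" u] by blast
qed

lemma dd_cong_near:
  assumes "\<forall>\<^sub>F x in nhds u. f x = g x"
  shows "dd v f u = dd v g u"
proof -
  obtain S where "open S" "u \<in> S" "\<And>x. x \<in> S \<Longrightarrow> f x = g x"
    using assms unfolding eventually_nhds by blast
  then show ?thesis using dd_cong_open[of S u f g v] by blast
qed

lemma dd_dd_cong_near:
  assumes "\<forall>\<^sub>F x in nhds u. f x = g x"
  shows "dd w (dd v f) u = dd w (dd v g) u"
proof (rule dd_cong_near)
  obtain S where "open S" "u \<in> S" "\<And>x. x \<in> S \<Longrightarrow> f x = g x"
    using assms unfolding eventually_nhds by blast
  then show "\<forall>\<^sub>F x in nhds u. dd v f x = dd v g x"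
    unfolding eventually_nhds using dd_cong_open[of S _ f g v] by blast
qed

lemma smooth_near_cong:
  assumes "\<forall>\<^sub>F x in nhds u. f x = g x" "smooth_near u f"
  shows "smooth_near u g"
proof -
  obtain S T where S: "open S" "u \<in> S" "\<And>x. x \<in> S \<Longrightarrow> f x = g x" and T: "open T" "u \<in> T" "smooth_on T f"
    using assms unfolding eventually_nhds smooth_near_def by blast
  show ?thesis
    by (rule smooth_nearI[of "S \<inter> T"])
      (use S T smooth_on_cong[of "S \<inter> T" f g] smooth_on_subset[of T f "S \<inter> T"] in auto)
qed

lemma eventually_smooth_near: "smooth_near u f \<Longrightarrow> \<forall>\<^sub>F x in nhds u. smooth_near x f"
  unfolding smooth_near_def eventually_nhds by blast

lemma eventually_smooth_near_compose:
  assumes "smooth_near (\<psi> u) f" "smooth_near u \<psi>"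
  shows "\<forall>\<^sub>F x in nhds u. smooth_near (\<psi> x) f"
proof -
  have "isCont \<psi> u"
    using differentiable_imp_continuous_within[OF smooth_near_differentiable[OF assms(2)]] .
  then have "filterlim \<psi> (nhds (\<psi> u)) (nhds u)"
    by (simp add: isCont_def tendsto_at_iff_tendsto_nhds)
  from eventually_compose_filterlim[OF eventually_smooth_near[OF assms(1)] this] show ?thesis .
qed

lemma dd_dd_add:
  assumes "smooth_near u f" "smooth_near u g"
  shows "dd w (dd v (\<lambda>x. f x + g x)) u = dd w (dd v f) u + dd w (dd v g) u"
proof -
  have "\<forall>\<^sub>F x in nhds u. dd v (\<lambda>x. f x + g x) x = dd v f x + dd v g x"
    using eventually_smooth_near[OF assms(1)] eventually_smooth_near[OF assms(2)]
    by eventually_elim (simp add: dd_add smooth_near_differentiable)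
  then show ?thesis
    using dd_cong_near[of "dd v (\<lambda>x. f x + g x)" "\<lambda>x. dd v f x + dd v g x" u w] assms
    by (simp add: dd_add smooth_near_differentiable smooth_near_dd)
qed

lemma dd_dd_minus:
  assumes "smooth_near u f" "smooth_near u g"
  shows "dd w (dd v (\<lambda>x. f x - g x)) u = dd w (dd v f) u - dd w (dd v g) u"
proof -
  have "\<forall>\<^sub>F x in nhds u. dd v (\<lambda>x. f x - g x) x = dd v f x - dd v g x"
    using eventually_smooth_near[OF assms(1)] eventually_smooth_near[OF assms(2)]
    by eventually_elim (simp add: dd_minus smooth_near_differentiable)
  then show ?thesis
    using dd_cong_near[of "dd v (\<lambda>x. f x - g x)" "\<lambda>x. dd v f x - dd v g x" u w] assms
    by (simp add: dd_minus smooth_near_differentiable smooth_near_dd)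
qed

lemma dd_dd_mult:
  fixes f g :: "'a::real_normed_vector \<Rightarrow> real"
  assumes "smooth_near u f" "smooth_near u g"
  shows "dd w (dd v (\<lambda>x. f x * g x)) u =
    f u * dd w (dd v g) u + dd w f u * dd v g u + (dd v f u * dd w g u + dd w (dd v f) u * g u)"
proof -
  have "\<forall>\<^sub>F x in nhds u. dd v (\<lambda>x. f x * g x) x = f x * dd v g x + dd v f x * g x"
    using eventually_smooth_near[OF assms(1)] eventually_smooth_near[OF assms(2)]
    by eventually_elim (simp add: dd_mult smooth_near_differentiable)
  then have "dd w (dd v (\<lambda>x. f x * g x)) u = dd w (\<lambda>x. f x * dd v g x + dd v f x * g x) u"
    by (rule dd_cong_near)
  also have "\<dots> = dd w (\<lambda>x. f x * dd v g x) u + dd w (\<lambda>x. dd v f x * g x) u"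
    by (rule dd_add) (intro smooth_near_differentiable smooth_near_mult smooth_near_dd assms)+
  also have "\<dots> = f u * dd w (dd v g) u + dd w f u * dd v g u + (dd v f u * dd w g u + dd w (dd v f) u * g u)"
    using assms by (simp add: dd_mult smooth_near_differentiable smooth_near_dd)
  finally show ?thesis .
qed

text \<open>\<open>f\<close> vanishes to first order at \<open>u\<close>, where its second derivative is \<open>S\<close>. Two fields have
  2-jets differing only in the second derivatives iff their difference is of this kind.\<close>

definition flat :: "'a::euclidean_space \<Rightarrow> ('a \<Rightarrow> real) \<Rightarrow> ('a \<Rightarrow> 'a \<Rightarrow> real) \<Rightarrow> bool" where
  "flat u f S \<longleftrightarrow> smooth_near u f \<and> f u = 0 \<and> (\<forall>v. dd v f u = 0) \<and> (\<forall>v w. dd w (dd v f) u = S v w)"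

lemma flatD:
  assumes "flat u f S"
  shows "smooth_near u f" "f u = 0" "dd v f u = 0" "dd w (dd v f) u = S v w"
  using assms unfolding flat_def by auto

lemma flat_zero: "flat u (\<lambda>_. 0) (\<lambda>_ _. 0)"
proof -
  have "dd v (\<lambda>_::'a. 0::real) = (\<lambda>_. 0)" for v by (rule ext) (rule dd_const)
  then show ?thesis unfolding flat_def by (simp add: smooth_near_const)
qed

lemma flat_add: "flat u f S \<Longrightarrow> flat u g T \<Longrightarrow> flat u (\<lambda>x. f x + g x) (\<lambda>v w. S v w + T v w)"
  unfolding flat_def by (simp add: dd_add dd_dd_add smooth_near_add smooth_near_differentiable)

lemma flat_sum:
  "(\<And>i. i \<in> I \<Longrightarrow> flat u (f i) (S i)) \<Longrightarrow> flat u (\<lambda>x. \<Sum>i\<in>I. f i x) (\<lambda>v w. \<Sum>i\<in>I. S i v w)"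
  by (induction I rule: infinite_finite_induct) (simp_all add: flat_zero flat_add)

text \<open>By Leibniz, each term in which g is differentiated carries f or a first derivative of f,
  and these vanish at u.\<close>

lemma flat_mult: "smooth_near u g \<Longrightarrow> flat u f S \<Longrightarrow> flat u (\<lambda>x. g x * f x) (\<lambda>v w. g u * S v w)"
  unfolding flat_def by (simp add: dd_mult dd_dd_mult smooth_near_mult smooth_near_differentiable)

lemma flat_prod:
  assumes "smooth_near u f" "smooth_near u g" "f u = 0" "g u = 0"
  shows "flat u (\<lambda>x. f x * g x) (\<lambda>v w. dd v f u * dd w g u + dd w f u * dd v g u)"
  using assms unfolding flat_def
  by (simp add: dd_mult dd_dd_mult smooth_near_mult smooth_near_differentiable)

lemma flat_cong:
  assumes "\<forall>\<^sub>F x in nhds u. f x = g x" "flat u f S" "\<And>v w. S v w = T v w"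
  shows "flat u g T"
proof -
  have "f u = g u" using assms(1) by (rule eventually_nhds_x_imp_x)
  then show ?thesis
    using assms(2,3) dd_cong_near[OF assms(1)] dd_dd_cong_near[OF assms(1)] smooth_near_cong[OF assms(1)]
    unfolding flat_def by simp
qed

lemma flat_diff_iff:
  assumes "smooth_near u f" "smooth_near u g"
  shows "flat u (\<lambda>x. f x - g x) S \<longleftrightarrow>
    f u = g u \<and> (\<forall>v. dd v f u = dd v g u) \<and> (\<forall>v w. dd w (dd v f) u = dd w (dd v g) u + S v w)"
  unfolding flat_def using assms
  by (auto simp: dd_minus dd_dd_minus smooth_near_differentiable smooth_near_minus algebra_simps)

lemma dd_dd_Basis:
  fixes f :: "'a::euclidean_space \<Rightarrow> real"
  assumes "smooth_near u f"
  shows "dd w (dd v f) u = (\<Sum>i\<in>Basis. (v \<bullet> i) * dd w (dd i f) u)"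
proof -
  have "\<forall>\<^sub>F x in nhds u. dd v f x = (\<Sum>i\<in>Basis. (v \<bullet> i) * dd i f x)"
    using eventually_smooth_near[OF assms]
  proof eventually_elim
    case (elim x)
    show ?case using dd_Basis[OF smooth_near_differentiable[OF elim], of v] by simp
  qed
  then have "dd w (dd v f) u = dd w (\<lambda>x. \<Sum>i\<in>Basis. (v \<bullet> i) * dd i f x) u" by (rule dd_cong_near)
  also have "\<dots> = (\<Sum>i\<in>Basis. (v \<bullet> i) * dd w (dd i f) u)"
    by (rule dd_eqI, intro has_derivative_sum has_derivative_mult_right has_derivative_dd
        smooth_near_differentiable smooth_near_dd assms)
  finally show ?thesis .
qed

text \<open>Second derivatives of \<psi> enter only multiplied by first derivatives of f at
  \<open>\<psi> u\<close>, which vanish. What remains is the pull-back of S by the Jacobian; this is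
  why second derivatives of a difference of fields with equal 1-jets behave as a tensor.\<close>

lemma flat_compose:
  fixes \<psi> :: "'a::euclidean_space \<Rightarrow> 'b::euclidean_space"
  assumes f: "flat (\<psi> u) f S" and s: "smooth_near u \<psi>"
  shows "flat u (\<lambda>x. f (\<psi> x)) (\<lambda>v w. S (dd v \<psi> u) (dd w \<psi> u))"
proof -
  note fs = flatD(1)[OF f]
  have dfi: "dd i f differentiable (at (\<psi> u))" for i
    by (rule smooth_near_differentiable[OF smooth_near_dd[OF fs]])
  have psi: "smooth_near u (\<lambda>x. dd v \<psi> x \<bullet> i)" for v i
  proof -
    obtain T where "open T" "u \<in> T" "smooth_on T (dd v \<psi>)"
      using smooth_near_dd[OF s] unfolding smooth_near_def by blast
    then show ?thesis using smooth_on_compose_linear[OF bounded_linear_inner_left] smooth_nearI by blast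
  qed
  have ev: "\<forall>\<^sub>F x in nhds u. smooth_near (\<psi> x) f"
    by (rule eventually_smooth_near_compose[OF fs s])
  \<comment> \<open>The direction \<open>dd v \<psi> x\<close> varies with x; once it is written in
    \<open>Basis\<close>, the second differentiation is a product rule.\<close>
  have e: "\<forall>\<^sub>F x in nhds u. dd v (\<lambda>x. f (\<psi> x)) x = (\<Sum>i\<in>Basis. (dd v \<psi> x \<bullet> i) * dd i f (\<psi> x))" for v
    using ev eventually_smooth_near[OF s]
  proof eventually_elim
    case (elim x)
    then show ?case
      using trans[OF dd_compose(1)[of f \<psi> x v] dd_Basis[of f "\<psi> x" "dd v \<psi> x"]]
      by (simp add: smooth_near_differentiable)
  qed
  have d0: "dd v (\<lambda>x. f (\<psi> x)) u = 0" for v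
    using eventually_nhds_x_imp_x[OF e[of v]] flatD(3)[OF f] by simp
  have "dd w (dd v (\<lambda>x. f (\<psi> x))) u = S (dd v \<psi> u) (dd w \<psi> u)" for v w
  proof -
    have di: "((\<lambda>x. (dd v \<psi> x \<bullet> i) * dd i f (\<psi> x)) has_derivative
        (\<lambda>w. (dd v \<psi> u \<bullet> i) * dd (dd w \<psi> u) (dd i f) (\<psi> u) + dd w (\<lambda>x. dd v \<psi> x \<bullet> i) u * dd i f (\<psi> u))) (at u)" for i
      by (rule has_derivative_mult[OF has_derivative_dd[OF smooth_near_differentiable[OF psi]]
            dd_compose(2)[OF dfi smooth_near_differentiable[OF s]]])
    have "dd w (dd v (\<lambda>x. f (\<psi> x))) u = dd w (\<lambda>x. \<Sum>i\<in>Basis. (dd v \<psi> x \<bullet> i) * dd i f (\<psi> x)) u"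
      by (rule dd_cong_near[OF e])
    also have "\<dots> = (\<Sum>i\<in>Basis. (dd v \<psi> u \<bullet> i) * dd (dd w \<psi> u) (dd i f) (\<psi> u) + dd w (\<lambda>x. dd v \<psi> x \<bullet> i) u * dd i f (\<psi> u))"
      by (rule dd_eqI[OF has_derivative_sum[OF di]])
    also have "\<dots> = (\<Sum>i\<in>Basis. (dd v \<psi> u \<bullet> i) * dd (dd w \<psi> u) (dd i f) (\<psi> u))"
      by (simp add: flatD(3)[OF f])
    also have "\<dots> = dd (dd w \<psi> u) (dd (dd v \<psi> u) f) (\<psi> u)" by (rule dd_dd_Basis[OF fs, symmetric])
    also have "\<dots> = S (dd v \<psi> u) (dd w \<psi> u)" by (rule flatD(4)[OF f])
    finally show ?thesis .
  qed
  then show ?thesis unfolding flat_def using d0 smooth_near_compose[OF fs s] flatD(2)[OF f] by auto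
qed

text \<open>Here the map, not f, is special: x + h(x) v has the 2-jet of the identity at u, so every
  extra term of the chain rule carries h or a derivative of h of order at most 2. For the components
  of a metric this says that moving the base point along a shear is invisible up to order 2.\<close>

lemma flat_shift:
  fixes f h :: "'a::euclidean_space \<Rightarrow> real"
  assumes f: "smooth_near u f" and h: "flat u h (\<lambda>_ _. 0)"
  shows "flat u (\<lambda>x. f (x + h x *\<^sub>R v) - f x) (\<lambda>_ _. 0)"
proof -
  define \<sigma> where "\<sigma> = (\<lambda>x. x + h x *\<^sub>R v)"
  have su: "\<sigma> u = u" using flatD(2)[OF h] by (simp add: \<sigma>_def)
  have d\<sigma>: "(\<sigma> has_derivative (\<lambda>a. a + dd a h x *\<^sub>R v)) (at x)" if "smooth_near x h" for x
    unfolding \<sigma>_def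
    by (intro has_derivative_add has_derivative_ident has_derivative_scaleR_left has_derivative_dd
        smooth_near_differentiable that)
  have s\<sigma>: "smooth_near u \<sigma>"
  proof -
    obtain T where "open T" "u \<in> T" "smooth_on T h"
      using flatD(1)[OF h] unfolding smooth_near_def by blast
    then have "smooth_on T \<sigma>"
      unfolding \<sigma>_def by (intro smooth_on_add smooth_on_id smooth_on_scaleR smooth_on_const)
    then show ?thesis using \<open>open T\<close> \<open>u \<in> T\<close> smooth_nearI by blast
  qed
  have ev: "\<forall>\<^sub>F x in nhds u. smooth_near (\<sigma> x) f"
    by (rule eventually_smooth_near_compose[OF _ s\<sigma>]) (simp add: su f)
  have e: "\<forall>\<^sub>F x in nhds u. dd a (\<lambda>x. f (\<sigma> x)) x = dd a f (\<sigma> x) + dd a h x * dd v f (\<sigma> x)" for a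
    using ev eventually_smooth_near[OF flatD(1)[OF h]]
  proof eventually_elim
    case (elim x)
    note df = smooth_near_differentiable[OF elim(1)]
    have "dd a (\<lambda>x. f (\<sigma> x)) x = dd (a + dd a h x *\<^sub>R v) f (\<sigma> x)"
      by (rule dd_eqI[OF has_derivative_compose[OF d\<sigma>[OF elim(2)] has_derivative_dd[OF df]]])
    also have "\<dots> = dd a f (\<sigma> x) + dd a h x * dd v f (\<sigma> x)"
      by (simp add: dd_add_vec[OF df])
    finally show ?case .
  qed
  have d1: "dd a (\<lambda>x. f (\<sigma> x)) u = dd a f u" for a
    using eventually_nhds_x_imp_x[OF e[of a]] flatD(3)[OF h] su by simp
  have "dd b (dd a (\<lambda>x. f (\<sigma> x))) u = dd b (dd a f) u" for a b
  proof -
    have df: "((\<lambda>x. dd c f (\<sigma> x)) has_derivative (\<lambda>b. dd b (dd c f) u)) (at u)" for c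
    proof -
      have "dd c f differentiable (at (\<sigma> u))"
        using smooth_near_differentiable[OF smooth_near_dd[OF f]] su by simp
      from has_derivative_compose[OF d\<sigma>[OF flatD(1)[OF h]] has_derivative_dd[OF this]]
      show ?thesis by (simp add: su flatD(3)[OF h])
    qed
    have "dd b (dd a (\<lambda>x. f (\<sigma> x))) u = dd b (\<lambda>x. dd a f (\<sigma> x) + dd a h x * dd v f (\<sigma> x)) u"
      by (rule dd_cong_near[OF e])
    also have "\<dots> = dd b (dd a f) u + (dd a h u * dd b (dd v f) u + dd b (dd a h) u * dd v f (\<sigma> u))"
      by (rule dd_eqI[OF has_derivative_add[OF df has_derivative_mult[OF has_derivative_dd df]]])
        (rule smooth_near_differentiable[OF smooth_near_dd[OF flatD(1)[OF h]]])
    also have "\<dots> = dd b (dd a f) u" by (simp add: flatD(3,4)[OF h])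
    finally show ?thesis .
  qed
  then have "flat u (\<lambda>x. f (\<sigma> x) - f x) (\<lambda>_ _. 0)"
    using flat_diff_iff[of u "\<lambda>x. f (\<sigma> x)" f] f su d1 smooth_near_compose[of \<sigma> u f] s\<sigma> by simp
  then show ?thesis by (simp add: \<sigma>_def)
qed

text \<open>This expands (1 + F)^T (G + E) (1 + F) - G up to order 2. The term quadratic in F drops
  out because F vanishes to first order, and E because its 2-jet is zero. It serves twice: with F
  coming from the Jacobian of a shear, and with E = 0 to build metrics with prescribed second
  derivatives.\<close>

lemma flat_congruence:
  fixes G E F :: "'n::finite \<Rightarrow> 'n \<Rightarrow> 'a::euclidean_space \<Rightarrow> real"
  assumes G: "\<And>i j. smooth_near u (G i j)" and E: "\<And>i j. flat u (E i j) (\<lambda>_ _. 0)"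
    and F: "\<And>i j. flat u (F i j) (SF i j)"
  shows "flat u (\<lambda>x. (\<Sum>i\<in>UNIV. \<Sum>j\<in>UNIV.
        (of_bool (i = a) + F i a x) * (of_bool (j = b) + F j b x) * (G i j x + E i j x)) - G a b x)
     (\<lambda>v w. (\<Sum>i\<in>UNIV. SF i a v w * G i b u) + (\<Sum>j\<in>UNIV. SF j b v w * G a j u))"
proof -
  let ?H = "\<lambda>i j x. G i j x + E i j x"
  have H: "smooth_near u (?H i j)" for i j by (intro smooth_near_add G flatD(1)[OF E])
  have Hu: "?H i j u = G i j u" for i j using flatD(2)[OF E] by simp
  have 1: "flat u (\<lambda>x. \<Sum>i\<in>UNIV. ?H i b x * F i a x) (\<lambda>v w. \<Sum>i\<in>UNIV. ?H i b u * SF i a v w)"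
    by (intro flat_sum flat_mult H F)
  have 2: "flat u (\<lambda>x. \<Sum>j\<in>UNIV. ?H a j x * F j b x) (\<lambda>v w. \<Sum>j\<in>UNIV. ?H a j u * SF j b v w)"
    by (intro flat_sum flat_mult H F)
  have 3: "flat u (\<lambda>x. \<Sum>i\<in>UNIV. \<Sum>j\<in>UNIV. (?H i j x * F j b x) * F i a x)
      (\<lambda>v w. \<Sum>i\<in>UNIV. \<Sum>j\<in>UNIV. (?H i j u * F j b u) * SF i a v w)"
    by (intro flat_sum flat_mult smooth_near_mult H F flatD(1)[OF F])
  have eq: "E a b x + ((\<Sum>i\<in>UNIV. ?H i b x * F i a x) + ((\<Sum>j\<in>UNIV. ?H a j x * F j b x) +
      (\<Sum>i\<in>UNIV. \<Sum>j\<in>UNIV. (?H i j x * F j b x) * F i a x))) =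
    (\<Sum>i\<in>UNIV. \<Sum>j\<in>UNIV. (of_bool (i = a) + F i a x) * (of_bool (j = b) + F j b x) * ?H i j x) - G a b x" for x
  proof -
    have "(\<Sum>j\<in>UNIV. (of_bool (i = a) + F i a x) * (of_bool (j = b) + F j b x) * ?H i j x) =
        of_bool (i = a) * ?H i b x + F i a x * ?H i b x
        + of_bool (i = a) * (\<Sum>j\<in>UNIV. F j b x * ?H i j x) + (\<Sum>j\<in>UNIV. F i a x * F j b x * ?H i j x)" for i
    proof -
      have "(\<Sum>j\<in>UNIV. (of_bool (i = a) + F i a x) * (of_bool (j = b) + F j b x) * ?H i j x) =
        (\<Sum>j\<in>UNIV. of_bool (j = b) * (of_bool (i = a) * ?H i j x + F i a x * ?H i j x)
          + of_bool (i = a) * (F j b x * ?H i j x) + F i a x * F j b x * ?H i j x)"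
        by (rule sum.cong) (simp_all add: algebra_simps)
      then show ?thesis by (simp add: sum.distrib sum_distrib_left of_bool_def if_distrib[of "\<lambda>z. z * _"] cong: if_cong)
    qed
    then show ?thesis
      by (simp add: sum.distrib of_bool_def if_distrib[of "\<lambda>z. z * _"] mult_ac cong: if_cong)
  qed
  show ?thesis
  proof (rule flat_cong[OF always_eventually flat_add[OF E[of a b] flat_add[OF 1 flat_add[OF 2 3]]]], goal_cases)
    case 1
    show ?case using eq by blast
  next
    case (2 v w)
    show ?case by (simp add: flatD(2)[OF F] flatD(2)[OF E] mult.commute)
  qed
qed

text \<open>\<open>reparam s\<close> is a diffeomorphism with 3-jet \<open>z + s z\<^sup>3\<close> at the origin, chosen so that the inverse
  of \<open>reparam s\<close> is \<open>reparam (- s)\<close>.\<close>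

definition reparam :: "real \<Rightarrow> real \<Rightarrow> real" where
  "reparam s z = z * (1 - 2 * s * z\<^sup>2) powr (- 1/2)"

definition reparam_dom :: "real \<Rightarrow> real set" where
  "reparam_dom s = {z. 1 - 2 * s * z\<^sup>2 > 0}"

lemma open_reparam_dom: "open (reparam_dom s)"
  unfolding reparam_dom_def by (intro open_Collect_less continuous_intros)

lemma zero_in_reparam_dom [simp]: "0 \<in> reparam_dom s"
  by (simp add: reparam_dom_def)

lemma reparam_0 [simp]: "reparam s 0 = 0"
  by (simp add: reparam_def)

text \<open>For z \<noteq> 0 the map lowers 1/z^2 by 2 s, so the shifts for s and - s cancel. The
  identity r in the proof is this shift in a form that makes sense at z = 0 too.\<close>

lemma reparam_inverse:
  assumes "z \<in> reparam_dom s"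
  shows "reparam s z \<in> reparam_dom (- s)" "reparam (- s) (reparam s z) = z"
proof -
  define q where "q = 1 - 2 * s * z\<^sup>2"
  have q: "q > 0" using assms by (simp add: q_def reparam_dom_def)
  have root: "x powr - (1/2) = inverse (sqrt x)" if "x > 0" for x :: real
    using that powr_minus[of x "1/2"] by (simp add: powr_half_sqrt)
  have p2: "(q powr (- 1/2))\<^sup>2 = inverse q"
    using q by (simp add: root power_inverse)
  have rs: "reparam s z = z * q powr (- 1/2)" unfolding reparam_def q_def by (rule refl)
  have sq: "(reparam s z)\<^sup>2 = z\<^sup>2 / q"
    unfolding rs power_mult_distrib p2 by (rule divide_inverse[symmetric])
  have r: "1 - 2 * (- s) * (reparam s z)\<^sup>2 = inverse q"
  proof -
    have "1 - 2 * (- s) * (z\<^sup>2 / q) = (q + 2 * s * z\<^sup>2) / q" using q by (simp add: add_divide_distrib)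
    also have "q + 2 * s * z\<^sup>2 = 1" by (simp add: q_def)
    finally show ?thesis by (simp add: sq inverse_eq_divide)
  qed
  then show "reparam s z \<in> reparam_dom (- s)" using q by (simp add: reparam_dom_def)
  have "reparam (- s) (reparam s z) = z * q powr (- 1/2) * (inverse q) powr (- 1/2)"
    unfolding reparam_def[of "- s"] r unfolding rs by (rule refl)
  also have "\<dots> = z" using q by (simp add: root real_sqrt_inverse)
  finally show "reparam (- s) (reparam s z) = z" .
qed

lemma smooth_on_quadratic: "smooth_on (reparam_dom s) (\<lambda>z. 1 - 2 * s * z\<^sup>2)"
  unfolding power2_eq_square
  by (intro smooth_on_minus smooth_on_mult smooth_on_const smooth_on_id open_reparam_dom)

lemma smooth_on_reparam: "smooth_on (reparam_dom s) (reparam s)"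
  unfolding reparam_def[abs_def]
  by (intro smooth_on_mult smooth_on_powr smooth_on_quadratic smooth_on_id open_reparam_dom)
    (simp add: reparam_dom_def)

text \<open>The exponents that occur are -1/2 for \<open>reparam\<close>, -3/2 for its derivative
  and -5/2 for its second derivative.\<close>

lemma DERIV_quadratic_powr:
  assumes "z \<in> reparam_dom s"
  shows "((\<lambda>z. (1 - 2 * s * z\<^sup>2) powr a) has_real_derivative
      (a * (1 - 2 * s * z\<^sup>2) powr (a - 1)) * (- (4 * s * z))) (at z)"
proof -
  have "((\<lambda>z. 1 - 2 * s * z\<^sup>2) has_real_derivative - (4 * s * z)) (at z)"
    by (auto intro!: derivative_eq_intros)
  moreover have "((\<lambda>x. x powr a) has_real_derivative a * (1 - 2 * s * z\<^sup>2) powr (a - 1)) (at (1 - 2 * s * z\<^sup>2))"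
    using assms by (intro has_real_derivative_powr) (simp add: reparam_dom_def)
  ultimately show ?thesis by (rule DERIV_chain2[rotated])
qed

lemma DERIV_reparam:
  assumes "z \<in> reparam_dom s"
  shows "(reparam s has_real_derivative (1 - 2 * s * z\<^sup>2) powr (- 3/2)) (at z)"
proof -
  let ?q = "1 - 2 * s * z\<^sup>2"
  have q: "?q > 0" using assms by (simp add: reparam_dom_def)
  have "(reparam s has_real_derivative
      z * ((- 1/2 * ?q powr (- 1/2 - 1)) * (- (4 * s * z))) + 1 * ?q powr (- 1/2)) (at z)"
    unfolding reparam_def[abs_def] by (rule DERIV_mult'[OF DERIV_ident DERIV_quadratic_powr[OF assms]])
  moreover have "z * ((- 1/2 * ?q powr (- 1/2 - 1)) * (- (4 * s * z))) + 1 * ?q powr (- 1/2) = ?q powr (- 3/2)"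
  proof -
    \<comment> \<open>With q = 1 - 2 s z^2 the sum is 2 s z^2 R + q R, and the two coefficients add
      up to 1.\<close>
    define R where "R = ?q powr (- 3/2)"
    have 1: "?q powr (- 1/2) = ?q * R" using q powr_mult_base[of ?q "- 3/2"] by (simp add: R_def)
    have 2: "?q powr (- 1/2 - 1) = R" by (simp add: R_def)
    show ?thesis unfolding 1 2 R_def[symmetric] by (simp add: algebra_simps power2_eq_square)
  qed
  ultimately show ?thesis by simp
qed

lemma dd_real: "(f has_real_derivative D) (at x) \<Longrightarrow> dd v f x = D * v"
  by (rule dd_eqI) (simp add: has_field_derivative_def)

text \<open>The function is the derivative of \<open>reparam s\<close> minus 1. Its expansion 3 s
  z^2 + ... is the source of the constant 6 in the change of the metric.\<close>

lemma flat_reparam_deriv: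
  "flat 0 (\<lambda>z. (1 - 2 * s * z\<^sup>2) powr (- 3/2) - 1) (\<lambda>v w. 6 * s * v * w)" (is "flat 0 ?\<psi> _")
proof -
  have sm: "smooth_on (reparam_dom s) ?\<psi>"
    by (intro smooth_on_minus smooth_on_powr smooth_on_quadratic smooth_on_const open_reparam_dom)
      (simp add: reparam_dom_def)
  have d: "dd v ?\<psi> z = 6 * s * v * (z * (1 - 2 * s * z\<^sup>2) powr (- 5/2))" if "z \<in> reparam_dom s" for v z
    using dd_real[OF DERIV_diff[OF DERIV_quadratic_powr[OF that, of "- 3/2"] DERIV_const[of 1]], of v] by simp
  have "dd w (dd v ?\<psi>) 0 = 6 * s * v * w" for v w
  proof -
    have "dd w (dd v ?\<psi>) 0 = dd w (\<lambda>z. 6 * s * v * (z * (1 - 2 * s * z\<^sup>2) powr (- 5/2))) 0"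
      by (rule dd_cong_open[OF open_reparam_dom zero_in_reparam_dom d])
    also have "\<dots> = 6 * s * v * w"
      using dd_real[OF DERIV_cmult[OF DERIV_mult'[OF DERIV_ident DERIV_quadratic_powr[OF zero_in_reparam_dom, of s "- 5/2"]],
            of "6 * s * v"], of w] by simp
    finally show ?thesis .
  qed
  then show ?thesis unfolding flat_def
    using d[OF zero_in_reparam_dom] smooth_nearI[OF open_reparam_dom zero_in_reparam_dom sm] by simp
qed

lemma flat_reparam: "flat 0 (\<lambda>z. reparam s z - z) (\<lambda>_ _. 0)"
proof -
  let ?h = "\<lambda>z. reparam s z - z" and ?\<psi> = "\<lambda>z::real. (1 - 2 * s * z\<^sup>2) powr (- 3/2) - 1"
  have sm: "smooth_on (reparam_dom s) ?h"
    by (intro smooth_on_minus smooth_on_reparam smooth_on_id open_reparam_dom)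
  have d: "dd v ?h z = v * ?\<psi> z" if "z \<in> reparam_dom s" for v z
    using dd_real[OF DERIV_diff[OF DERIV_reparam[OF that] DERIV_ident], of v] by simp
  have "dd w (dd v ?h) 0 = 0" for v w
  proof -
    have "dd w (dd v ?h) 0 = dd w (\<lambda>z. v * ?\<psi> z) 0"
      by (rule dd_cong_open[OF open_reparam_dom zero_in_reparam_dom d])
    also have "\<dots> = 0"
      by (rule flatD(3)[OF flat_mult[OF smooth_near_const flat_reparam_deriv]])
    finally show ?thesis .
  qed
  then show ?thesis unfolding flat_def
    using d[OF zero_in_reparam_dom] smooth_nearI[OF open_reparam_dom zero_in_reparam_dom sm] by simp
qed

section \<open>Tensor algebra\<close>

lemma finite_lists_length: "finite {K :: 'n::finite list. length K = p}"
  using finite_lists_length_eq[of "UNIV :: 'n set" p] by simp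

lemma sum_lists_Suc:
  fixes f :: "'n::finite list \<Rightarrow> real"
  shows "(\<Sum>K | length K = Suc p. f K) = (\<Sum>k\<in>UNIV. \<Sum>K | length K = p. f (k # K))"
proof -
  have "bij_betw (\<lambda>(k, K). k # K) (UNIV \<times> {K. length K = p}) {K :: 'n list. length K = Suc p}"
    by (rule bij_betwI[where g = "\<lambda>K. (hd K, tl K)"]) (auto simp: length_Suc_conv)
  from sum.reindex_bij_betw[OF this, of f] show ?thesis
    by (simp add: sum.cartesian_product case_prod_unfold)
qed

lemma sum_lists_0: "(\<Sum>K | length K = 0. f K) = (f [] :: real)"
  by simp

lemma sum_lists_2:
  fixes f :: "'n::finite list \<Rightarrow> real"
  shows "(\<Sum>K | length K = 2. f K) = (\<Sum>a\<in>UNIV. \<Sum>b\<in>UNIV. f [a, b])"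
  unfolding numeral_2_eq_2 sum_lists_Suc sum_lists_0 ..

lemma sum_lists_4:
  fixes f :: "'n::finite list \<Rightarrow> real"
  shows "(\<Sum>K | length K = 4. f K) = (\<Sum>a\<in>UNIV. \<Sum>b\<in>UNIV. \<Sum>k\<in>UNIV. \<Sum>l\<in>UNIV. f [a, b, k, l])"
proof -
  have four: "4 = Suc (Suc (Suc (Suc 0)))" by simp
  show ?thesis unfolding four sum_lists_Suc sum_lists_0 ..
qed

text \<open>Distributivity. It lets matrices act on a multi-index one index at a time, which gives
  the compatibility of \<open>tensor_act\<close> with matrix products and its value on decomposable
  tensors.\<close>

lemma sum_prod_lists:
  fixes f :: "nat \<Rightarrow> 'n::finite \<Rightarrow> real"
  shows "(\<Sum>K | length K = p. \<Prod>i<p. f i (K ! i)) = (\<Prod>i<p. \<Sum>k\<in>UNIV. f i k)"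
proof (induction p arbitrary: f)
  case 0 show ?case by simp
next
  case (Suc p)
  have "(\<Sum>K | length K = Suc p. \<Prod>i<Suc p. f i (K ! i)) =
      (\<Sum>k\<in>UNIV. \<Sum>K | length K = p. f 0 k * (\<Prod>i<p. f (Suc i) (K ! i)))"
    unfolding sum_lists_Suc prod.lessThan_Suc_shift by simp
  also have "\<dots> = (\<Sum>k\<in>UNIV. f 0 k) * (\<Prod>i<p. \<Sum>k\<in>UNIV. f (Suc i) k)"
    by (simp add: sum_distrib_left[symmetric] sum_distrib_right[symmetric] Suc.IH[of "\<lambda>i. f (Suc i)"])
  finally show ?case by (simp only: prod.lessThan_Suc_shift)
qed

lemma tensor_act_length: "length I \<noteq> p \<Longrightarrow> tensor_act A p t I = 0"
  by (simp add: tensor_act_def)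

lemma tensor_act_rank_one:
  "length I = p \<Longrightarrow>
    tensor_act A p (\<lambda>K. \<Prod>i<p. x i $ (K ! i)) I = (\<Prod>i<p. (A *v x i) $ (I ! i))"
  by (simp add: tensor_act_def prod.distrib[symmetric] sum_prod_lists[symmetric] matrix_vector_mult_def)

lemma tensor_act_compose: "tensor_act A p (tensor_act B p t) = tensor_act (A ** B) p t"
proof
  fix I
  show "tensor_act A p (tensor_act B p t) I = tensor_act (A ** B) p t I"
  proof (cases "length I = p")
    case True
    have "tensor_act A p (tensor_act B p t) I =
        (\<Sum>K | length K = p. \<Sum>J | length J = p. (\<Prod>i<p. A $ (I ! i) $ (K ! i) * B $ (K ! i) $ (J ! i)) * t J)"
      using True by (simp add: tensor_act_def sum_distrib_left prod.distrib mult.assoc)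
    also have "\<dots> = (\<Sum>J | length J = p. (\<Sum>K | length K = p. \<Prod>i<p. A $ (I ! i) $ (K ! i) * B $ (K ! i) $ (J ! i)) * t J)"
      by (subst sum.swap) (simp add: sum_distrib_right)
    also have "\<dots> = (\<Sum>J | length J = p. (\<Prod>i<p. (A ** B) $ (I ! i) $ (J ! i)) * t J)"
      by (subst sum_prod_lists) (simp add: matrix_matrix_mult_def)
    finally show ?thesis using True by (simp add: tensor_act_def)
  qed (simp add: tensor_act_def)
qed

text \<open>\<open>tensor_act\<close> returns 0 on lists of the wrong length, so t has to follow the
  same convention.\<close>

lemma tensor_act_id:
  fixes t :: "'n::finite list \<Rightarrow> real"
  assumes "\<And>K. length K \<noteq> p \<Longrightarrow> t K = 0"
  shows "tensor_act (mat 1) p t = t"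
proof
  fix I :: "'n list"
  show "tensor_act (mat 1) p t I = t I"
  proof (cases "length I = p")
    case True
    have "(\<Prod>i<p. (mat 1 :: real^'n^'n) $ (I ! i) $ (K ! i)) * t K = (if K = I then t K else 0)"
      if "length K = p" for K
    proof (cases "K = I")
      case False
      then have "\<exists>i<p. I ! i \<noteq> K ! i" using True that nth_equalityI[of I K] by auto
      then obtain i where "i < p" "I ! i \<noteq> K ! i" by blast
      then have "(\<Prod>i<p. (mat 1 :: real^'n^'n) $ (I ! i) $ (K ! i)) = 0"
        by (intro prod_zero) (auto simp: mat_def intro!: bexI[of _ i])
      then show ?thesis using False by simp
    qed (simp add: mat_def)
    then have "(\<Sum>K | length K = p. (\<Prod>i<p. (mat 1 :: real^'n^'n) $ (I ! i) $ (K ! i)) * t K) =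
        (\<Sum>K | length K = p. if K = I then t K else 0)"
      by (intro sum.cong refl) simp
    then have "tensor_act (mat 1) p t I = (\<Sum>K | length K = p. if K = I then t K else 0)"
      using True by (simp add: tensor_act_def)
    then show ?thesis using True by (simp add: finite_lists_length)
  qed (use assms in \<open>simp add: tensor_act_def\<close>)
qed

text \<open>The pairing of contravariant and covariant arrays: a matrix acting on one side moves to
  the other as its transpose. The chart independence of full contractions rests on this.\<close>

lemma tensor_act_adjoint:
  "(\<Sum>I | length I = p. tensor_act A p t I * s I) = (\<Sum>K | length K = p. t K * tensor_act (transpose A) p s K)"
proof -
  have "(\<Sum>I | length I = p. tensor_act A p t I * s I) =
      (\<Sum>I | length I = p. \<Sum>K | length K = p. (\<Prod>i<p. A $ (I ! i) $ (K ! i)) * t K * s I)"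
    by (intro sum.cong refl) (simp add: tensor_act_def sum_distrib_right)
  also have "\<dots> = (\<Sum>K | length K = p. \<Sum>I | length I = p. (\<Prod>i<p. A $ (I ! i) $ (K ! i)) * t K * s I)"
    by (rule sum.swap)
  also have "\<dots> = (\<Sum>K | length K = p. t K * tensor_act (transpose A) p s K)"
    by (intro sum.cong refl) (simp add: tensor_act_def sum_distrib_left transpose_def mult_ac)
  finally show ?thesis .
qed

lemma tensor_act_scale: "tensor_act A p (\<lambda>K. c * t K) I = c * tensor_act A p t I"
  by (simp add: tensor_act_def sum_distrib_left mult_ac)

lemma tensor_act_2:
  "tensor_act A 2 t [a, b] = (\<Sum>i\<in>UNIV. \<Sum>j\<in>UNIV. A $ a $ i * A $ b $ j * t [i, j])"
proof -
  have two: "{..<2::nat} = {0, 1}" by auto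
  show ?thesis by (simp add: tensor_act_def sum_lists_2 two)
qed

lemma tensor_act_4:
  "tensor_act A 4 t [a, b, k, l] = (\<Sum>i\<in>UNIV. \<Sum>j\<in>UNIV. \<Sum>m\<in>UNIV. \<Sum>n\<in>UNIV.
     A $ a $ i * A $ b $ j * A $ k $ m * A $ l $ n * t [i, j, m, n])"
proof -
  have four: "{..<4::nat} = {0, 1, 2, 3}" by auto
  show ?thesis by (simp add: tensor_act_def sum_lists_4 four mult_ac numeral_2_eq_2 numeral_3_eq_3)
qed

lemma tensor_act_4_sym:
  assumes "\<And>a b k l. t [a, b, k, l] = t [b, a, k, l]" "\<And>a b k l. t [a, b, k, l] = t [a, b, l, k]"
  shows "tensor_act A 4 t [a, b, k, l] = tensor_act A 4 t [b, a, k, l]"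
    and "tensor_act A 4 t [a, b, k, l] = tensor_act A 4 t [a, b, l, k]"
proof -
  show "tensor_act A 4 t [a, b, k, l] = tensor_act A 4 t [b, a, k, l]"
    unfolding tensor_act_4 by (subst sum.swap) (intro sum.cong refl, subst assms(1), simp)
  show "tensor_act A 4 t [a, b, k, l] = tensor_act A 4 t [a, b, l, k]"
    unfolding tensor_act_4
    by (rule sum.cong[OF refl], rule sum.cong[OF refl], subst sum.swap) (intro sum.cong refl, subst assms(2), simp)
qed

lemma tensor_act_2_matrix:
  "(\<chi> a b. tensor_act (transpose B) 2 t [a, b]) = transpose B ** (\<chi> a b. t [a, b]) ** B"
  by (simp add: vec_eq_iff tensor_act_2 matrix_matrix_mult_def transpose_def sum_distrib_left sum_distrib_right mult_ac)
    (intro allI, subst sum.swap, simp add: mult_ac)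

section \<open>Signature and congruence\<close>

lemma has_signature_congruence:
  fixes H B :: "real^'n::finite^'n"
  assumes "has_signature r s H" "invertible B"
  shows "has_signature r s (transpose B ** H ** B)"
proof -
  obtain P :: "real^'n^'n" and d :: "'n \<Rightarrow> real" where P: "invertible P" "\<forall>i. d i = 1 \<or> d i = - 1"
    "card {i. d i = 1} = r" "card {i. d i = - 1} = s" "transpose P ** H ** P = (\<chi> i j. if i = j then d i else 0)"
    using assms(1) unfolding has_signature_def by blast
  obtain C where inv: "B ** C = mat 1" "C ** B = mat 1" using assms(2) unfolding invertible_def by blast
  have C': "invertible C" using inv unfolding invertible_def by blast
  \<comment> \<open>C inverts B, so the frame \<open>C ** P\<close> brings the new form to the same
    diagonal d.\<close>
  have "transpose (C ** P) ** (transpose B ** H ** B) ** (C ** P) =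
      transpose P ** (transpose (B ** C)) ** H ** (B ** C) ** P"
    by (simp only: matrix_transpose_mul matrix_mul_assoc)
  also have "\<dots> = transpose P ** H ** P" by (simp add: inv)
  finally show ?thesis
    unfolding has_signature_def using P invertible_mult[OF C' P(1)]
    by (intro exI[of _ "C ** P"] exI[of _ d]) simp
qed

text \<open>Both properties are read off from H = C^T D C, with C inverse to the diagonalizing
  frame; D is its own inverse because its entries are 1 and -1.\<close>

lemma has_signature_symmetric_invertible:
  fixes H :: "real^'n::finite^'n"
  assumes "has_signature r s H"
  shows "transpose H = H" "invertible H"
proof -
  obtain P :: "real^'n^'n" and d :: "'n \<Rightarrow> real" where P: "invertible P" "\<forall>i. d i = 1 \<or> d i = - 1"
    "transpose P ** H ** P = (\<chi> i j. if i = j then d i else 0)" (is "_ = ?D")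
    using assms(1) unfolding has_signature_def by blast
  obtain C where inv: "P ** C = mat 1" "C ** P = mat 1" using P(1) unfolding invertible_def by blast
  have inv': "transpose C ** transpose P = mat 1" using inv by (metis matrix_transpose_mul transpose_mat)
  have "transpose C ** (transpose P ** H ** P) ** C = (transpose C ** transpose P) ** H ** (P ** C)"
    by (simp only: matrix_mul_assoc)
  then have H: "H = transpose C ** ?D ** C" by (simp add: inv inv' P(3))
  have D: "transpose ?D = ?D" by (auto simp: vec_eq_iff transpose_def)
  show "transpose H = H"
    by (subst (1 2) H) (simp only: matrix_transpose_mul transpose_transpose D matrix_mul_assoc)
  have DD: "?D ** ?D = mat 1"
  proof -
    have "d i * d i = 1" for i using P(2)[rule_format, of i] by auto
    then show ?thesis
      by (auto simp: vec_eq_iff matrix_matrix_mult_def mat_def if_distrib[of "\<lambda>z. z * _"] cong: if_cong)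
  qed
  have "invertible ?D" using DD unfolding invertible_def by blast
  moreover have "invertible C" using inv unfolding invertible_def by blast
  ultimately show "invertible H"
    by (subst H) (intro invertible_mult transpose_invertible)
qed

text \<open>A contravariant array of order 4 as a quadrilinear form on covectors, where polarization
  is plain multilinear algebra; the basis covectors give the components back.\<close>

definition form4 :: "('n::finite list \<Rightarrow> real) \<Rightarrow> real^'n \<Rightarrow> real^'n \<Rightarrow> real^'n \<Rightarrow> real^'n \<Rightarrow> real" where
  "form4 t w x y z = (\<Sum>a\<in>UNIV. \<Sum>b\<in>UNIV. \<Sum>k\<in>UNIV. \<Sum>l\<in>UNIV. t [a, b, k, l] * (w $ a * x $ b * y $ k * z $ l))"

lemma form4_add:
  "form4 t (w + w') x y z = form4 t w x y z + form4 t w' x y z"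
  "form4 t w (x + x') y z = form4 t w x y z + form4 t w x' y z"
  "form4 t w x (y + y') z = form4 t w x y z + form4 t w x y' z"
  "form4 t w x y (z + z') = form4 t w x y z + form4 t w x y z'"
  by (simp_all add: form4_def distrib_left distrib_right sum.distrib)

lemma form4_scale:
  "form4 t (c *\<^sub>R w) x y z = c * form4 t w x y z"
  "form4 t w (c *\<^sub>R x) y z = c * form4 t w x y z"
  "form4 t w x (c *\<^sub>R y) z = c * form4 t w x y z"
  "form4 t w x y (c *\<^sub>R z) = c * form4 t w x y z"
  by (simp_all add: form4_def sum_distrib_left mult_ac)

lemma form4_axis: "form4 t (axis a 1) (axis b 1) (axis k 1) (axis l 1) = t [a, b, k, l]"
  by (simp add: form4_def axis_def if_distrib[of "\<lambda>z. z * _"] if_distrib[of "\<lambda>z. _ * z"] cong: if_cong)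

lemma form4_tensor_act:
  "form4 (tensor_act B 4 t) w x y z =
     form4 t (transpose B *v w) (transpose B *v x) (transpose B *v y) (transpose B *v z)"
proof -
  \<comment> \<open>Indexing the four covectors by a number turns their product into a decomposable
    array, on which the action of a matrix is known.\<close>
  let ?v = "\<lambda>i::nat. if i = 0 then w else if i = 1 then x else if i = 2 then y else z"
  have four: "{..<4::nat} = {0, 1, 2, 3}" by auto
  have "form4 (tensor_act B 4 t) w x y z = (\<Sum>L | length L = 4. tensor_act B 4 t L * (\<Prod>i<4. ?v i $ (L ! i)))"
    unfolding sum_lists_4 form4_def four by (simp add: mult_ac numeral_2_eq_2 numeral_3_eq_3)
  also have "\<dots> = (\<Sum>L | length L = 4. t L * tensor_act (transpose B) 4 (\<lambda>L. \<Prod>i<4. ?v i $ (L ! i)) L)"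
    by (rule tensor_act_adjoint)
  also have "\<dots> = (\<Sum>L | length L = 4. t L * (\<Prod>i<4. (transpose B *v ?v i) $ (L ! i)))"
    by (intro sum.cong refl) (subst tensor_act_rank_one, simp_all)
  also have "\<dots> = form4 t (transpose B *v w) (transpose B *v x) (transpose B *v y) (transpose B *v z)"
    unfolding sum_lists_4 form4_def four by (simp add: mult_ac numeral_2_eq_2 numeral_3_eq_3)
  finally show ?thesis .
qed

text \<open>For the cubic form f(x) = \<open>form4 t w x x x\<close> the six mixed terms are
  f(x+y+z) - f(x+y) - f(y+z) - f(x+z) + f(x) + f(y) + f(z).\<close>

lemma form4_polarization:
  assumes "\<And>x. form4 t w x x x = 0"
  shows "form4 t w x y z + form4 t w x z y + form4 t w y x z + form4 t w y z x + form4 t w z x y + form4 t w z y x = 0"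
  using assms[of "x + y + z"] assms[of "x + y"] assms[of "y + z"] assms[of "x + z"] assms[of x] assms[of y] assms[of z]
  by (simp add: form4_add)

lemma symmetrization_eq_0:
  assumes "\<And>w x. form4 t w x x x = 0"
  shows "t [a, b, k, l] + t [a, b, l, k] + t [a, k, b, l] + t [a, k, l, b] + t [a, l, b, k] + t [a, l, k, b] = 0"
  using form4_polarization[OF assms, of "axis a 1" "axis b 1" "axis k 1" "axis l 1"] unfolding form4_axis by simp

section \<open>Charts and fields\<close>

lemma dmat_nth: "dmat \<tau> c c' x $ i $ j = dd (axis j 1) (local_rep \<tau> c c') (cmap c x) $ i"
  by (simp add: dmat_def jacobian_def matrix_def dd_def)

lemma dd_local_rep:
  assumes "local_rep \<tau> c c' differentiable (at (cmap c x))"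
  shows "dd v (local_rep \<tau> c c') (cmap c x) = dmat \<tau> c c' x *v v"
  using dd_eqI[OF iffD1[OF jacobian_works assms]] by (simp add: dmat_def)

lemma dmat_eqI:
  assumes "(local_rep \<tau> c c' has_derivative (\<lambda>v. M *v v)) (at (cmap c x))"
  shows "dmat \<tau> c c' x = M"
  unfolding vec_eq_iff dmat_nth dd_eqI[OF assms]
  by (simp add: matrix_vector_mul_component inner_axis)

text \<open>Being C^k is a local property, by induction on k. This turns statements about germs into
  the \<open>smooth_on\<close> conditions of the definitions.\<close>

lemma smooth_near_imp_smooth_on:
  assumes "open S" "\<And>u. u \<in> S \<Longrightarrow> smooth_near u f"
  shows "smooth_on S f"
proof -
  have loc: "C_on k S f" if "\<And>u. u \<in> S \<Longrightarrow> \<exists>W. open W \<and> u \<in> W \<and> C_on k W f" for k and f :: "'c::real_normed_vector \<Rightarrow> 'd::real_normed_vector" and S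
    using that
  proof (induction k arbitrary: f)
    case 0
    have "isCont f u" if "u \<in> S" for u
      using 0[OF that] continuous_on_eq_continuous_at by auto
    then show ?case by (simp add: continuous_at_imp_continuous_on)
  next
    case (Suc k)
    have "f differentiable (at u)" if "u \<in> S" for u
      using Suc.prems[OF that] unfolding C_on_Suc_dd by blast
    moreover have "C_on k S (dd v f)" for v
    proof (rule Suc.IH)
      fix u assume "u \<in> S"
      then show "\<exists>W. open W \<and> u \<in> W \<and> C_on k W (dd v f)"
        using Suc.prems[of u] unfolding C_on_Suc_dd by blast
    qed
    ultimately show ?case unfolding C_on_Suc_dd by blast
  qed
  show ?thesis unfolding smooth_on_def
  proof
    fix k
    show "C_on k S f"
      by (rule loc) (use assms(2) in \<open>auto simp: smooth_near_def smooth_on_def\<close>)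
  qed
qed

section \<open>Charts, transition maps and Jacobians\<close>

locale smooth_manifold =
  fixes \<A> :: "('x::{t2_space, second_countable_topology}, 'n::finite) chart set"
  assumes atlas: "smooth_atlas \<A>"
begin

lemma charts_atD: "c \<in> charts_at \<A> x \<Longrightarrow> c \<in> \<A> \<and> x \<in> cdom c"
  by (simp add: charts_at_def)

lemma chart_homeomorphism:
  assumes "c \<in> \<A>"
  shows "open (cdom c)" "open (cmap c ` cdom c)" "homeomorphism (cdom c) (cmap c ` cdom c) (cmap c) (cinv c)"
  using atlas assms unfolding smooth_atlas_def by auto

lemma cinv_cmap: "c \<in> \<A> \<Longrightarrow> x \<in> cdom c \<Longrightarrow> cinv c (cmap c x) = x"
  by (rule homeomorphism_apply1[OF chart_homeomorphism(3)])

lemma cmap_cinv: "c \<in> \<A> \<Longrightarrow> u \<in> cmap c ` cdom c \<Longrightarrow> cmap c (cinv c u) = u"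
  by (rule homeomorphism_apply2[OF chart_homeomorphism(3)])

lemma cinv_in: "c \<in> \<A> \<Longrightarrow> u \<in> cmap c ` cdom c \<Longrightarrow> cinv c u \<in> cdom c"
  by (erule imageE) (simp add: cinv_cmap)

lemma cmap_image_iff:
  assumes "c \<in> \<A>"
  shows "u \<in> cmap c ` (W \<inter> cdom c) \<longleftrightarrow> u \<in> cmap c ` cdom c \<and> cinv c u \<in> W"
  by (auto simp: cinv_cmap[OF assms])

lemma open_cmap_image:
  assumes "c \<in> \<A>" "open W"
  shows "open (cmap c ` (W \<inter> cdom c))"
proof -
  have "openin (top_of_set (cdom c)) (W \<inter> cdom c)" using assms(2) by (metis Int_commute openin_open_Int)
  from homeomorphism_imp_open_map[OF chart_homeomorphism(3)[OF assms(1)] this]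
  show ?thesis using openin_open_trans chart_homeomorphism(2)[OF assms(1)] by blast
qed

lemma open_cinv_image:
  assumes "c \<in> \<A>" "open O'" "O' \<subseteq> cmap c ` cdom c"
  shows "open (cinv c ` O')"
proof -
  have "openin (top_of_set (cmap c ` cdom c)) O'"
    using assms(2,3) by (simp add: openin_open_eq chart_homeomorphism(2)[OF assms(1)])
  from homeomorphism_imp_open_map[OF homeomorphism_symD[OF chart_homeomorphism(3)[OF assms(1)]] this]
  show ?thesis using openin_open_trans chart_homeomorphism(1)[OF assms(1)] by blast
qed

lemma cmap_in_image: "c \<in> charts_at \<A> x \<Longrightarrow> x \<in> U \<Longrightarrow> cmap c x \<in> cmap c ` (U \<inter> cdom c)"
  by (simp add: charts_at_def)

lemma eventually_cinv:
  assumes "c \<in> charts_at \<A> x" "open U" "x \<in> U"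
  shows "\<forall>\<^sub>F u in nhds (cmap c x). cinv c u \<in> U \<and> u \<in> cmap c ` cdom c"
  using open_cmap_image[of c U] cmap_in_image[OF assms(1,3)] assms(2) charts_atD[OF assms(1)]
    cmap_image_iff[of c _ U] unfolding eventually_nhds by blast

lemma local_rep_apply: "local_rep \<tau> c c' u = cmap c' (\<tau> (cinv c u))"
  by (simp add: local_rep_def)

lemma smooth_transition:
  assumes "c \<in> \<A>" "c' \<in> \<A>"
  shows "smooth_on (cmap c ` (cdom c' \<inter> cdom c)) (local_rep id c c')"
  using atlas assms unfolding smooth_atlas_def by (simp add: Int_commute)

lemma smooth_near_transition:
  assumes "c \<in> charts_at \<A> x" "c' \<in> charts_at \<A> x"
  shows "smooth_near (cmap c x) (local_rep id c c')"
proof (rule smooth_nearI)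
  show "open (cmap c ` (cdom c' \<inter> cdom c))"
    by (rule open_cmap_image) (use charts_atD[OF assms(1)] charts_atD[OF assms(2)] chart_homeomorphism(1) in auto)
  show "cmap c x \<in> cmap c ` (cdom c' \<inter> cdom c)"
    by (rule cmap_in_image[OF assms(1)]) (use charts_atD[OF assms(2)] in auto)
  show "smooth_on (cmap c ` (cdom c' \<inter> cdom c)) (local_rep id c c')"
    by (rule smooth_transition) (use charts_atD[OF assms(1)] charts_atD[OF assms(2)] in auto)
qed

text \<open>The chain rule through the intermediate chart \<open>c'\<close>. The coordinate
  expression of the composite factors only where \<tau> lands in the domain of \<open>c'\<close>,
  whence the eventual hypothesis.\<close>

lemma dmat_compose:
  assumes c: "c \<in> charts_at \<A> x" and c': "c' \<in> charts_at \<A> (\<tau> x)"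
    and near: "\<forall>\<^sub>F u in nhds (cmap c x). \<tau> (cinv c u) \<in> cdom c'"
    and d1: "local_rep \<tau> c c' differentiable (at (cmap c x))"
    and d2: "local_rep \<tau>' c' c'' differentiable (at (cmap c' (\<tau> x)))"
  shows "dmat (\<tau>' \<circ> \<tau>) c c'' x = dmat \<tau>' c' c'' (\<tau> x) ** dmat \<tau> c c' x"
proof (rule dmat_eqI)
  have u: "local_rep \<tau> c c' (cmap c x) = cmap c' (\<tau> x)"
    using cinv_cmap charts_atD[OF c] by (simp add: local_rep_apply)
  have "((\<lambda>u. local_rep \<tau>' c' c'' (local_rep \<tau> c c' u)) has_derivative
      (\<lambda>v. dmat \<tau>' c' c'' (\<tau> x) *v (dmat \<tau> c c' x *v v))) (at (cmap c x))"
    using dd_compose(2)[OF d2[folded u] d1] unfolding u dd_local_rep[OF d1] dd_local_rep[OF d2] .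
  moreover obtain W where W: "open W" "cmap c x \<in> W" "\<And>u. u \<in> W \<Longrightarrow> \<tau> (cinv c u) \<in> cdom c'"
    using near unfolding eventually_nhds by blast
  moreover have "local_rep \<tau>' c' c'' (local_rep \<tau> c c' u) = local_rep (\<tau>' \<circ> \<tau>) c c'' u" if "u \<in> W" for u
    using W(3)[OF that] cinv_cmap charts_atD[OF c'] by (simp add: local_rep_apply)
  ultimately have "(local_rep (\<tau>' \<circ> \<tau>) c c'' has_derivative
      (\<lambda>v. dmat \<tau>' c' c'' (\<tau> x) *v (dmat \<tau> c c' x *v v))) (at (cmap c x))"
    using has_derivative_transform_within_open by blast
  then show "(local_rep (\<tau>' \<circ> \<tau>) c c'' has_derivative
      (\<lambda>v. dmat \<tau>' c' c'' (\<tau> x) ** dmat \<tau> c c' x *v v)) (at (cmap c x))"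
    by (simp add: matrix_vector_mul_assoc)
qed

lemma dmat_id_compose:
  assumes "c \<in> charts_at \<A> x" "c' \<in> charts_at \<A> x" "c'' \<in> charts_at \<A> x"
  shows "dmat id c' c'' x ** dmat id c c' x = dmat id c c'' x"
proof -
  have "\<forall>\<^sub>F u in nhds (cmap c x). id (cinv c u) \<in> cdom c'"
    using eventually_cinv[OF assms(1), of "cdom c'"] charts_atD[OF assms(2)] chart_homeomorphism(1)
    by (auto elim: eventually_mono)
  from dmat_compose[of c x c' id id c'', OF assms(1) _ this]
  have "dmat (id \<circ> id) c c'' x = dmat id c' c'' (id x) ** dmat id c c' x"
    using assms smooth_near_transition[THEN smooth_near_differentiable] by (simp only: id_apply)
  then show ?thesis by simp
qed

lemma dmat_id_same:
  assumes "c \<in> charts_at \<A> x"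
  shows "dmat id c c x = mat 1"
proof (rule dmat_eqI)
  have "local_rep id c c u = u" if "u \<in> cmap c ` cdom c" for u
    using that cmap_cinv charts_atD[OF assms] by (simp add: local_rep_apply)
  then have "(local_rep id c c has_derivative (\<lambda>v. v)) (at (cmap c x))"
    using has_derivative_cong_open[of "cmap c ` cdom c" "cmap c x" "local_rep id c c" "\<lambda>u. u"]
      chart_homeomorphism(2) charts_atD[OF assms] by auto
  then show "(local_rep id c c has_derivative (\<lambda>v. mat 1 *v v)) (at (cmap c x))" by (simp only: matrix_vector_mul_lid)
qed

lemma dmat_id_inverse:
  assumes "c \<in> charts_at \<A> x" "c' \<in> charts_at \<A> x"
  shows "dmat id c' c x ** dmat id c c' x = mat 1" and "invertible (dmat id c c' x)"
proof -
  show *: "dmat id c' c x ** dmat id c c' x = mat 1"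
    using dmat_id_compose[OF assms assms(1)] dmat_id_same[OF assms(1)] by simp
  have "dmat id c c' x ** dmat id c' c x = mat 1"
    using dmat_id_compose[OF assms(2,1,2)] dmat_id_same[OF assms(2)] by simp
  with * show "invertible (dmat id c c' x)" unfolding invertible_def by blast
qed

lemma smooth_near_dmat:
  assumes "smooth_near (cmap c x) (local_rep \<tau> c c')" "c \<in> charts_at \<A> x"
  shows "smooth_near (cmap c x) (\<lambda>u. dmat \<tau> c c' (cinv c u) $ i $ j)"
proof -
  obtain W where W: "open W" "cmap c x \<in> W" "smooth_on W (local_rep \<tau> c c')"
    using assms(1) unfolding smooth_near_def by blast
  have "smooth_on W (\<lambda>u. dd (axis j 1) (local_rep \<tau> c c') u $ i)"
    by (rule smooth_on_vec_nth[OF W(1) smooth_on_dd[OF W(3)]])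
  then have "smooth_near (cmap c x) (\<lambda>u. dd (axis j 1) (local_rep \<tau> c c') u $ i)"
    using W smooth_nearI by blast
  moreover have "\<forall>\<^sub>F u in nhds (cmap c x). dd (axis j 1) (local_rep \<tau> c c') u $ i = dmat \<tau> c c' (cinv c u) $ i $ j"
    using eventually_cinv[OF assms(2) open_UNIV UNIV_I]
    by eventually_elim (simp add: dmat_nth cmap_cinv charts_atD[OF assms(2)])
  ultimately show ?thesis by (rule smooth_near_cong[rotated])
qed

text \<open>A tensor is a family over all charts at x; this one is spread from its components t in
  the single chart c. The cocycle rule \<open>dmat_id_compose\<close> makes the family
  consistent.\<close>

definition cotens_at :: "('x, 'n) chart \<Rightarrow> nat \<Rightarrow> 'x \<Rightarrow> ('n list \<Rightarrow> real) \<Rightarrow> ('x, 'n) tens" where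
  "cotens_at c q x t = (\<lambda>c'. if c' \<in> charts_at \<A> x then tensor_act (transpose (dmat id c' c x)) q t else (\<lambda>_. 0))"

definition ctens_at :: "('x, 'n) chart \<Rightarrow> nat \<Rightarrow> 'x \<Rightarrow> ('n list \<Rightarrow> real) \<Rightarrow> ('x, 'n) tens" where
  "ctens_at c p x t = (\<lambda>c'. if c' \<in> charts_at \<A> x then tensor_act (dmat id c c' x) p t else (\<lambda>_. 0))"

lemma cotens_at_in_cotens:
  assumes "c \<in> charts_at \<A> x"
  shows "cotens_at c q x t \<in> cotens \<A> q x"
  unfolding cotens_def
  by (auto simp: cotens_at_def tensor_act_length tensor_act_compose matrix_transpose_mul[symmetric]
      dmat_id_compose assms)

lemma ctens_at_in_ctens:
  assumes "c \<in> charts_at \<A> x"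
  shows "ctens_at c p x t \<in> ctens \<A> p x"
  unfolding ctens_def
  by (auto simp: ctens_at_def tensor_act_length tensor_act_compose dmat_id_compose assms)

lemma cotens_at_same:
  assumes "c \<in> charts_at \<A> x" "\<And>K. length K \<noteq> q \<Longrightarrow> t K = 0"
  shows "cotens_at c q x t c = t"
  using assms by (simp add: cotens_at_def dmat_id_same tensor_act_id)

lemma cotens_transform:
  assumes "t \<in> cotens \<A> q x" "c \<in> charts_at \<A> x" "c' \<in> charts_at \<A> x"
  shows "t c' = tensor_act (transpose (dmat id c' c x)) q (t c)"
  using assms unfolding cotens_def by blast

lemma ctens_transform:
  assumes "t \<in> ctens \<A> p x" "c \<in> charts_at \<A> x" "c' \<in> charts_at \<A> x"
  shows "t c' = tensor_act (dmat id c c' x) p (t c)"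
  using assms unfolding ctens_def by blast

text \<open>\<open>metric_on\<close> without the signature. Metrics transported by shears are
  treated only as such fields, so their signature never has to be computed.\<close>

definition smooth_field :: "'x set \<Rightarrow> ('x \<Rightarrow> ('x, 'n) tens) \<Rightarrow> bool" where
  "smooth_field U g \<longleftrightarrow> open U \<and> U \<subseteq> mcarrier \<A> \<and> (\<forall>y\<in>U. g y \<in> cotens \<A> 2 y) \<and>
     (\<forall>c\<in>\<A>. \<forall>a b. smooth_on (cmap c ` (U \<inter> cdom c)) (\<lambda>u. g (cinv c u) c [a, b]))"

lemma metric_on_iff:
  "metric_on \<A> r s U g \<longleftrightarrow>
    smooth_field U g \<and> (\<forall>y\<in>U. \<forall>c\<in>charts_at \<A> y. has_signature r s (\<chi> a b. g y c [a, b]))"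
  unfolding metric_on_def smooth_field_def metric_fibre_def by blast

lemma smooth_near_field:
  assumes "smooth_field U g" "x \<in> U" "c \<in> charts_at \<A> x"
  shows "smooth_near (cmap c x) (\<lambda>u. g (cinv c u) c [a, b])"
proof (rule smooth_nearI)
  show "open (cmap c ` (U \<inter> cdom c))"
    by (rule open_cmap_image) (use charts_atD[OF assms(3)] assms(1) in \<open>auto simp: smooth_field_def\<close>)
  show "cmap c x \<in> cmap c ` (U \<inter> cdom c)" by (rule cmap_in_image[OF assms(3,2)])
  show "smooth_on (cmap c ` (U \<inter> cdom c)) (\<lambda>u. g (cinv c u) c [a, b])"
    using charts_atD[OF assms(3)] assms(1) by (simp add: smooth_field_def)
qed

lemma smooth_field_subset:
  assumes "smooth_field U g" "open V" "V \<subseteq> U"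
  shows "smooth_field V g"
proof -
  have sub: "cmap c ` (V \<inter> cdom c) \<subseteq> cmap c ` (U \<inter> cdom c)" for c :: "('x, 'n) chart" using assms(3) by blast
  have "smooth_on (cmap c ` (V \<inter> cdom c)) (\<lambda>u. g (cinv c u) c [a, b])" if "c \<in> \<A>" for c a b
    by (rule smooth_on_subset[OF _ sub]) (use assms(1) that in \<open>simp add: smooth_field_def\<close>)
  then show ?thesis using assms unfolding smooth_field_def by blast
qed

lemma transform_components:
  assumes "g (cinv c u) \<in> cotens \<A> 2 (cinv c u)" "c0 \<in> \<A>" "c \<in> \<A>" "u \<in> cmap c ` cdom c" "cinv c u \<in> cdom c0"
  shows "g (cinv c u) c [a, b] = (\<Sum>i\<in>UNIV. \<Sum>j\<in>UNIV.
      dmat id c c0 (cinv c u) $ i $ a * dmat id c c0 (cinv c u) $ j $ b * g (cinv c0 (local_rep id c c0 u)) c0 [i, j])"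
proof -
  have ch: "c0 \<in> charts_at \<A> (cinv c u)" "c \<in> charts_at \<A> (cinv c u)"
    using assms cinv_in by (auto simp: charts_at_def)
  have "cinv c0 (local_rep id c c0 u) = cinv c u"
    using assms cinv_cmap by (simp add: local_rep_apply)
  then show ?thesis
    using cotens_transform[OF assms(1) ch] by (simp add: tensor_act_2 transpose_def)
qed

text \<open>One chart covering U suffices: the components in any other chart are sums of products of
  transition Jacobians with the c0-components composed with the transition map.\<close>

lemma smooth_fieldI:
  assumes c0: "c0 \<in> \<A>" and U: "open U" "U \<subseteq> cdom c0"
    and g: "\<And>y. y \<in> U \<Longrightarrow> g y \<in> cotens \<A> 2 y"
    and s: "\<And>y a b. y \<in> U \<Longrightarrow> smooth_near (cmap c0 y) (\<lambda>u. g (cinv c0 u) c0 [a, b])"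
  shows "smooth_field U g"
proof -
  have "smooth_on (cmap c ` (U \<inter> cdom c)) (\<lambda>u. g (cinv c u) c [a, b])" if c: "c \<in> \<A>" for c a b
  proof (rule smooth_near_imp_smooth_on[OF open_cmap_image[OF c U(1)]])
    fix u assume "u \<in> cmap c ` (U \<inter> cdom c)"
    then obtain x where x: "x \<in> U" "x \<in> cdom c" "u = cmap c x" by blast
    have ch: "c \<in> charts_at \<A> x" "c0 \<in> charts_at \<A> x" using x U(2) c c0 by (auto simp: charts_at_def)
    have "local_rep id c c0 (cmap c x) = cmap c0 x" using cinv_cmap x c by (simp add: local_rep_apply)
    then have "smooth_near (cmap c x) (\<lambda>u. g (cinv c0 (local_rep id c c0 u)) c0 [i, j])" for i j
      using smooth_near_compose[of "local_rep id c c0" "cmap c x" "\<lambda>u. g (cinv c0 u) c0 [i, j]"] s[OF x(1)]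
        smooth_near_transition[OF ch] by simp
    then have "smooth_near (cmap c x) (\<lambda>u. \<Sum>i\<in>UNIV. \<Sum>j\<in>UNIV.
      dmat id c c0 (cinv c u) $ i $ a * dmat id c c0 (cinv c u) $ j $ b * g (cinv c0 (local_rep id c c0 u)) c0 [i, j])"
      by (intro smooth_near_sum smooth_near_mult smooth_near_dmat[OF smooth_near_transition[OF ch] ch(1)])
    then show "smooth_near u (\<lambda>u. g (cinv c u) c [a, b])"
      unfolding x(3)
    proof (rule smooth_near_cong[rotated])
      show "\<forall>\<^sub>F u in nhds (cmap c x). (\<Sum>i\<in>UNIV. \<Sum>j\<in>UNIV.
          dmat id c c0 (cinv c u) $ i $ a * dmat id c c0 (cinv c u) $ j $ b * g (cinv c0 (local_rep id c c0 u)) c0 [i, j])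
          = g (cinv c u) c [a, b]"
        using eventually_cinv[OF ch(1) U(1) x(1)]
      proof eventually_elim
        case (elim u)
        then show ?case using transform_components[of g c u c0 a b, OF g c0 c] U(2) by auto
      qed
    qed
  qed
  then show ?thesis using c0 U g unfolding smooth_field_def mcarrier_def by blast
qed

text \<open>The affine structure of the fibre is independent of the chart. In another chart the
  difference of the fields is multiplied by Jacobians and composed with the transition map; by
  \<open>flat_mult\<close> and \<open>flat_compose\<close> no derivatives of these contribute, so S
  transforms as a covariant tensor of order 4.\<close>

lemma metric_coords_eqI:
  assumes g: "smooth_field U g" and h: "smooth_field U h" and x: "x \<in> U"
    and ch0: "c0 \<in> charts_at \<A> x" and ch: "c \<in> charts_at \<A> x"
    and fl: "\<And>a b. flat (cmap c0 x) (\<lambda>u. h (cinv c0 u) c0 [a, b] - g (cinv c0 u) c0 [a, b])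
      (\<lambda>v w. \<Sum>k\<in>UNIV. \<Sum>l\<in>UNIV. S [a, b, k, l] * (v $ k * w $ l))"
  shows "metric_coords c x h = metric_coords c x g + (0, 0, 0, \<chi> a b k l. cotens_at c0 4 x S c [a, b, k, l])"
proof -
  let ?B = "dmat id c c0" and ?rep = "local_rep id c c0"
  let ?d = "\<lambda>i j u. h (cinv c0 u) c0 [i, j] - g (cinv c0 u) c0 [i, j]"
  have c: "c0 \<in> \<A>" "c \<in> \<A>" "x \<in> cdom c0" "x \<in> cdom c"
    using charts_atD[OF ch0] charts_atD[OF ch] by auto
  have rep: "?rep (cmap c x) = cmap c0 x" using cinv_cmap c by (simp add: local_rep_apply)
  note sr = smooth_near_transition[OF ch ch0]
  have U: "open U" using g by (simp add: smooth_field_def)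
  define S' where "S' = (\<lambda>a b v w. \<Sum>i\<in>UNIV. \<Sum>j\<in>UNIV. (?B x $ i $ a * ?B x $ j $ b) *
      (\<Sum>k\<in>UNIV. \<Sum>l\<in>UNIV. S [i, j, k, l] * ((?B x *v v) $ k * (?B x *v w) $ l)))"
  have "flat (cmap c x) (\<lambda>u. \<Sum>i\<in>UNIV. \<Sum>j\<in>UNIV. (?B (cinv c u) $ i $ a * ?B (cinv c u) $ j $ b) * ?d i j (?rep u))
      (\<lambda>v w. \<Sum>i\<in>UNIV. \<Sum>j\<in>UNIV. (?B (cinv c (cmap c x)) $ i $ a * ?B (cinv c (cmap c x)) $ j $ b) *
        (\<Sum>k\<in>UNIV. \<Sum>l\<in>UNIV. S [i, j, k, l] * (dd v ?rep (cmap c x) $ k * dd w ?rep (cmap c x) $ l)))" for a b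
    by (intro flat_sum flat_mult smooth_near_mult smooth_near_dmat[OF sr ch]
        flat_compose[OF fl[folded rep] sr])
  then have "flat (cmap c x) (\<lambda>u. \<Sum>i\<in>UNIV. \<Sum>j\<in>UNIV. (?B (cinv c u) $ i $ a * ?B (cinv c u) $ j $ b) * ?d i j (?rep u))
      (S' a b)" for a b
    unfolding S'_def dd_local_rep[OF smooth_near_differentiable[OF sr]] cinv_cmap[OF c(2,4)] .
  then have "flat (cmap c x) (\<lambda>u. h (cinv c u) c [a, b] - g (cinv c u) c [a, b]) (S' a b)" for a b
  proof (rule flat_cong[rotated])
    show "\<forall>\<^sub>F u in nhds (cmap c x). (\<Sum>i\<in>UNIV. \<Sum>j\<in>UNIV. (?B (cinv c u) $ i $ a * ?B (cinv c u) $ j $ b) * ?d i j (?rep u))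
       = h (cinv c u) c [a, b] - g (cinv c u) c [a, b]"
      using eventually_cinv[OF ch open_Int[OF U chart_homeomorphism(1)[OF c(1)]] IntI[OF x c(3)]]
    proof eventually_elim
      case (elim u)
      have "g (cinv c u) \<in> cotens \<A> 2 (cinv c u)" "h (cinv c u) \<in> cotens \<A> 2 (cinv c u)"
        using g h elim unfolding smooth_field_def by auto
      then show ?case
        using transform_components[of g c u c0 a b] transform_components[of h c u c0 a b] c elim
        by (simp add: sum_subtractf right_diff_distrib)
    qed
  qed simp
  then have *: "\<forall>a b. h (cinv c (cmap c x)) c [a, b] = g (cinv c (cmap c x)) c [a, b] \<and>
      (\<forall>v. dd v (\<lambda>u. h (cinv c u) c [a, b]) (cmap c x) = dd v (\<lambda>u. g (cinv c u) c [a, b]) (cmap c x)) \<and>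
      (\<forall>v w. dd w (dd v (\<lambda>u. h (cinv c u) c [a, b])) (cmap c x) =
         dd w (dd v (\<lambda>u. g (cinv c u) c [a, b])) (cmap c x) + S' a b v w)"
    using flat_diff_iff[OF smooth_near_field[OF h x ch] smooth_near_field[OF g x ch]] by blast
  have ax: "?B x *v axis k 1 = (\<chi> i. ?B x $ i $ k)" for k
    by (simp add: vec_eq_iff matrix_vector_mul_component inner_axis)
  have "S' a b (axis k 1) (axis l 1) = cotens_at c0 4 x S c [a, b, k, l]" for a b k l
    unfolding S'_def ax
    by (simp add: cotens_at_def ch tensor_act_4 transpose_def sum_distrib_left mult_ac)
  with * show ?thesis
    unfolding metric_coords_def Let_def pd_eq_dd by (simp add: vec_eq_iff)
qed

end

section \<open>Shears\<close>

definition shear :: "real \<Rightarrow> 'a \<Rightarrow> 'a \<Rightarrow> 'a \<Rightarrow> 'a \<Rightarrow> 'a::euclidean_space" where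
  "shear s l v u0 u = u + (reparam s (l \<bullet> (u - u0)) - l \<bullet> (u - u0)) *\<^sub>R v"

definition shear_dom :: "real \<Rightarrow> 'a \<Rightarrow> 'a \<Rightarrow> 'a::euclidean_space set" where
  "shear_dom s l u0 = {u. l \<bullet> (u - u0) \<in> reparam_dom s}"

text \<open>Since \<open>l \<bullet> v = 1\<close>, the coordinate
  \<open>l \<bullet> (u - u0)\<close> of the image is \<open>reparam s\<close> of the old one, while
  u moves only along v. Inverting the shear thus reduces to inverting
  \<open>reparam s\<close>.\<close>

lemma shear_inverse:
  assumes "l \<bullet> v = 1" "u \<in> shear_dom s l u0"
  shows "shear s l v u0 u \<in> shear_dom (- s) l u0" "shear (- s) l v u0 (shear s l v u0 u) = u"
proof -
  have "l \<bullet> (shear s l v u0 u - u0) = l \<bullet> (u - u0) + (reparam s (l \<bullet> (u - u0)) - l \<bullet> (u - u0)) * (l \<bullet> v)"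
    by (simp add: shear_def inner_add_right inner_diff_right)
  then have *: "l \<bullet> (shear s l v u0 u - u0) = reparam s (l \<bullet> (u - u0))" using assms(1) by simp
  show "shear s l v u0 u \<in> shear_dom (- s) l u0"
    using assms(2) reparam_inverse(1) unfolding shear_dom_def by (simp add: *)
  have "shear (- s) l v u0 (shear s l v u0 u) =
      shear s l v u0 u + (l \<bullet> (u - u0) - reparam s (l \<bullet> (u - u0))) *\<^sub>R v"
    unfolding shear_def[of "- s"] * using assms(2) reparam_inverse(2) by (simp add: shear_dom_def)
  then show "shear (- s) l v u0 (shear s l v u0 u) = u"
    by (simp add: shear_def algebra_simps)
qed

lemma shear_base [simp]: "shear s l v u0 u0 = u0"
  by (simp add: shear_def)

lemma base_in_shear_dom [simp]: "u0 \<in> shear_dom s l u0"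
  by (simp add: shear_dom_def)

lemma smooth_on_inner_shift: "smooth_on UNIV (\<lambda>u. l \<bullet> (u - u0))"
  by (rule smooth_on_compose_linear[OF bounded_linear_inner_right])
    (intro smooth_on_minus smooth_on_id smooth_on_const open_UNIV)+

lemma dd_inner_shift: "dd a (\<lambda>u. l \<bullet> (u - u0)) u = l \<bullet> a"
  by (rule dd_eqI) (auto intro!: derivative_eq_intros)

lemma open_shear_dom: "open (shear_dom s l u0)"
proof -
  have "open ((\<lambda>u. l \<bullet> (u - u0)) -` reparam_dom s)"
    by (rule open_vimage[OF open_reparam_dom]) (intro continuous_intros)
  then show ?thesis by (simp add: shear_dom_def vimage_def)
qed

lemma smooth_on_shear: "smooth_on (shear_dom s l u0) (shear s l v u0)"
proof -
  have "smooth_on (shear_dom s l u0) (\<lambda>u. reparam s (l \<bullet> (u - u0)))"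
    by (rule smooth_on_compose[OF open_shear_dom _ smooth_on_reparam smooth_on_subset[OF smooth_on_inner_shift]])
      (auto simp: shear_dom_def)
  then show ?thesis
    unfolding shear_def[abs_def]
    by (intro smooth_on_add smooth_on_scaleR smooth_on_minus smooth_on_id smooth_on_const open_shear_dom
        smooth_on_subset[OF smooth_on_inner_shift]) auto
qed

lemma smooth_near_shear: "u \<in> shear_dom s l u0 \<Longrightarrow> smooth_near u (shear s l v u0)"
  by (rule smooth_nearI[OF open_shear_dom _ smooth_on_shear])

text \<open>The derivative of \<open>reparam s\<close> minus 1, at z =
  \<open>l \<bullet> (u - u0)\<close>. The Jacobian of the shear is the identity plus this scalar
  times the rank-one map that sends a to \<open>(l \<bullet> a) *\<^sub>R v\<close>.\<close>

definition shear_jac :: "real \<Rightarrow> 'a \<Rightarrow> 'a \<Rightarrow> 'a::euclidean_space \<Rightarrow> real" where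
  "shear_jac s l u0 u = (1 - 2 * s * (l \<bullet> (u - u0))\<^sup>2) powr (- 3/2) - 1"

lemma dd_shear:
  assumes "u \<in> shear_dom s l u0"
  shows "dd a (shear s l v u0) u = a + (shear_jac s l u0 u * (l \<bullet> a)) *\<^sub>R v"
proof -
  let ?z = "\<lambda>u. l \<bullet> (u - u0)"
  have z: "?z u \<in> reparam_dom s" using assms by (simp add: shear_dom_def)
  have dz: "(?z has_derivative (\<lambda>a. l \<bullet> a)) (at u)" by (auto intro!: derivative_eq_intros)
  have "((\<lambda>z. reparam s z - z) has_derivative (\<lambda>h. shear_jac s l u0 u * h)) (at (?z u))"
    using DERIV_diff[OF DERIV_reparam[OF z] DERIV_ident]
    by (simp add: has_field_derivative_def shear_jac_def)
  from has_derivative_compose[OF dz this]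
  have "(shear s l v u0 has_derivative (\<lambda>a. a + (shear_jac s l u0 u * (l \<bullet> a)) *\<^sub>R v)) (at u)"
    unfolding shear_def[abs_def]
    by (intro has_derivative_add has_derivative_ident has_derivative_scaleR_left)
  then show ?thesis by (rule dd_eqI)
qed

lemma smooth_near_inner_shift: "smooth_near u (\<lambda>u. l \<bullet> (u - u0))"
  by (rule smooth_nearI[OF open_UNIV UNIV_I smooth_on_inner_shift])

lemma flat_shear_jac: "flat u0 (shear_jac s l u0) (\<lambda>a b. 6 * s * (l \<bullet> a) * (l \<bullet> b))"
proof -
  have "flat ((\<lambda>u. l \<bullet> (u - u0)) u0) (\<lambda>z. (1 - 2 * s * z\<^sup>2) powr (- 3/2) - 1) (\<lambda>v w. 6 * s * v * w)"
    using flat_reparam_deriv by simp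
  from flat_compose[OF this smooth_near_inner_shift] show ?thesis
    unfolding shear_jac_def[abs_def] dd_inner_shift .
qed

lemma flat_shear_displacement: "flat u0 (\<lambda>u. reparam s (l \<bullet> (u - u0)) - l \<bullet> (u - u0)) (\<lambda>_ _. 0)"
proof -
  have "flat ((\<lambda>u. l \<bullet> (u - u0)) u0) (\<lambda>z. reparam s z - z) (\<lambda>_ _. 0)"
    using flat_reparam by simp
  from flat_compose[OF this smooth_near_inner_shift] show ?thesis .
qed

section \<open>Shears as local diffeomorphisms of the manifold\<close>

context smooth_manifold
begin

text \<open>The points of the chart at which the formula for the shear is regular and its value
  stays in the chart. With both conditions imposed, the shear for s maps this set exactly onto the
  one for - s.\<close>

definition shear_nbhd :: "('x, 'n) chart \<Rightarrow> 'x \<Rightarrow> real^'n \<Rightarrow> real^'n \<Rightarrow> real \<Rightarrow> 'x set" where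
  "shear_nbhd c x l v s =
    {y \<in> cdom c. cmap c y \<in> shear_dom s l (cmap c x) \<and> shear s l v (cmap c x) (cmap c y) \<in> cmap c ` cdom c}"

definition shear_map :: "('x, 'n) chart \<Rightarrow> 'x \<Rightarrow> real^'n \<Rightarrow> real^'n \<Rightarrow> real \<Rightarrow> 'x \<Rightarrow> 'x" where
  "shear_map c x l v s y = cinv c (shear s l v (cmap c x) (cmap c y))"

lemma shear_map_base:
  assumes "c \<in> charts_at \<A> x"
  shows "shear_map c x l v s x = x" "x \<in> shear_nbhd c x l v s"
  using charts_atD[OF assms] cinv_cmap by (auto simp: shear_map_def shear_nbhd_def)

lemma shear_map_inverse:
  assumes c: "c \<in> \<A>" and lv: "l \<bullet> v = 1" and y: "y \<in> shear_nbhd c x l v s"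
  shows "shear_map c x l v s y \<in> shear_nbhd c x l v (- s)"
    "shear_map c x l v (- s) (shear_map c x l v s y) = y"
    "cmap c (shear_map c x l v s y) = shear s l v (cmap c x) (cmap c y)"
    "shear_map c x l v s y \<in> cdom c" "y \<in> cdom c"
proof -
  let ?S = "\<lambda>s. shear s l v (cmap c x)"
  show y': "y \<in> cdom c" using y by (simp add: shear_nbhd_def)
  have im: "?S s (cmap c y) \<in> cmap c ` cdom c" "cmap c y \<in> shear_dom s l (cmap c x)"
    using y by (auto simp: shear_nbhd_def)
  show e: "cmap c (shear_map c x l v s y) = ?S s (cmap c y)"
    unfolding shear_map_def by (rule cmap_cinv[OF c im(1)])
  show d: "shear_map c x l v s y \<in> cdom c"
    unfolding shear_map_def by (rule cinv_in[OF c im(1)])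
  have inv: "?S (- s) (?S s (cmap c y)) = cmap c y" "?S s (cmap c y) \<in> shear_dom (- s) l (cmap c x)"
    using shear_inverse[OF lv im(2)] by auto
  show "shear_map c x l v (- s) (shear_map c x l v s y) = y"
    unfolding shear_map_def[of _ _ _ _ "- s"] e inv(1) by (rule cinv_cmap[OF c y'])
  show "shear_map c x l v s y \<in> shear_nbhd c x l v (- s)"
    unfolding shear_nbhd_def using d inv y' by (simp add: e)
qed

text \<open>One statement for several purposes: with W = \<open>UNIV\<close> it gives openness of
  the neighbourhood, for general W continuity of the shear, and it supplies the open domains of
  transported fields.\<close>

lemma open_shear_nbhd_inter:
  assumes c: "c \<in> \<A>" and W: "open W"
  shows "open {y \<in> shear_nbhd c x l v s. shear_map c x l v s y \<in> W}"
proof -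
  let ?S = "shear s l v (cmap c x)" and ?D = "shear_dom s l (cmap c x)"
  let ?N = "\<lambda>T. cmap c ` cdom c \<inter> (?D \<inter> ?S -` T)"
  let ?O = "?N (cmap c ` (W \<inter> cdom c))"
  have "open ?O"
    by (intro open_Int chart_homeomorphism(2)[OF c]
        continuous_open_preimage[OF smooth_on_continuous[OF smooth_on_shear] open_shear_dom] open_cmap_image c W)
  then have "open (cinv c ` ?O)" by (rule open_cinv_image[OF c]) auto
  moreover have "cinv c ` ?O = {y \<in> shear_nbhd c x l v s. shear_map c x l v s y \<in> W}"
  proof (intro set_eqI iffI)
    fix y assume "y \<in> cinv c ` ?O"
    then obtain u where "y = cinv c u" "u \<in> cmap c ` cdom c" "u \<in> ?D" "?S u \<in> cmap c ` (W \<inter> cdom c)" by auto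
    then show "y \<in> {y \<in> shear_nbhd c x l v s. shear_map c x l v s y \<in> W}"
      using cmap_image_iff[OF c, of "?S u" W] cmap_cinv[OF c] cinv_in[OF c]
      by (simp add: shear_nbhd_def shear_map_def)
  next
    fix y assume y: "y \<in> {y \<in> shear_nbhd c x l v s. shear_map c x l v s y \<in> W}"
    then have "cmap c y \<in> ?O" "y = cinv c (cmap c y)"
      using cmap_image_iff[OF c, of "?S (cmap c y)" W] cinv_cmap[OF c]
      by (auto simp: shear_nbhd_def shear_map_def)
    then show "y \<in> cinv c ` ?O" by blast
  qed
  ultimately show ?thesis by simp
qed

lemma open_shear_nbhd:
  assumes "c \<in> \<A>"
  shows "open (shear_nbhd c x l v s)"
  using open_shear_nbhd_inter[OF assms open_UNIV, of x l v s] by simp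

text \<open>Between arbitrary charts the shear factors near y as a transition into c0, the explicit
  shear, and a transition out of c0.\<close>

lemma smooth_near_shear_map:
  assumes c0: "c0 \<in> \<A>" and y: "y \<in> shear_nbhd c0 x l v s" and lv: "l \<bullet> v = 1"
    and ch: "c \<in> charts_at \<A> y" "c' \<in> charts_at \<A> (shear_map c0 x l v s y)"
  shows "smooth_near (cmap c y) (local_rep (shear_map c0 x l v s) c c')"
    and "\<forall>\<^sub>F u in nhds (cmap c y). cinv c u \<in> shear_nbhd c0 x l v s \<and> shear_map c0 x l v s (cinv c u) \<in> cdom c'"
proof -
  let ?\<tau> = "shear_map c0 x l v s" and ?S = "shear s l v (cmap c0 x)"
  note inv = shear_map_inverse[OF c0 lv y]
  have ch0: "c0 \<in> charts_at \<A> y" "c0 \<in> charts_at \<A> (?\<tau> y)"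
    using c0 inv by (auto simp: charts_at_def)
  have "{z \<in> shear_nbhd c0 x l v s. ?\<tau> z \<in> cdom c'} = shear_nbhd c0 x l v s \<inter> ?\<tau> -` cdom c'" by auto
  then have o: "open (shear_nbhd c0 x l v s \<inter> ?\<tau> -` cdom c')"
    using open_shear_nbhd_inter[OF c0 chart_homeomorphism(1), of c' x l v s] charts_atD[OF ch(2)] by simp
  have ev: "\<forall>\<^sub>F u in nhds (cmap c y). cinv c u \<in> shear_nbhd c0 x l v s \<inter> ?\<tau> -` cdom c' \<and> u \<in> cmap c ` cdom c"
    by (rule eventually_cinv[OF ch(1) o]) (use y charts_atD[OF ch(2)] in auto)
  then show "\<forall>\<^sub>F u in nhds (cmap c y). cinv c u \<in> shear_nbhd c0 x l v s \<and> ?\<tau> (cinv c u) \<in> cdom c'"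
    by eventually_elim auto
  have r: "local_rep id c c0 (cmap c y) = cmap c0 y"
    using cinv_cmap charts_atD[OF ch(1)] by (simp add: local_rep_apply)
  have dom: "cmap c0 y \<in> shear_dom s l (cmap c0 x)" using y by (simp add: shear_nbhd_def)
  have S: "smooth_near (cmap c y) (\<lambda>u. ?S (local_rep id c c0 u))"
    by (rule smooth_near_compose[OF _ smooth_near_transition[OF ch(1) ch0(1)]])
      (simp add: r smooth_near_shear[OF dom])
  have "smooth_near (cmap c y) (\<lambda>u. local_rep id c0 c' (?S (local_rep id c c0 u)))"
    by (rule smooth_near_compose[OF _ S])
      (use smooth_near_transition[OF ch0(2) ch(2)] in \<open>simp only: r inv(3)\<close>)
  then show "smooth_near (cmap c y) (local_rep ?\<tau> c c')"
  proof (rule smooth_near_cong[rotated])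
    show "\<forall>\<^sub>F u in nhds (cmap c y). local_rep id c0 c' (?S (local_rep id c c0 u)) = local_rep ?\<tau> c c' u"
      using ev
    proof eventually_elim
      case (elim u)
      then show ?case by (simp add: local_rep_apply shear_map_def)
    qed
  qed
qed

text \<open>Stated for any f agreeing with the shear on its neighbourhood, because the inverse in
  \<open>local_diffeo\<close> is an \<open>inv_into\<close>, which is identified with the opposite
  shear only there.\<close>

lemma smooth_map_shear:
  assumes c0: "c0 \<in> \<A>" and lv: "l \<bullet> v = 1" and f: "\<And>y. y \<in> shear_nbhd c0 x l v s \<Longrightarrow> f y = shear_map c0 x l v s y"
  shows "smooth_map \<A> (shear_nbhd c0 x l v s) f"
  unfolding smooth_map_def
proof (intro ballI)
  fix c c' assume c: "c \<in> \<A>" "c' \<in> \<A>"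
  let ?\<tau> = "shear_map c0 x l v s" and ?U = "shear_nbhd c0 x l v s"
  have eq: "?U \<inter> cdom c \<inter> f -` cdom c' = {y \<in> ?U. ?\<tau> y \<in> cdom c'} \<inter> cdom c" using f by auto
  have o: "open (cmap c ` ({y \<in> ?U. ?\<tau> y \<in> cdom c'} \<inter> cdom c))"
    by (intro open_cmap_image open_shear_nbhd_inter c c0 chart_homeomorphism(1))
  show "smooth_on (cmap c ` (?U \<inter> cdom c \<inter> f -` cdom c')) (local_rep f c c')"
    unfolding eq
  proof (rule smooth_near_imp_smooth_on[OF o])
    fix u assume "u \<in> cmap c ` ({y \<in> ?U. ?\<tau> y \<in> cdom c'} \<inter> cdom c)"
    then obtain y where y: "y \<in> ?U" "?\<tau> y \<in> cdom c'" "y \<in> cdom c" "u = cmap c y" by auto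
    have ch: "c \<in> charts_at \<A> y" "c' \<in> charts_at \<A> (?\<tau> y)" using y c by (auto simp: charts_at_def)
    show "smooth_near u (local_rep f c c')" unfolding y(4)
    proof (rule smooth_near_cong[OF _ smooth_near_shear_map(1)[OF c0 y(1) lv ch]])
      show "\<forall>\<^sub>F u in nhds (cmap c y). local_rep ?\<tau> c c' u = local_rep f c c' u"
        using smooth_near_shear_map(2)[OF c0 y(1) lv ch] by eventually_elim (simp add: local_rep_apply f)
    qed
  qed
qed

lemma continuous_on_shear_map:
  assumes c: "c \<in> \<A>"
  shows "continuous_on (shear_nbhd c x l v s) (shear_map c x l v s)"
proof -
  have "open (shear_map c x l v s -` W \<inter> shear_nbhd c x l v s)" if "open W" for W
    using open_shear_nbhd_inter[OF c that, of x l v s] by (simp add: vimage_def Int_def conj_commute)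
  then show ?thesis using continuous_on_open_vimage[OF open_shear_nbhd[OF c]] by blast
qed

lemma inv_into_shear_map:
  assumes c: "c \<in> \<A>" and lv: "l \<bullet> v = 1" and y: "y \<in> shear_nbhd c x l v (- s)"
  shows "inv_into (shear_nbhd c x l v s) (shear_map c x l v s) y = shear_map c x l v (- s) y"
proof (rule inv_into_f_eq)
  show "inj_on (shear_map c x l v s) (shear_nbhd c x l v s)"
    by (rule inj_on_inverseI[of _ "shear_map c x l v (- s)"]) (rule shear_map_inverse(2)[OF c lv])
  show "shear_map c x l v (- s) y \<in> shear_nbhd c x l v s"
    using shear_map_inverse(1)[OF c lv y] by simp
  show "shear_map c x l v s (shear_map c x l v (- s) y) = y"
    using shear_map_inverse(2)[OF c lv y] by simp
qed

lemma local_diffeo_shear_map: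
  assumes c: "c \<in> \<A>" and lv: "l \<bullet> v = 1"
  shows "local_diffeo \<A> (shear_nbhd c x l v s) (shear_nbhd c x l v (- s)) (shear_map c x l v s)"
proof -
  let ?U = "\<lambda>s. shear_nbhd c x l v s" and ?\<tau> = "\<lambda>s. shear_map c x l v s"
  let ?i = "inv_into (?U s) (?\<tau> s)"
  have i: "?i y = ?\<tau> (- s) y" if "y \<in> ?U (- s)" for y by (rule inv_into_shear_map[OF c lv that])
  have "homeomorphism (?U s) (?U (- s)) (?\<tau> s) ?i"
  proof (rule homeomorphismI)
    show "continuous_on (?U s) (?\<tau> s)" by (rule continuous_on_shear_map[OF c])
    show "continuous_on (?U (- s)) ?i"
      by (rule continuous_on_eq[OF continuous_on_shear_map[OF c, of x l v "- s"]]) (simp add: i)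
    show "?\<tau> s ` ?U s \<subseteq> ?U (- s)" using shear_map_inverse(1)[OF c lv] by blast
    have "?\<tau> (- s) y \<in> ?U s" "?\<tau> s (?\<tau> (- s) y) = y" if "y \<in> ?U (- s)" for y
      using shear_map_inverse(1,2)[OF c lv that] by simp_all
    then show "?i ` ?U (- s) \<subseteq> ?U s" "\<And>y. y \<in> ?U (- s) \<Longrightarrow> ?\<tau> s (?i y) = y"
      by (auto simp: i)
    fix y assume "y \<in> ?U s"
    then show "?i (?\<tau> s y) = y" using shear_map_inverse(1,2)[OF c lv] by (simp add: i)
  qed
  moreover have "?U s \<subseteq> mcarrier \<A>" for s using c unfolding mcarrier_def shear_nbhd_def by auto
  ultimately show ?thesis
    unfolding local_diffeo_def using open_shear_nbhd[OF c] smooth_map_shear[OF c lv] i by blast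
qed

section \<open>The action of shears on 2-jets\<close>

lemma dmat_cong:
  assumes "\<forall>\<^sub>F u in nhds (cmap c y). f (cinv c u) = h (cinv c u)"
  shows "dmat f c c' y = dmat h c c' y"
proof -
  have "\<forall>\<^sub>F u in nhds (cmap c y). local_rep f c c' u = local_rep h c c' u"
    using assms by eventually_elim (simp add: local_rep_apply)
  from dd_cong_near[OF this] show ?thesis by (simp add: vec_eq_iff dmat_nth)
qed

lemma some_chart_in: "c \<in> charts_at \<A> x \<Longrightarrow> some_chart \<A> x \<in> charts_at \<A> x"
  unfolding some_chart_def by (rule someI)

lemma ctens_outside: "t \<in> ctens \<A> p x \<Longrightarrow> c \<notin> charts_at \<A> x \<Longrightarrow> t c = (\<lambda>_. 0)"
  unfolding ctens_def by blast

text \<open>Pushing forward by the shear for - q is pulling back by the shear for q. The definition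
  computes in the arbitrary chart \<open>some_chart\<close> at the image point; the transformation
  law of g replaces it by c0, where the shear is explicit.\<close>

lemma push_metric_shear:
  assumes c0: "c0 \<in> \<A>" and lv: "l \<bullet> v = 1" and g: "smooth_field U g"
    and y: "y \<in> shear_nbhd c0 x l v q" "shear_map c0 x l v q y \<in> U"
    and c': "c' \<in> charts_at \<A> y"
  shows "push_metric \<A> (shear_nbhd c0 x l v (- q)) (shear_map c0 x l v (- q)) g y c' =
    tensor_act (transpose (dmat (shear_map c0 x l v q) c' c0 y)) 2 (g (shear_map c0 x l v q y) c0)"
proof -
  let ?\<sigma> = "shear_map c0 x l v q" and ?U = "shear_nbhd c0 x l v"
  let ?i = "inv_into (?U (- q)) (shear_map c0 x l v (- q))"
  define z where "z = ?\<sigma> y"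
  define c1 where "c1 = some_chart \<A> z"
  have i: "?i y' = ?\<sigma> y'" if "y' \<in> ?U q" for y'
    using inv_into_shear_map[OF c0 lv, of y' x "- q"] that by simp
  have z0: "c0 \<in> charts_at \<A> z"
    using shear_map_inverse(4)[OF c0 lv y(1)] c0 by (simp add: charts_at_def z_def)
  then have z1: "c1 \<in> charts_at \<A> z" unfolding c1_def by (rule some_chart_in)
  note sm0 = smooth_near_shear_map[OF c0 y(1) lv c' z0[unfolded z_def]]
  note sm1 = smooth_near_shear_map[OF c0 y(1) lv c' z1[unfolded z_def]]
  have "dmat ?i c' c1 y = dmat ?\<sigma> c' c1 y"
    by (rule dmat_cong) (use sm1(2) in \<open>eventually_elim, simp add: i\<close>)
  moreover have "dmat ?\<sigma> c' c0 y = dmat id c1 c0 z ** dmat ?\<sigma> c' c1 y"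
    using dmat_compose[of c' y c1 ?\<sigma> id c0, OF c' z1[unfolded z_def] _ smooth_near_differentiable[OF sm1(1)]
        smooth_near_differentiable[OF smooth_near_transition[OF z1 z0, unfolded z_def]]]
      eventually_mono[OF sm1(2)] by (simp add: z_def)
  moreover have "g z \<in> cotens \<A> 2 z" using g y(2) by (simp add: smooth_field_def z_def)
  then have "g z c1 = tensor_act (transpose (dmat id c1 c0 z)) 2 (g z c0)"
    by (rule cotens_transform[OF _ z0 z1])
  ultimately show ?thesis
    using c' i[OF y(1)] unfolding push_metric_def Let_def
    by (simp add: z_def[symmetric] c1_def[symmetric] tensor_act_compose matrix_transpose_mul)
qed

lemma push_metric_shear_in_cotens:
  assumes c0: "c0 \<in> \<A>" and lv: "l \<bullet> v = 1" and g: "smooth_field U g"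
    and y: "y \<in> shear_nbhd c0 x l v q" "shear_map c0 x l v q y \<in> U"
  shows "push_metric \<A> (shear_nbhd c0 x l v (- q)) (shear_map c0 x l v (- q)) g y \<in> cotens \<A> 2 y"
    (is "?P \<in> _")
proof -
  let ?\<sigma> = "shear_map c0 x l v q"
  have z: "c0 \<in> charts_at \<A> (?\<sigma> y)"
    using shear_map_inverse(4)[OF c0 lv y(1)] c0 by (simp add: charts_at_def)
  have *: "dmat ?\<sigma> c2 c0 y = dmat ?\<sigma> c1 c0 y ** dmat id c2 c1 y"
    if ch: "c1 \<in> charts_at \<A> y" "c2 \<in> charts_at \<A> y" for c1 c2
  proof -
    have "\<forall>\<^sub>F u in nhds (cmap c2 y). id (cinv c2 u) \<in> cdom c1"
      using eventually_cinv[OF ch(2) chart_homeomorphism(1), of c1] charts_atD[OF ch(1)]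
      by (auto elim: eventually_mono)
    moreover have "c1 \<in> charts_at \<A> (id y)" using ch(1) by simp
    ultimately show ?thesis
      using dmat_compose[of c2 y c1 id ?\<sigma> c0, OF ch(2) _ _
          smooth_near_differentiable[OF smooth_near_transition[OF ch(2,1)]]]
        smooth_near_differentiable[OF smooth_near_shear_map(1)[OF c0 y(1) lv ch(1) z]] by simp
  qed
  have "?P c2 = tensor_act (transpose (dmat id c2 c1 y)) 2 (?P c1)"
    if ch: "c1 \<in> charts_at \<A> y" "c2 \<in> charts_at \<A> y" for c1 c2
    unfolding push_metric_shear[OF c0 lv g y ch(1)] push_metric_shear[OF c0 lv g y ch(2)] *[OF ch]
    by (simp add: tensor_act_compose matrix_transpose_mul)
  moreover have "?P c I = 0" if "c \<notin> charts_at \<A> y \<or> length I \<noteq> 2" for c I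
    using that by (auto simp: push_metric_def Let_def tensor_act_length)
  ultimately show ?thesis unfolding cotens_def by blast
qed

lemma push_metric_shear_coords:
  assumes c0: "c0 \<in> \<A>" and lv: "l \<bullet> v = 1" and g: "smooth_field U g"
    and y: "y \<in> shear_nbhd c0 x l v q" "shear_map c0 x l v q y \<in> U"
  shows "\<forall>\<^sub>F u in nhds (cmap c0 y).
    push_metric \<A> (shear_nbhd c0 x l v (- q)) (shear_map c0 x l v (- q)) g (cinv c0 u) c0 [a, b] =
    (\<Sum>i\<in>UNIV. \<Sum>j\<in>UNIV. dmat (shear_map c0 x l v q) c0 c0 (cinv c0 u) $ i $ a *
       dmat (shear_map c0 x l v q) c0 c0 (cinv c0 u) $ j $ b *
       g (cinv c0 (shear q l v (cmap c0 x) u)) c0 [i, j])"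
proof -
  let ?\<sigma> = "shear_map c0 x l v q"
  have ch: "c0 \<in> charts_at \<A> y" using y(1) c0 by (simp add: charts_at_def shear_nbhd_def)
  have U: "open U" using g by (simp add: smooth_field_def)
  have "\<forall>\<^sub>F u in nhds (cmap c0 y). cinv c0 u \<in> {y \<in> shear_nbhd c0 x l v q. ?\<sigma> y \<in> U} \<and> u \<in> cmap c0 ` cdom c0"
    by (rule eventually_cinv[OF ch open_shear_nbhd_inter[OF c0 U]]) (use y in simp)
  then show ?thesis
  proof eventually_elim
    case (elim u)
    then have u: "cinv c0 u \<in> shear_nbhd c0 x l v q" "?\<sigma> (cinv c0 u) \<in> U" "cmap c0 (cinv c0 u) = u"
      using cmap_cinv[OF c0] by auto
    have chu: "c0 \<in> charts_at \<A> (cinv c0 u)" using u(1) c0 by (simp add: charts_at_def shear_nbhd_def)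
    have "?\<sigma> (cinv c0 u) = cinv c0 (shear q l v (cmap c0 x) u)" by (simp add: shear_map_def u(3))
    then show ?case
      unfolding push_metric_shear[OF c0 lv g u(1,2) chu] by (simp add: tensor_act_2 transpose_def)
  qed
qed

lemma smooth_field_push_metric:
  assumes c0: "c0 \<in> \<A>" and lv: "l \<bullet> v = 1" and g: "smooth_field U g"
  shows "smooth_field {y \<in> shear_nbhd c0 x l v q. shear_map c0 x l v q y \<in> U}
    (push_metric \<A> (shear_nbhd c0 x l v (- q)) (shear_map c0 x l v (- q)) g)"
proof (rule smooth_fieldI[OF c0])
  let ?\<sigma> = "shear_map c0 x l v q"
  have U: "open U" using g by (simp add: smooth_field_def)
  show "open {y \<in> shear_nbhd c0 x l v q. ?\<sigma> y \<in> U}" by (rule open_shear_nbhd_inter[OF c0 U])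
  show "{y \<in> shear_nbhd c0 x l v q. ?\<sigma> y \<in> U} \<subseteq> cdom c0" by (auto simp: shear_nbhd_def)
  fix y assume "y \<in> {y \<in> shear_nbhd c0 x l v q. ?\<sigma> y \<in> U}"
  then have y: "y \<in> shear_nbhd c0 x l v q" "?\<sigma> y \<in> U" by auto
  show "push_metric \<A> (shear_nbhd c0 x l v (- q)) (shear_map c0 x l v (- q)) g y \<in> cotens \<A> 2 y"
    by (rule push_metric_shear_in_cotens[OF c0 lv g y])
  fix a b
  have ch: "c0 \<in> charts_at \<A> y" "c0 \<in> charts_at \<A> (?\<sigma> y)"
    using shear_map_inverse(4,5)[OF c0 lv y(1)] c0 by (auto simp: charts_at_def)
  have sJ: "smooth_near (cmap c0 y) (\<lambda>u. dmat ?\<sigma> c0 c0 (cinv c0 u) $ i $ j)" for i j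
    by (rule smooth_near_dmat[OF smooth_near_shear_map(1)[OF c0 y(1) lv ch] ch(1)])
  have dom: "cmap c0 y \<in> shear_dom q l (cmap c0 x)" using y(1) by (simp add: shear_nbhd_def)
  have sG: "smooth_near (cmap c0 y) (\<lambda>u. g (cinv c0 (shear q l v (cmap c0 x) u)) c0 [i, j])" for i j
  proof (rule smooth_near_compose[of "shear q l v (cmap c0 x)" "cmap c0 y" "\<lambda>u. g (cinv c0 u) c0 [i, j]"])
    show "smooth_near (shear q l v (cmap c0 x) (cmap c0 y)) (\<lambda>u. g (cinv c0 u) c0 [i, j])"
      using smooth_near_field[OF g y(2) ch(2)] by (simp add: shear_map_inverse(3)[OF c0 lv y(1)])
    show "smooth_near (cmap c0 y) (shear q l v (cmap c0 x))" by (rule smooth_near_shear[OF dom])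
  qed
  show "smooth_near (cmap c0 y)
      (\<lambda>u. push_metric \<A> (shear_nbhd c0 x l v (- q)) (shear_map c0 x l v (- q)) g (cinv c0 u) c0 [a, b])"
  proof (rule smooth_near_cong)
    show "\<forall>\<^sub>F u in nhds (cmap c0 y). (\<Sum>i\<in>UNIV. \<Sum>j\<in>UNIV. dmat ?\<sigma> c0 c0 (cinv c0 u) $ i $ a *
       dmat ?\<sigma> c0 c0 (cinv c0 u) $ j $ b * g (cinv c0 (shear q l v (cmap c0 x) u)) c0 [i, j]) =
       push_metric \<A> (shear_nbhd c0 x l v (- q)) (shear_map c0 x l v (- q)) g (cinv c0 u) c0 [a, b]"
      using push_metric_shear_coords[OF c0 lv g y, of a b] by eventually_elim simp
    show "smooth_near (cmap c0 y) (\<lambda>u. \<Sum>i\<in>UNIV. \<Sum>j\<in>UNIV. dmat ?\<sigma> c0 c0 (cinv c0 u) $ i $ a *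
       dmat ?\<sigma> c0 c0 (cinv c0 u) $ j $ b * g (cinv c0 (shear q l v (cmap c0 x) u)) c0 [i, j])"
      by (intro smooth_near_sum smooth_near_mult sJ sG)
  qed
qed

lemma dmat_shear_map:
  assumes c0: "c0 \<in> \<A>" and lv: "l \<bullet> v = 1" and y: "y \<in> shear_nbhd c0 x l v q"
  shows "dmat (shear_map c0 x l v q) c0 c0 y $ i $ j =
    of_bool (i = j) + shear_jac q l (cmap c0 x) (cmap c0 y) * (l $ j * v $ i)"
proof -
  let ?\<sigma> = "shear_map c0 x l v q"
  have ch: "c0 \<in> charts_at \<A> y" using y c0 by (simp add: charts_at_def shear_nbhd_def)
  have "\<forall>\<^sub>F u in nhds (cmap c0 y). local_rep ?\<sigma> c0 c0 u = shear q l v (cmap c0 x) u"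
    using eventually_cinv[OF ch open_shear_nbhd[OF c0] y]
  proof eventually_elim
    case (elim u)
    then show ?case using shear_map_inverse(3)[OF c0 lv, of "cinv c0 u" x q] cmap_cinv[OF c0]
      by (simp add: local_rep_apply)
  qed
  from dd_cong_near[OF this] have "dd (axis j 1) (local_rep ?\<sigma> c0 c0) (cmap c0 y) =
      axis j 1 + (shear_jac q l (cmap c0 x) (cmap c0 y) * (l \<bullet> axis j 1)) *\<^sub>R v"
    using dd_shear[of "cmap c0 y" q l "cmap c0 x" "axis j 1" v] y by (simp add: shear_nbhd_def)
  moreover have "l \<bullet> axis j 1 = l $ j" by (simp add: inner_axis)
  ultimately show ?thesis by (simp add: dmat_nth) (simp add: axis_def)
qed

text \<open>In the chart c0 the pulled-back metric is (1 + F)^T (G + E) (1 + F), where F is the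
  rank-one part of the Jacobian and E the change of g caused by moving the base point. E has zero
  2-jet by \<open>flat_shift\<close>. The second derivative of F is 6 q times v, l, l, l, and
  contracting v with g turns it into w.\<close>

lemma metric_coords_push_metric:
  fixes l v :: "real^'n"
  assumes ch0: "c0 \<in> charts_at \<A> x" and lv: "l \<bullet> v = 1" and g: "smooth_field U g" and x: "x \<in> U"
    and sym: "\<And>a b. g x c0 [a, b] = g x c0 [b, a]"
    and w: "w = (\<chi> a b. g x c0 [a, b]) *v v"
    and S: "\<And>a b k m. S [a, b, k, m] = 6 * q * (l $ a * w $ b + l $ b * w $ a) * l $ k * l $ m"
    and ch: "c \<in> charts_at \<A> x"
  shows "metric_coords c x (push_metric \<A> (shear_nbhd c0 x l v (- q)) (shear_map c0 x l v (- q)) g) =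
    metric_coords c x g + (0, 0, 0, \<chi> a b k l. cotens_at c0 4 x S c [a, b, k, l])"
proof -
  let ?P = "push_metric \<A> (shear_nbhd c0 x l v (- q)) (shear_map c0 x l v (- q)) g"
  let ?\<sigma> = "shear_map c0 x l v q" and ?u0 = "cmap c0 x"
  let ?V = "{y \<in> shear_nbhd c0 x l v q. ?\<sigma> y \<in> U}"
  have c0: "c0 \<in> \<A>" "x \<in> cdom c0" using charts_atD[OF ch0] by auto
  note base = shear_map_base[OF ch0, of l v q]
  have U: "open U" using g by (simp add: smooth_field_def)
  have V: "open (U \<inter> ?V)" "x \<in> U \<inter> ?V"
    using open_Int[OF U open_shear_nbhd_inter[OF c0(1) U]] x base by auto
  have gV: "smooth_field (U \<inter> ?V) g" by (rule smooth_field_subset[OF g V(1)]) auto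
  have PV: "smooth_field (U \<inter> ?V) ?P"
    by (rule smooth_field_subset[OF smooth_field_push_metric[OF c0(1) lv g] V(1)]) auto
  let ?G = "\<lambda>i j u. g (cinv c0 u) c0 [i, j]"
  let ?F = "\<lambda>i j u. (l $ j * v $ i) * shear_jac q l ?u0 u"
  let ?E = "\<lambda>i j u. ?G i j (shear q l v ?u0 u) - ?G i j u"
  have G: "smooth_near ?u0 (?G i j)" for i j by (rule smooth_near_field[OF g x ch0])
  have E: "flat ?u0 (?E i j) (\<lambda>_ _. 0)" for i j
    using flat_shift[where f = "?G i j" and h = "\<lambda>u. reparam q (l \<bullet> (u - ?u0)) - l \<bullet> (u - ?u0)" and v = v,
        OF G flat_shear_displacement] by (simp add: shear_def)
  have F: "flat ?u0 (?F i j) (\<lambda>a b. (l $ j * v $ i) * (6 * q * (l \<bullet> a) * (l \<bullet> b)))" for i j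
    by (rule flat_mult[OF smooth_near_const flat_shear_jac])
  have fl: "flat ?u0 (\<lambda>u. ?P (cinv c0 u) c0 [a, b] - ?G a b u)
      (\<lambda>v w. \<Sum>k\<in>UNIV. \<Sum>l\<in>UNIV. S [a, b, k, l] * (v $ k * w $ l))" for a b
  proof (rule flat_cong[OF _ flat_congruence[where u = ?u0 and G = ?G and E = ?E and F = ?F and a = a and b = b, OF G E F]])
    have "\<forall>\<^sub>F u in nhds ?u0. cinv c0 u \<in> shear_nbhd c0 x l v q \<and> u \<in> cmap c0 ` cdom c0"
      by (rule eventually_cinv[OF ch0 open_shear_nbhd[OF c0(1)] base(2)])
    moreover have "\<forall>\<^sub>F u in nhds ?u0. ?P (cinv c0 u) c0 [a, b] =
      (\<Sum>i\<in>UNIV. \<Sum>j\<in>UNIV. dmat ?\<sigma> c0 c0 (cinv c0 u) $ i $ a * dmat ?\<sigma> c0 c0 (cinv c0 u) $ j $ b *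
        ?G i j (shear q l v ?u0 u))"
      by (rule push_metric_shear_coords[OF c0(1) lv g base(2)]) (simp add: base x)
    ultimately show "\<forall>\<^sub>F u in nhds ?u0. (\<Sum>i\<in>UNIV. \<Sum>j\<in>UNIV. (of_bool (i = a) + ?F i a u) *
        (of_bool (j = b) + ?F j b u) * (?G i j u + ?E i j u)) - ?G a b u = ?P (cinv c0 u) c0 [a, b] - ?G a b u"
    proof eventually_elim
      case (elim u)
      then show ?case
        using dmat_shear_map[OF c0(1) lv, of "cinv c0 u" x q] cmap_cinv[OF c0(1)]
        by (simp add: mult.commute[of "shear_jac _ _ _ _"])
    qed
    fix a' b' :: "real^'n"
    \<comment> \<open>\<open>flat_congruence\<close> contracts v once with the first and once with
      the second index of g; by symmetry both give w.\<close>
    have wa: "w $ a = (\<Sum>j\<in>UNIV. v $ j * ?G a j ?u0)" "w $ a = (\<Sum>j\<in>UNIV. v $ j * ?G j a ?u0)" for a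
      using sym by (simp_all add: w matrix_vector_mult_def cinv_cmap[OF c0] mult.commute)
    have "(\<Sum>k\<in>UNIV. \<Sum>m\<in>UNIV. S [a, b, k, m] * (a' $ k * b' $ m)) =
        6 * q * (l $ a * w $ b + l $ b * w $ a) * ((\<Sum>k\<in>UNIV. l $ k * a' $ k) * (\<Sum>m\<in>UNIV. l $ m * b' $ m))"
    proof -
      define K where "K = 6 * q * (l $ a * w $ b + l $ b * w $ a)"
      show ?thesis unfolding S sum_product K_def[symmetric] by (simp add: sum_distrib_left mult_ac)
    qed
    also have "\<dots> = 6 * q * (l \<bullet> a') * (l \<bullet> b') * (l $ a * w $ b) + 6 * q * (l \<bullet> a') * (l \<bullet> b') * (l $ b * w $ a)"
      by (simp add: inner_vec_def algebra_simps)
    also have "\<dots> = (\<Sum>i\<in>UNIV. (l $ a * v $ i) * (6 * q * (l \<bullet> a') * (l \<bullet> b')) * ?G i b ?u0) +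
        (\<Sum>j\<in>UNIV. (l $ b * v $ j) * (6 * q * (l \<bullet> a') * (l \<bullet> b')) * ?G a j ?u0)"
      unfolding wa(2)[of b] wa(1)[of a] by (simp add: sum_distrib_left mult_ac)
    finally show "(\<Sum>i\<in>UNIV. (l $ a * v $ i) * (6 * q * (l \<bullet> a') * (l \<bullet> b')) * ?G i b ?u0) +
        (\<Sum>j\<in>UNIV. (l $ b * v $ j) * (6 * q * (l \<bullet> a') * (l \<bullet> b')) * ?G a j ?u0) =
        (\<Sum>k\<in>UNIV. \<Sum>l\<in>UNIV. S [a, b, k, l] * (a' $ k * b' $ l))" by simp
  qed
  show ?thesis by (rule metric_coords_eqI[OF gV PV V(2) ch0 ch fl])
qed

text \<open>The shear fixes x and has identity Jacobian there, so it pushes every contravariant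
  tensor at x to itself. Taking c0 to be \<open>some_chart\<close> matches the chart in which
  \<open>push_tens\<close> computes.\<close>

lemma natural_shear_invariance:
  assumes nat: "natural_tensor \<A> r s p T"
    and ct: "T (jet2 \<A> r s x g) \<in> ctens \<A> p x"
    and g: "metric_near \<A> r s x g" and c0: "c0 = some_chart \<A> x" "c0 \<in> charts_at \<A> x" and lv: "l \<bullet> v = 1"
  shows "T (jet2 \<A> r s x (push_metric \<A> (shear_nbhd c0 x l v q) (shear_map c0 x l v q) g)) = T (jet2 \<A> r s x g)"
proof -
  let ?\<tau> = "shear_map c0 x l v q" and ?U = "shear_nbhd c0 x l v q"
  have cA: "c0 \<in> \<A>" using charts_atD[OF c0(2)] by simp
  note base = shear_map_base[OF c0(2), of l v q]
  have "T (jet2 \<A> r s (?\<tau> x) (push_metric \<A> ?U ?\<tau> g)) = push_tens \<A> p ?\<tau> x (T (jet2 \<A> r s x g))"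
    using nat local_diffeo_shear_map[OF cA lv] base(2) g unfolding natural_tensor_def by blast
  also have "\<dots> = T (jet2 \<A> r s x g)"
  proof
    fix c'
    have "dmat ?\<tau> c0 c' x = dmat id c0 c' x" if c': "c' \<in> charts_at \<A> x"
    proof -
      have b: "c0 \<in> charts_at \<A> (?\<tau> x)" using c0(2) base(1) by simp
      note sm = smooth_near_shear_map[OF cA base(2) lv c0(2) b]
      have "dmat (id \<circ> ?\<tau>) c0 c' x = dmat id c0 c' (?\<tau> x) ** dmat ?\<tau> c0 c0 x"
      proof (rule dmat_compose[of c0 x c0 ?\<tau> id c', OF c0(2) b])
        show "\<forall>\<^sub>F u in nhds (cmap c0 x). ?\<tau> (cinv c0 u) \<in> cdom c0" using sm(2) by (rule eventually_mono) simp
        show "local_rep ?\<tau> c0 c0 differentiable (at (cmap c0 x))" by (rule smooth_near_differentiable[OF sm(1)])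
        show "local_rep id c0 c' differentiable (at (cmap c0 (?\<tau> x)))"
          unfolding base(1) by (rule smooth_near_differentiable[OF smooth_near_transition[OF c0(2) c']])
      qed
      moreover have "dmat ?\<tau> c0 c0 x = mat 1"
        by (simp add: vec_eq_iff dmat_shear_map[OF cA lv base(2)] mat_def flatD(2)[OF flat_shear_jac] of_bool_def)
      ultimately show ?thesis by (simp add: base(1))
    qed
    then show "push_tens \<A> p ?\<tau> x (T (jet2 \<A> r s x g)) c' = T (jet2 \<A> r s x g) c'"
      using ctens_outside[OF ct, of c'] ctens_transform[OF ct c0(2), of c']
      unfolding push_tens_def Let_def base(1) c0(1)[symmetric] by (cases "c' \<in> charts_at \<A> x") simp_all
  qed
  finally show ?thesis by (simp add: base(1))
qed

end

section \<open>The derivative along the fibres\<close>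

lemma vec4_expansion:
  fixes Z :: "real^'n::finite^'n^'n^'n"
  shows "Z = (\<Sum>a\<in>UNIV. \<Sum>b\<in>UNIV. \<Sum>k\<in>UNIV. \<Sum>l\<in>UNIV.
    Z $ a $ b $ k $ l *\<^sub>R axis a (axis b (axis k (axis l 1))))"
proof -
  have e: "(\<Sum>i\<in>UNIV. axis i (z $ i)) = z" for z :: "('d::real_vector)^'n"
    by (simp add: vec_eq_iff axis_def if_distrib[of "\<lambda>z. z $ _"] cong: if_cong)
  have s: "(\<Sum>i\<in>I. axis j (f i)) = axis j (\<Sum>i\<in>I. f i)" for I :: "'n set" and j :: 'n and f :: "'n \<Rightarrow> ('d::real_vector)"
    by (induction I rule: infinite_finite_induct) (auto simp: vec_eq_iff axis_def)
  have c: "r *\<^sub>R axis j z = axis j (r *\<^sub>R z)" for r and j :: 'n and z :: "'d::real_vector"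
    by (simp add: vec_eq_iff axis_def)
  show ?thesis
    unfolding c s by (simp add: e)
qed

text \<open>A linear functional on all arrays need not have coefficients with the symmetries of
  \<open>S22_dual\<close>. Averaging them over the four permutations generated by swapping a, b and
  swapping k, l provides these symmetries and does not change the values on arrays that are
  symmetric themselves.\<close>

lemma symmetric_representation:
  fixes \<phi> :: "real^'n::finite^'n^'n^'n \<Rightarrow> real"
  assumes "linear \<phi>"
  obtains N :: "'n list \<Rightarrow> real" where "\<And>L. length L \<noteq> 4 \<Longrightarrow> N L = 0"
    "\<And>a b k l. N [a, b, k, l] = N [b, a, k, l]" "\<And>a b k l. N [a, b, k, l] = N [a, b, l, k]"
    "\<And>S. (\<And>a b k l. S [a, b, k, l] = S [b, a, k, l]) \<Longrightarrow> (\<And>a b k l. S [a, b, k, l] = S [a, b, l, k]) \<Longrightarrow>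
       \<phi> (\<chi> a b k l. S [a, b, k, l]) = (\<Sum>L | length L = 4. N L * S L)"
proof -
  define e where "e = (\<lambda>a b k l. \<phi> (axis a (axis b (axis k (axis l 1)))))"
  define N where "N = (\<lambda>L. if length L = 4 then
    (e (L ! 0) (L ! 1) (L ! 2) (L ! 3) + e (L ! 1) (L ! 0) (L ! 2) (L ! 3) +
     e (L ! 0) (L ! 1) (L ! 3) (L ! 2) + e (L ! 1) (L ! 0) (L ! 3) (L ! 2)) / 4 else 0)"
  have N: "N [a, b, k, l] = (e a b k l + e b a k l + e a b l k + e b a l k) / 4" for a b k l
    by (simp add: N_def numeral_2_eq_2 numeral_3_eq_3)
  have "\<phi> (\<chi> a b k l. S [a, b, k, l]) = (\<Sum>L | length L = 4. N L * S L)"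
    if S: "\<And>a b k l. S [a, b, k, l] = S [b, a, k, l]" "\<And>a b k l. S [a, b, k, l] = S [a, b, l, k]" for S
  proof -
    define Q where "Q = (\<lambda>e :: 'n \<Rightarrow> 'n \<Rightarrow> 'n \<Rightarrow> 'n \<Rightarrow> real.
      \<Sum>a\<in>UNIV. \<Sum>b\<in>UNIV. \<Sum>k\<in>UNIV. \<Sum>l\<in>UNIV. S [a, b, k, l] * e a b k l)"
    have sw1: "Q (\<lambda>a b k l. f b a k l) = Q f" for f
      unfolding Q_def by (subst sum.swap) (intro sum.cong refl, simp only: S(1))
    have sw2: "Q (\<lambda>a b k l. f a b l k) = Q f" for f
      unfolding Q_def by (rule sum.cong[OF refl], rule sum.cong[OF refl], subst sum.swap) (intro sum.cong refl, simp only: S(2))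
    have "\<phi> (\<chi> a b k l. S [a, b, k, l]) = Q e"
      by (subst vec4_expansion) (simp add: linear_sum[OF assms] linear_cmul[OF assms] Q_def e_def)
    also have "Q e = (Q e + Q (\<lambda>a b k l. e b a k l) + Q (\<lambda>a b k l. e a b l k) + Q (\<lambda>a b k l. e b a l k)) / 4"
      using sw1[of e] sw2[of e] sw2[of "\<lambda>a b k l. e b a k l"] by simp
    also have "\<dots> = Q (\<lambda>a b k l. (e a b k l + e b a k l + e a b l k + e b a l k) / 4)"
      unfolding Q_def by (simp add: sum.distrib distrib_left sum_divide_distrib[symmetric])
    also have "\<dots> = (\<Sum>L | length L = 4. N L * S L)"
      unfolding Q_def sum_lists_4 N by (simp add: mult.commute)
    finally show ?thesis .
  qed
  moreover have "N [a, b, k, l] = N [b, a, k, l]" "N [a, b, k, l] = N [a, b, l, k]" for a b k l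
    by (simp_all add: N)
  ultimately show thesis using that[of N] by (simp add: N_def)
qed

section \<open>Jets and metrics with prescribed second derivatives\<close>

context smooth_manifold
begin

lemma metric_nearE:
  assumes "metric_near \<A> r s x g"
  obtains U where "x \<in> U" "smooth_field U g"
    "\<And>y c. y \<in> U \<Longrightarrow> c \<in> charts_at \<A> y \<Longrightarrow> has_signature r s (\<chi> a b. g y c [a, b])"
  using assms unfolding metric_near_def metric_on_iff by blast

lemma some_chart_in_charts_at:
  assumes "metric_near \<A> r s x g"
  shows "some_chart \<A> x \<in> charts_at \<A> x"
proof -
  obtain U where "x \<in> U" "smooth_field U g" using assms by (rule metric_nearE)
  then obtain c where "c \<in> charts_at \<A> x"
    unfolding smooth_field_def mcarrier_def charts_at_def by blast
  then show ?thesis by (rule some_chart_in)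
qed

lemma jet2_cong:
  "(\<And>c. c \<in> charts_at \<A> x \<Longrightarrow> metric_coords c x g = metric_coords c x h) \<Longrightarrow> jet2 \<A> r s x g = jet2 \<A> r s x h"
  by (simp add: jet2_def)

lemma fst_jet2 [simp]: "fst (jet2 \<A> r s x g) = x"
  by (simp add: jet2_def)

lemma jet_coords_jet2:
  assumes "metric_near \<A> r s x g" "c \<in> charts_at \<A> x"
  shows "jet_coords c (jet2 \<A> r s x g) = metric_coords c x g"
proof -
  have "g \<in> snd (jet2 \<A> r s x g)" using assms(1) by (simp add: jet2_def)
  then have "(SOME h. h \<in> snd (jet2 \<A> r s x g)) \<in> snd (jet2 \<A> r s x g)"
    by (rule someI[of "\<lambda>h. h \<in> snd (jet2 \<A> r s x g)"])
  then show ?thesis using assms(2) by (simp add: jet_coords_def jet2_def)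
qed

lemma jet2_in_J2M: "metric_near \<A> r s x g \<Longrightarrow> jet2 \<A> r s x g \<in> J2M \<A> r s"
  unfolding J2M_def by blast

text \<open>A jet over x is determined by its coordinates in the charts at x, so the definite
  description in \<open>jet_add\<close> is met by the class of h alone.\<close>

lemma jet_add_eq:
  assumes g: "metric_near \<A> r s x g" and h: "metric_near \<A> r s x h"
    and eq: "\<And>c. c \<in> charts_at \<A> x \<Longrightarrow>
      metric_coords c x h = metric_coords c x g + (0, 0, 0, \<chi> a b k l. S c [a, b, k, l])"
  shows "jet_add \<A> r s (jet2 \<A> r s x g) S = jet2 \<A> r s x h"
  unfolding jet_add_def
proof (rule the_equality)
  show "jet2 \<A> r s x h \<in> J2M \<A> r s \<and> fst (jet2 \<A> r s x h) = fst (jet2 \<A> r s x g) \<and>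
    (\<forall>c\<in>charts_at \<A> (fst (jet2 \<A> r s x g)). jet_coords c (jet2 \<A> r s x h) =
      jet_coords c (jet2 \<A> r s x g) + (0, 0, 0, \<chi> a b k l. S c [a, b, k, l]))"
    using jet2_in_J2M[OF h] eq by (simp add: jet_coords_jet2[OF g] jet_coords_jet2[OF h])
next
  fix j' assume j': "j' \<in> J2M \<A> r s \<and> fst j' = fst (jet2 \<A> r s x g) \<and>
    (\<forall>c\<in>charts_at \<A> (fst (jet2 \<A> r s x g)). jet_coords c j' =
      jet_coords c (jet2 \<A> r s x g) + (0, 0, 0, \<chi> a b k l. S c [a, b, k, l]))"
  then obtain y h' where h': "j' = jet2 \<A> r s y h'" "metric_near \<A> r s y h'" unfolding J2M_def by blast
  have y: "y = x" using j' h'(1) by simp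
  show "j' = jet2 \<A> r s x h" unfolding h'(1) y
  proof (rule jet2_cong)
    fix c assume c: "c \<in> charts_at \<A> x"
    then have "jet_coords c j' = metric_coords c x g + (0, 0, 0, \<chi> a b k l. S c [a, b, k, l])"
      using j' by (simp add: jet_coords_jet2[OF g])
    then show "metric_coords c x h' = metric_coords c x h"
      using jet_coords_jet2[OF h'(2)] c h'(1) y eq[OF c] by simp
  qed
qed

lemma cotens_at_cotens:
  assumes "S \<in> cotens \<A> q x" "c0 \<in> charts_at \<A> x" "c \<in> charts_at \<A> x"
  shows "cotens_at c0 q x (S c0) c = S c"
  using cotens_transform[OF assms] assms(3) by (simp add: cotens_at_def)

text \<open>A metric with prescribed second derivatives is obtained as \<open>(1 + A)\<^sup>T G (1 + A)\<close> with \<open>A\<close>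
  quadratic, so that its signature is that of \<open>G\<close>.\<close>

lemma metric_with_second_derivatives:
  assumes g: "metric_near \<A> r s x g" and S: "S \<in> S22 \<A> x"
  obtains h where "metric_near \<A> r s x h"
    "\<And>c. c \<in> charts_at \<A> x \<Longrightarrow>
      metric_coords c x h = metric_coords c x g + (0, 0, 0, \<chi> a b k l. S c [a, b, k, l])"
proof -
  obtain U where x: "x \<in> U" and gU: "smooth_field U g"
    and sig: "\<And>y c. y \<in> U \<Longrightarrow> c \<in> charts_at \<A> y \<Longrightarrow> has_signature r s (\<chi> a b. g y c [a, b])"
    using g by (rule metric_nearE) blast
  define c0 where "c0 = some_chart \<A> x"
  have ch0: "c0 \<in> charts_at \<A> x" unfolding c0_def by (rule some_chart_in_charts_at[OF g])
  have c0: "c0 \<in> \<A>" "x \<in> cdom c0" using charts_atD[OF ch0] by auto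
  have U: "open U" using gU by (simp add: smooth_field_def)
  let ?u0 = "cmap c0 x"
  have Sc: "S \<in> cotens \<A> 4 x" and Ssym: "S c0 [a, b, k, l] = S c0 [b, a, k, l]" "S c0 [a, b, k, l] = S c0 [a, b, l, k]" for a b k l
    using S unfolding S22_def by blast+
  define H where "H = (\<chi> a b. g x c0 [a, b])"
  have Hs: "transpose H = H" "invertible H"
    using has_signature_symmetric_invertible[OF sig[OF x ch0]] by (auto simp: H_def)
  obtain K where K: "H ** K = mat 1" "K ** H = mat 1" using Hs(2) unfolding invertible_def by blast
  have Ks: "transpose K = K"
  proof -
    have "transpose K ** H = mat 1" using K(1) Hs(1) by (metis matrix_transpose_mul transpose_mat)
    then have "transpose K ** H ** K = K" by simp
    then show ?thesis by (simp add: matrix_mul_assoc[symmetric] K(1))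
  qed
  have Kd: "(\<Sum>i\<in>UNIV. K $ i $ m * H $ i $ b) = of_bool (m = b)" "(\<Sum>j\<in>UNIV. H $ a $ j * K $ j $ m) = of_bool (a = m)" for a b m
  proof -
    have "(transpose K ** H) $ m $ b = mat 1 $ m $ b" by (simp add: Ks K(2))
    then show "(\<Sum>i\<in>UNIV. K $ i $ m * H $ i $ b) = of_bool (m = b)"
      by (simp add: matrix_matrix_mult_def transpose_def mat_def)
    have "(H ** K) $ a $ m = mat 1 $ a $ m" by (simp add: K(1))
    then show "(\<Sum>j\<in>UNIV. H $ a $ j * K $ j $ m) = of_bool (a = m)"
      by (simp add: matrix_matrix_mult_def mat_def)
  qed
  \<comment> \<open>K is the inverse of the metric at x, so that contracting A with the metric gives
    back S. The factor 1/4 becomes 1/2 on differentiating twice, since S is symmetric in k and l,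
    and each of the two factors 1 + A then contributes half of S.\<close>
  define A where "A = (\<lambda>i a u. \<Sum>m\<in>UNIV. \<Sum>k\<in>UNIV. \<Sum>l\<in>UNIV.
    (K $ i $ m * S c0 [m, a, k, l] / 4) * ((u - ?u0) $ k * (u - ?u0) $ l))"
  define SA where "SA = (\<lambda>i a v w. \<Sum>m\<in>UNIV. K $ i $ m / 2 * (\<Sum>k\<in>UNIV. \<Sum>l\<in>UNIV. S c0 [m, a, k, l] * (v $ k * w $ l)))"
  have comp: "smooth_on UNIV (\<lambda>u::real^'n. (u - ?u0) $ k)" for k
    by (intro smooth_on_vec_nth smooth_on_minus smooth_on_id smooth_on_const open_UNIV)
  have dcomp: "dd v (\<lambda>u::real^'n. (u - ?u0) $ k) ?u0 = v $ k" for k v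
    by (rule dd_eqI) (auto intro!: derivative_eq_intros bounded_linear.has_derivative[OF bounded_linear_vec_nth])
  have flq: "flat ?u0 (\<lambda>u. (u - ?u0) $ k * (u - ?u0) $ l) (\<lambda>v w. v $ k * w $ l + w $ k * v $ l)" for k l
  proof -
    have "flat ?u0 (\<lambda>u. (u - ?u0) $ k * (u - ?u0) $ l) (\<lambda>v w. dd v (\<lambda>u. (u - ?u0) $ k) ?u0 * dd w (\<lambda>u. (u - ?u0) $ l) ?u0
        + dd w (\<lambda>u. (u - ?u0) $ k) ?u0 * dd v (\<lambda>u. (u - ?u0) $ l) ?u0)"
      by (rule flat_prod[OF smooth_nearI[OF open_UNIV UNIV_I comp] smooth_nearI[OF open_UNIV UNIV_I comp]]) simp_all
    then show ?thesis unfolding dcomp .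
  qed
  have flA: "flat ?u0 (A i a) (SA i a)" for i a
  proof (rule flat_cong[OF always_eventually])
    show "flat ?u0 (A i a) (\<lambda>v w. \<Sum>m\<in>UNIV. \<Sum>k\<in>UNIV. \<Sum>l\<in>UNIV.
        (K $ i $ m * S c0 [m, a, k, l] / 4) * (v $ k * w $ l + w $ k * v $ l))"
      unfolding A_def by (intro flat_sum flat_mult smooth_near_const flq)
    fix v w :: "real^'n"
    have sw: "(\<Sum>k\<in>UNIV. \<Sum>l\<in>UNIV. S c0 [m, a, k, l] * (w $ k * v $ l)) =
        (\<Sum>k\<in>UNIV. \<Sum>l\<in>UNIV. S c0 [m, a, k, l] * (v $ k * w $ l))" for m
      by (subst sum.swap) (intro sum.cong refl, subst Ssym(2), simp)
    have inner: "(\<Sum>k\<in>UNIV. \<Sum>l\<in>UNIV. (K $ i $ m * S c0 [m, a, k, l] / 4) * (v $ k * w $ l + w $ k * v $ l)) =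
        K $ i $ m / 4 * ((\<Sum>k\<in>UNIV. \<Sum>l\<in>UNIV. S c0 [m, a, k, l] * (v $ k * w $ l)) +
          (\<Sum>k\<in>UNIV. \<Sum>l\<in>UNIV. S c0 [m, a, k, l] * (w $ k * v $ l)))" for m
      by (simp add: sum_distrib_left sum.distrib[symmetric] algebra_simps add_divide_distrib)
    show "(\<Sum>m\<in>UNIV. \<Sum>k\<in>UNIV. \<Sum>l\<in>UNIV.
        (K $ i $ m * S c0 [m, a, k, l] / 4) * (v $ k * w $ l + w $ k * v $ l)) = SA i a v w"
      unfolding inner sw SA_def by (intro sum.cong refl) simp
  qed simp
  have smA: "smooth_on UNIV (A i a)" for i a
    unfolding A_def by (intro smooth_on_sum smooth_on_mult smooth_on_const comp open_UNIV)
  define M where "M = (\<lambda>u. \<chi> i a. of_bool (i = a) + A i a u)"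
  have Mn: "M u $ i $ a = of_bool (i = a) + A i a u" for u i a by (simp add: M_def)
  have contM: "continuous_on UNIV (\<lambda>u. M u $ i $ a)" for i a
    unfolding Mn by (intro continuous_intros smooth_on_continuous smA)
  have "open {u. det (M u) \<noteq> 0}"
  proof -
    have "continuous_on UNIV (\<lambda>u. det (M u))" unfolding det_def by (intro continuous_intros contM)
    then show ?thesis by (intro open_Collect_neq continuous_intros)
  qed
  moreover have "M ?u0 = mat 1" using flatD(2)[OF flA] by (simp add: vec_eq_iff Mn mat_def of_bool_def)
  then have M0: "det (M ?u0) \<noteq> 0" by simp
  \<comment> \<open>Where M is invertible the congruence preserves the signature. This is an open
    condition that holds at x, as M is the identity there.\<close>
  define V where "V = U \<inter> cinv c0 ` ({u. det (M u) \<noteq> 0} \<inter> cmap c0 ` cdom c0)"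
  have VU: "V \<subseteq> U" and Vc: "V \<subseteq> cdom c0" using cinv_in[OF c0(1)] unfolding V_def by auto
  have oV: "open V" unfolding V_def
    by (intro open_Int U open_cinv_image[OF c0(1)] calculation chart_homeomorphism(2)[OF c0(1)]) auto
  have xV: "x \<in> V"
    unfolding V_def using x M0 c0 cinv_cmap[OF c0] by (force intro: image_eqI[of _ _ ?u0])
  have detV: "det (M (cmap c0 y)) \<noteq> 0" if "y \<in> V" for y
    using that cmap_cinv[OF c0(1)] unfolding V_def by auto
  define h where "h = (\<lambda>y. cotens_at c0 2 y (tensor_act (transpose (M (cmap c0 y))) 2 (g y c0)))"
  have hc: "h y c0 = tensor_act (transpose (M (cmap c0 y))) 2 (g y c0)" if "y \<in> V" for y
    unfolding h_def by (rule cotens_at_same) (use that Vc c0 in \<open>auto simp: charts_at_def tensor_act_length\<close>)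
  have hcot: "h y \<in> cotens \<A> 2 y" if "y \<in> V" for y
    unfolding h_def by (rule cotens_at_in_cotens) (use that Vc c0 in \<open>auto simp: charts_at_def\<close>)
  have gV: "smooth_field V g" by (rule smooth_field_subset[OF gU oV VU])
  have form: "\<forall>\<^sub>F u in nhds (cmap c0 y). (\<Sum>i\<in>UNIV. \<Sum>j\<in>UNIV. (of_bool (i = a) + A i a u) *
      (of_bool (j = b) + A j b u) * g (cinv c0 u) c0 [i, j]) = h (cinv c0 u) c0 [a, b]" if y: "y \<in> V" for y a b
  proof -
    have "c0 \<in> charts_at \<A> y" using y Vc c0 by (auto simp: charts_at_def)
    from eventually_cinv[OF this oV y] show ?thesis
    proof eventually_elim
      case (elim u)
      then show ?case using cmap_cinv[OF c0(1)] by (simp add: hc tensor_act_2 transpose_def Mn)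
    qed
  qed
  have hV: "smooth_field V h"
  proof (rule smooth_fieldI[OF c0(1) oV Vc hcot])
    fix y a b assume y: "y \<in> V"
    then have ch: "c0 \<in> charts_at \<A> y" using Vc c0 by (auto simp: charts_at_def)
    show "smooth_near (cmap c0 y) (\<lambda>u. h (cinv c0 u) c0 [a, b])"
      by (rule smooth_near_cong[OF form[OF y]])
        (intro smooth_near_sum smooth_near_mult smooth_near_add smooth_near_const
          smooth_near_field[OF gV y ch] smooth_nearI[OF open_UNIV UNIV_I smA])
  qed
  have hsig: "has_signature r s (\<chi> a b. h y c [a, b])" if y: "y \<in> V" and c: "c \<in> charts_at \<A> y" for y c
  proof -
    have ch: "c0 \<in> charts_at \<A> y" using y Vc c0 by (auto simp: charts_at_def)
    have "h y c = tensor_act (transpose (dmat id c c0 y)) 2 (h y c0)"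
      by (rule cotens_transform[OF hcot[OF y] ch c])
    then have "(\<chi> a b. h y c [a, b]) = transpose (dmat id c c0 y) **
       (transpose (M (cmap c0 y)) ** (\<chi> a b. g y c0 [a, b]) ** M (cmap c0 y)) ** dmat id c c0 y"
      by (simp add: hc[OF y] tensor_act_2_matrix)
    moreover have "invertible (M (cmap c0 y))" using detV[OF y] invertible_det_nz by blast
    ultimately show ?thesis
      using sig[OF subsetD[OF VU y] ch] dmat_id_inverse(2)[OF c ch] has_signature_congruence by metis
  qed
  have nh: "metric_near \<A> r s x h"
    unfolding metric_near_def metric_on_iff using xV hV hsig by blast
  have fl: "flat ?u0 (\<lambda>u. h (cinv c0 u) c0 [a, b] - g (cinv c0 u) c0 [a, b])
      (\<lambda>v w. \<Sum>k\<in>UNIV. \<Sum>l\<in>UNIV. S c0 [a, b, k, l] * (v $ k * w $ l))" for a b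
  proof (rule flat_cong[OF _ flat_congruence[where u = ?u0 and a = a and b = b and F = A and SF = SA
        and G = "\<lambda>i j u. g (cinv c0 u) c0 [i, j]" and E = "\<lambda>_ _ _. 0", OF smooth_near_field[OF gU x ch0] flat_zero flA]])
    show "\<forall>\<^sub>F u in nhds ?u0. (\<Sum>i\<in>UNIV. \<Sum>j\<in>UNIV. (of_bool (i = a) + A i a u) * (of_bool (j = b) + A j b u) *
        (g (cinv c0 u) c0 [i, j] + 0)) - g (cinv c0 u) c0 [a, b] = h (cinv c0 u) c0 [a, b] - g (cinv c0 u) c0 [a, b]"
      using form[OF xV, of a b] by eventually_elim simp
    fix v w :: "real^'n"
    define q where "q = (\<lambda>m a. \<Sum>k\<in>UNIV. \<Sum>l\<in>UNIV. S c0 [m, a, k, l] * (v $ k * w $ l))"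
    have qs: "q m a = q a m" for m a unfolding q_def by (simp add: Ssym(1)[of m a])
    have g0: "g (cinv c0 ?u0) c0 [i, j] = H $ i $ j" for i j by (simp add: H_def cinv_cmap[OF c0])
    have SAq: "SA i a v w = (\<Sum>m\<in>UNIV. K $ i $ m / 2 * q m a)" for i a unfolding SA_def q_def ..
    have ob: "(\<Sum>m\<in>UNIV. of_bool (m = b) * f m) = f b" "(\<Sum>m\<in>UNIV. of_bool (a = m) * f m) = f a"
      for f :: "'n \<Rightarrow> real" and a b :: 'n
      by (simp_all add: of_bool_def if_distrib[of "\<lambda>z. z * _"] cong: if_cong)
    have "(\<Sum>i\<in>UNIV. SA i a v w * H $ i $ b) = (\<Sum>m\<in>UNIV. (\<Sum>i\<in>UNIV. K $ i $ m * H $ i $ b) * (q m a / 2))"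
      unfolding SAq sum_distrib_right by (subst sum.swap) (simp add: mult_ac)
    also have "\<dots> = q b a / 2" unfolding Kd ob ..
    finally have 1: "(\<Sum>i\<in>UNIV. SA i a v w * H $ i $ b) = q b a / 2" .
    have "(\<Sum>j\<in>UNIV. SA j b v w * H $ a $ j) = (\<Sum>m\<in>UNIV. (\<Sum>j\<in>UNIV. H $ a $ j * K $ j $ m) * (q m b / 2))"
      unfolding SAq sum_distrib_right by (subst sum.swap) (simp add: mult_ac)
    also have "\<dots> = q a b / 2" unfolding Kd ob ..
    finally have 2: "(\<Sum>j\<in>UNIV. SA j b v w * H $ a $ j) = q a b / 2" .
    show "(\<Sum>i\<in>UNIV. SA i a v w * g (cinv c0 ?u0) c0 [i, b]) + (\<Sum>j\<in>UNIV. SA j b v w * g (cinv c0 ?u0) c0 [a, j]) =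
        (\<Sum>k\<in>UNIV. \<Sum>l\<in>UNIV. S c0 [a, b, k, l] * (v $ k * w $ l))"
      unfolding g0 1 2 qs[of b a] by (simp add: q_def)
  qed
  have "metric_coords c x h = metric_coords c x g + (0, 0, 0, \<chi> a b k l. S c [a, b, k, l])"
    if c: "c \<in> charts_at \<A> x" for c
    using metric_coords_eqI[OF gV hV xV ch0 c fl] cotens_at_cotens[OF Sc ch0 c] by simp
  with nh show thesis by (rule that)
qed

lemma S22_scale: "S \<in> S22 \<A> x \<Longrightarrow> (\<lambda>c L. t * S c L) \<in> S22 \<A> x"
proof -
  assume S: "S \<in> S22 \<A> x"
  then have c: "S \<in> cotens \<A> 4 x" by (simp add: S22_def)
  have "(\<lambda>L. t * S c' L) = tensor_act (transpose (dmat id c' c x)) 4 (\<lambda>L. t * S c L)"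
    if "c \<in> charts_at \<A> x" "c' \<in> charts_at \<A> x" for c c'
    unfolding tensor_act_scale[abs_def] cotens_transform[OF c that] by (rule refl)
  moreover have "t * S c I = 0" if "c \<notin> charts_at \<A> x \<or> length I \<noteq> 4" for c I
  proof -
    have "S c I = 0" using c that unfolding cotens_def by blast
    then show ?thesis by simp
  qed
  ultimately have "(\<lambda>c L. t * S c L) \<in> cotens \<A> 4 x" unfolding cotens_def by blast
  moreover have "t * S c [a, b, k, l] = t * S c [b, a, k, l] \<and> t * S c [a, b, k, l] = t * S c [a, b, l, k]" for c a b k l
  proof -
    have "S c [a, b, k, l] = S c [b, a, k, l] \<and> S c [a, b, k, l] = S c [a, b, l, k]"
      using S unfolding S22_def by blast
    then show ?thesis by simp
  qed
  ultimately show ?thesis unfolding S22_def by blast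
qed

section \<open>Symmetric tensors from components, and uniqueness of the derivative\<close>

lemma cotens_at_in_S22:
  assumes c0: "c0 \<in> charts_at \<A> x"
    and S: "\<And>a b k l. S [a, b, k, l] = S [b, a, k, l]" "\<And>a b k l. S [a, b, k, l] = S [a, b, l, k]"
  shows "cotens_at c0 4 x S \<in> S22 \<A> x"
proof -
  have "cotens_at c0 4 x S c [a, b, k, l] = cotens_at c0 4 x S c [b, a, k, l]"
    "cotens_at c0 4 x S c [a, b, k, l] = cotens_at c0 4 x S c [a, b, l, k]" for c a b k l
    using tensor_act_4_sym[where t = S, OF S] by (auto simp: cotens_at_def)
  then show ?thesis unfolding S22_def using cotens_at_in_cotens[OF c0] by blast
qed

lemma ctens_at_in_S22_dual:
  assumes c0: "c0 \<in> charts_at \<A> x"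
    and N: "\<And>a b k l. N [a, b, k, l] = N [b, a, k, l]" "\<And>a b k l. N [a, b, k, l] = N [a, b, l, k]"
  shows "ctens_at c0 4 x N \<in> S22_dual \<A> x"
proof -
  have "ctens_at c0 4 x N c [a, b, k, l] = ctens_at c0 4 x N c [b, a, k, l]"
    "ctens_at c0 4 x N c [a, b, k, l] = ctens_at c0 4 x N c [a, b, l, k]" for c a b k l
    using tensor_act_4_sym[where t = N, OF N] by (auto simp: ctens_at_def)
  then show ?thesis unfolding S22_dual_def using ctens_at_in_ctens[OF c0] by blast
qed

lemma ctens_at_in_N2:
  assumes c0: "c0 \<in> charts_at \<A> x"
    and N: "\<And>a b k l. N [a, b, k, l] = N [b, a, k, l]" "\<And>a b k l. N [a, b, k, l] = N [a, b, l, k]"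
    and z: "\<And>w y. form4 N w y y y = 0"
  shows "ctens_at c0 4 x N \<in> N2 \<A> x"
proof -
  let ?\<nu> = "ctens_at c0 4 x N"
  have "form4 (?\<nu> c) w y y y = 0" for c w y
    by (simp add: ctens_at_def form4_tensor_act z) (simp add: form4_def)
  from symmetrization_eq_0[OF this] show ?thesis
    unfolding N2_def using ctens_at_in_S22_dual[where N = N, OF c0 N] by simp
qed

text \<open>Test against the difference itself: for a fixed chart and fixed first p indices, the
  array d of differences has the symmetries of \<open>S22\<close> and extends to a member of it; the
  contraction is then the sum of the squares of its entries. Other charts and lists of the wrong
  length are settled by the zero convention. This is the uniqueness that the definite description in
  \<open>tensor_deriv\<close> requires.\<close>

lemma tens_prod_eqI:
  assumes D: "D \<in> tens_prod \<A> p x (S22_dual \<A> x)" and D': "D' \<in> tens_prod \<A> p x (S22_dual \<A> x)"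
    and eq: "\<And>S c I. S \<in> S22 \<A> x \<Longrightarrow> c \<in> charts_at \<A> x \<Longrightarrow> length I = p \<Longrightarrow>
      (\<Sum>L | length L = 4. D c (I @ L) * S c L) = (\<Sum>L | length L = 4. D' c (I @ L) * S c L)"
  shows "D = D'"
proof (intro ext)
  fix c L
  have zero: "D c L = 0" if D: "D \<in> tens_prod \<A> p x (S22_dual \<A> x)" and cL: "c \<notin> charts_at \<A> x \<or> length L \<noteq> p + 4" for D
  proof -
    obtain ts where ts: "set ts \<subseteq> ctens \<A> p x \<times> S22_dual \<A> x"
      "\<And>c L. D c L = (\<Sum>(t, \<nu>)\<leftarrow>ts. t c (take p L) * \<nu> c (drop p L))"
      using D unfolding tens_prod_def by blast
    have "t c (take p L) * \<nu> c (drop p L) = 0" if t: "(t, \<nu>) \<in> set ts" for t \<nu>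
    proof -
      have t: "t \<in> ctens \<A> p x" "\<nu> \<in> ctens \<A> 4 x" using t ts(1) unfolding S22_dual_def by auto
      have "c \<notin> charts_at \<A> x \<or> length (take p L) \<noteq> p \<or> length (drop p L) \<noteq> 4" using cL by auto
      then have "t c (take p L) = 0 \<or> \<nu> c (drop p L) = 0" using t unfolding ctens_def by blast
      then show ?thesis by auto
    qed
    then have "D c L = (\<Sum>_\<leftarrow>ts. 0)"
      unfolding ts(2) by (intro arg_cong[of _ _ sum_list] map_cong refl) auto
    then show ?thesis by simp
  qed
  have sym: "D c (I @ [a, b, k, l]) = D c (I @ [b, a, k, l])" "D c (I @ [a, b, k, l]) = D c (I @ [a, b, l, k])"
    if D: "D \<in> tens_prod \<A> p x (S22_dual \<A> x)" and I: "length I = p" for D I a b k l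
  proof -
    obtain ts where ts: "set ts \<subseteq> ctens \<A> p x \<times> S22_dual \<A> x"
      "\<And>c L. D c L = (\<Sum>(t, \<nu>)\<leftarrow>ts. t c (take p L) * \<nu> c (drop p L))"
      using D unfolding tens_prod_def by blast
    have "\<nu> c [a, b, k, l] = \<nu> c [b, a, k, l]" "\<nu> c [a, b, k, l] = \<nu> c [a, b, l, k]" if "(t, \<nu>) \<in> set ts" for t \<nu>
    proof -
      have "\<nu> \<in> S22_dual \<A> x" using that ts(1) by auto
      then show "\<nu> c [a, b, k, l] = \<nu> c [b, a, k, l]" "\<nu> c [a, b, k, l] = \<nu> c [a, b, l, k]"
        unfolding S22_dual_def by blast+
    qed
    then show "D c (I @ [a, b, k, l]) = D c (I @ [b, a, k, l])" "D c (I @ [a, b, k, l]) = D c (I @ [a, b, l, k])"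
      unfolding ts(2) using I by (auto intro!: arg_cong[of _ _ sum_list])
  qed
  show "D c L = D' c L"
  proof (cases "c \<in> charts_at \<A> x \<and> length L = p + 4")
    case False
    then show ?thesis using zero[OF D] zero[OF D'] by auto
  next
    case True
    let ?I = "take p L"
    have I: "length ?I = p" using True by simp
    define d where "d = (\<lambda>L. if length L = 4 then D c (?I @ L) - D' c (?I @ L) else 0)"
    have ds: "d [a, b, k, l] = d [b, a, k, l]" "d [a, b, k, l] = d [a, b, l, k]" for a b k l
      using sym[OF D I] sym[OF D' I] unfolding d_def by auto
    have "cotens_at c 4 x d c = d"
      using True by (intro cotens_at_same) (auto simp: d_def)
    then have "(\<Sum>L | length L = 4. D c (?I @ L) * d L) = (\<Sum>L | length L = 4. D' c (?I @ L) * d L)"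
      using eq[OF cotens_at_in_S22[where S = d, OF _ ds] _ I, of c c] True by simp
    then have "(\<Sum>L | length L = 4. (D c (?I @ L) - D' c (?I @ L)) * d L) = 0"
      by (simp add: left_diff_distrib sum_subtractf)
    moreover have "(\<Sum>L | length L = 4. (D c (?I @ L) - D' c (?I @ L)) * d L) = (\<Sum>L | length L = 4. d L * d L)"
      by (rule sum.cong) (simp_all add: d_def)
    ultimately have "(\<Sum>L | length L = 4. d L * d L) = 0" by simp
    then have "d (drop p L) * d (drop p L) = 0"
      using sum_nonneg_eq_0_iff[OF finite_lists_length, of 4 "\<lambda>L. d L * d L"] True by simp
    then show ?thesis using True by (simp add: d_def)
  qed
qed

text \<open>N stands for the derivative of one component of T in the chart c0. Along the S produced
  by shears that component is constant, so the contraction of N with S vanishes; varying v and l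
  gives all covectors.\<close>

lemma natural_form4_eq_0:
  assumes nat: "natural_tensor \<A> r s p T" and tens: "\<And>j. j \<in> J2M \<A> r s \<Longrightarrow> T j \<in> ctens \<A> p (fst j)"
    and g: "metric_near \<A> r s x g" and c0: "c0 = some_chart \<A> x"
    and N: "\<And>a b k l. N [a, b, k, l] = N [b, a, k, l]" "\<And>a b k l. N [a, b, k, l] = N [a, b, l, k]"
    and deriv: "\<And>S. S \<in> S22 \<A> x \<Longrightarrow>
      ((\<lambda>t. T (jet_add \<A> r s (jet2 \<A> r s x g) (\<lambda>c L. t * S c L)) c0 I) has_real_derivative
        (\<Sum>L | length L = 4. N L * S c0 L)) (at 0)"
  shows "form4 N w y y y = 0"
proof -
  obtain U where x: "x \<in> U" and gU: "smooth_field U g"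
    and sig: "\<And>y c. y \<in> U \<Longrightarrow> c \<in> charts_at \<A> y \<Longrightarrow> has_signature r s (\<chi> a b. g y c [a, b])"
    using g by (rule metric_nearE) blast
  have ch0: "c0 \<in> charts_at \<A> x" unfolding c0 by (rule some_chart_in_charts_at[OF g])
  define H where "H = (\<chi> a b. g x c0 [a, b])"
  have Hs: "transpose H = H" "invertible H"
    using has_signature_symmetric_invertible[OF sig[OF x ch0]] by (auto simp: H_def)
  have sym: "g x c0 [a, b] = g x c0 [b, a]" for a b
    using arg_cong[OF Hs(1), of "\<lambda>M. M $ b $ a"] by (simp add: H_def transpose_def)
  have unit: "form4 N (H *v v) l l l = 0" if lv: "l \<bullet> v = 1" for l v
  proof -
    define w where "w = H *v v"
    define S where "S = (\<lambda>q L. if length L = 4 then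
      6 * q * (l $ (L ! 0) * w $ (L ! 1) + l $ (L ! 1) * w $ (L ! 0)) * l $ (L ! 2) * l $ (L ! 3) else 0)"
    have Sq: "S q [a, b, k, m] = 6 * q * (l $ a * w $ b + l $ b * w $ a) * l $ k * l $ m" for q a b k m
      by (simp add: S_def numeral_2_eq_2 numeral_3_eq_3)
    have SS: "cotens_at c0 4 x (S 1) \<in> S22 \<A> x"
      by (rule cotens_at_in_S22[OF ch0]) (simp_all add: Sq algebra_simps)
    have Sc: "cotens_at c0 4 x (S 1) c0 = S 1"
      by (rule cotens_at_same[OF ch0]) (simp add: S_def)
    have scale: "cotens_at c0 4 x (S q) c L = q * cotens_at c0 4 x (S 1) c L" for q c L
    proof -
      have "S q = (\<lambda>L. q * S 1 L)" by (simp add: S_def fun_eq_iff)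
      then show ?thesis by (simp add: cotens_at_def tensor_act_scale)
    qed
    have const: "T (jet_add \<A> r s (jet2 \<A> r s x g) (\<lambda>c L. q * cotens_at c0 4 x (S 1) c L)) = T (jet2 \<A> r s x g)" for q
    proof -
      let ?P = "push_metric \<A> (shear_nbhd c0 x l v (- q)) (shear_map c0 x l v (- q)) g"
      \<comment> \<open>\<open>jet_add_eq\<close> asks for a metric of the right signature. Instead
        of checking this for \<open>?P\<close>, a metric h with the same coordinates at x is taken;
        the two have the same \<open>jet2\<close>, which depends only on those coordinates.\<close>
      obtain h where h: "metric_near \<A> r s x h"
        "\<And>c. c \<in> charts_at \<A> x \<Longrightarrow> metric_coords c x h =
          metric_coords c x g + (0, 0, 0, \<chi> a b k l. q * cotens_at c0 4 x (S 1) c [a, b, k, l])"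
        by (rule metric_with_second_derivatives[OF g S22_scale[OF SS, of q]]) (rule that)
      have "metric_coords c x ?P = metric_coords c x h" if c: "c \<in> charts_at \<A> x" for c
      proof -
        have "metric_coords c x ?P = metric_coords c x g + (0, 0, 0, \<chi> a b k l. cotens_at c0 4 x (S q) c [a, b, k, l])"
        proof (rule metric_coords_push_metric[where w = w and U = U, OF ch0 lv gU x])
          show "g x c0 [a, b] = g x c0 [b, a]" for a b by (rule sym)
          show "w = (\<chi> a b. g x c0 [a, b]) *v v" unfolding w_def H_def by (rule refl)
          show "S q [a, b, k, m] = 6 * q * (l $ a * w $ b + l $ b * w $ a) * l $ k * l $ m" for a b k m by (rule Sq)
        qed (rule c)
        then show ?thesis unfolding h(2)[OF c] scale[of q] .
      qed
      then have "jet2 \<A> r s x ?P = jet2 \<A> r s x h" by (rule jet2_cong)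
      moreover have "jet_add \<A> r s (jet2 \<A> r s x g) (\<lambda>c L. q * cotens_at c0 4 x (S 1) c L) = jet2 \<A> r s x h"
        by (rule jet_add_eq[OF g h(1) h(2)])
      moreover have "T (jet2 \<A> r s x ?P) = T (jet2 \<A> r s x g)"
        using natural_shear_invariance[OF nat _ g c0 ch0 lv] tens[OF jet2_in_J2M[OF g]] by simp
      ultimately show ?thesis by simp
    qed
    have "(\<Sum>L | length L = 4. N L * cotens_at c0 4 x (S 1) c0 L) = 0"
      using deriv[OF SS] unfolding const by (rule DERIV_unique[OF _ DERIV_const])
    then have "0 = (\<Sum>L | length L = 4. N L * S 1 L)" by (simp add: Sc)
    \<comment> \<open>The two terms of S give equal contractions because N is symmetric in its first
      two indices; the total is 12 times the form.\<close>
    also have "\<dots> = 6 * (\<Sum>a\<in>UNIV. \<Sum>b\<in>UNIV. \<Sum>k\<in>UNIV. \<Sum>m\<in>UNIV. N [a, b, k, m] * (l $ a * w $ b * l $ k * l $ m))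
        + 6 * form4 N w l l l"
      unfolding sum_lists_4 Sq form4_def by (simp add: sum_distrib_left sum.distrib[symmetric] algebra_simps)
    also have "(\<Sum>a\<in>UNIV. \<Sum>b\<in>UNIV. \<Sum>k\<in>UNIV. \<Sum>m\<in>UNIV. N [a, b, k, m] * (l $ a * w $ b * l $ k * l $ m)) = form4 N w l l l"
      unfolding form4_def by (subst sum.swap) (intro sum.cong refl, subst N(1), simp add: mult_ac)
    finally show ?thesis by (simp add: w_def)
  qed
  \<comment> \<open>Shears cover only l(v) = 1. Homogeneity in v extends this to l(v) \<noteq> 0; if
    l(v) = 0 and l \<noteq> 0, then v is the difference of v + l and l, on both of which l is
    nonzero.\<close>
  have all: "form4 N (H *v v) l l l = 0" for l v
  proof (cases "l = 0")
    case True
    then show ?thesis using form4_scale(2)[of N "H *v v" 0 l l l] by simp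
  next
    case False
    have u: "form4 N (H *v v) l l l = 0" if "l \<bullet> v \<noteq> 0" for v
    proof -
      have "form4 N (H *v ((1 / (l \<bullet> v)) *\<^sub>R v)) l l l = 0" using that by (intro unit) simp
      then show ?thesis using that by (simp add: matrix_vector_mult_scaleR form4_scale)
    qed
    show ?thesis
    proof (cases "l \<bullet> v = 0")
      case True
      have "l \<bullet> (v + l) \<noteq> 0" using True False by (simp add: inner_add_right)
      then have "form4 N (H *v v) l l l + form4 N (H *v l) l l l = 0"
        using u[of "v + l"] by (simp add: matrix_vector_right_distrib form4_add(1))
      then show ?thesis using u[of l] False by simp
    qed (rule u)
  qed
  \<comment> \<open>Non-degeneracy of g: every covector w is of the form g(v, -).\<close>
  obtain K where "H ** K = mat 1" using Hs(2) unfolding invertible_def by blast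
  then have "w = H *v (K *v w)" by (simp add: matrix_vector_mul_assoc)
  then show ?thesis using all[of "K *v w" y] by simp
qed

text \<open>A tensor D is built from the derivatives of the components of T in the single chart c0.
  It satisfies the description of the derivative, hence equals it, and its form as an explicit sum
  of products shows that it suffices to place each factor \<nu> K in \<open>N2\<close>.\<close>

lemma tensor_deriv_in_tens_prod_N2:
  assumes T: "second_order_tensor \<A> r s p T" and nat: "natural_tensor \<A> r s p T" and j: "j \<in> J2M \<A> r s"
  shows "tensor_deriv \<A> r s p T j \<in> tens_prod \<A> p (fst j) (N2 \<A> (fst j))"
proof -
  obtain x g where jx: "j = jet2 \<A> r s x g" and g: "metric_near \<A> r s x g" using j unfolding J2M_def by blast
  have fj: "fst j = x" by (simp add: jx)
  define c0 where "c0 = some_chart \<A> x"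
  have ch0: "c0 \<in> charts_at \<A> x" unfolding c0_def by (rule some_chart_in_charts_at[OF g])
  have tens: "T j \<in> ctens \<A> p (fst j)" if "j \<in> J2M \<A> r s" for j
    using T that unfolding second_order_tensor_def by blast
  let ?jS = "\<lambda>S t. jet_add \<A> r s j (\<lambda>c L. t * S c L)"
  have add: "?jS S t \<in> J2M \<A> r s \<and> fst (?jS S t) = x \<and>
      (\<forall>c\<in>charts_at \<A> x. jet_coords c (?jS S t) = jet_coords c j + (0, 0, 0, \<chi> a b k l. t * S c [a, b, k, l]))"
    if S: "S \<in> S22 \<A> x" for S t
  proof -
    obtain h where h: "metric_near \<A> r s x h"
      "\<And>c. c \<in> charts_at \<A> x \<Longrightarrow> metric_coords c x h =
          metric_coords c x g + (0, 0, 0, \<chi> a b k l. t * S c [a, b, k, l])"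
      by (rule metric_with_second_derivatives[OF g S22_scale[OF S, of t]]) (rule that)
    have "?jS S t = jet2 \<A> r s x h" unfolding jx by (rule jet_add_eq[OF g h])
    then show ?thesis using jet2_in_J2M[OF h(1)] h(2) by (simp add: jx jet_coords_jet2[OF g] jet_coords_jet2[OF h(1)])
  qed
  \<comment> \<open>N represents the derivative of the component K in the chart c0 only; the other
    charts follow from the transformation law. As a predicate it lets one array be chosen for each
    K.\<close>
  define Q where "Q = (\<lambda>K N. (\<forall>L. length L \<noteq> 4 \<longrightarrow> N L = 0) \<and>
      (\<forall>a b k l. N [a, b, k, l] = N [b, a, k, l] \<and> N [a, b, k, l] = N [a, b, l, k]) \<and>
      (\<forall>S\<in>S22 \<A> x. ((\<lambda>t. T (?jS S t) c0 K) has_real_derivative (\<Sum>L | length L = 4. N L * S c0 L)) (at 0)))"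
  have ex: "\<exists>N. Q K N"
    if K: "length K = p" for K
  proof -
    have "c0 \<in> \<A>" "fst j \<in> cdom c0" using charts_atD[OF ch0] fj by auto
    note ex = conjunct2[OF T[unfolded second_order_tensor_def], rule_format, OF this(1) j conjI[OF this(2) K]]
    obtain W F where W: "open W" "jet_coords c0 j \<in> W" "smooth_on W F"
      "\<And>j'. j' \<in> J2M \<A> r s \<Longrightarrow> fst j' \<in> cdom c0 \<Longrightarrow> jet_coords c0 j' \<in> W \<Longrightarrow> T j' c0 K = F (jet_coords c0 j')"
      using ex by blast
    let ?J = "jet_coords c0 j"
    have dF: "(F has_derivative (\<lambda>v. dd v F ?J)) (at ?J)"
      by (rule has_derivative_dd[OF smooth_on_differentiable[OF W(3,2)]])
    \<comment> \<open>F lives on the whole coordinate space of jets; only its derivative in the slot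
      of the second derivatives, that is along the fibre over the 1-jet, enters.\<close>
    define \<phi> where "\<phi> = (\<lambda>Z. dd (0, 0, 0, Z) F ?J)"
    have lin: "linear (\<lambda>v. dd v F ?J)" by (rule has_derivative_linear[OF dF])
    have "linear \<phi>"
    proof (rule linearI)
      show "\<phi> (Z + Z') = \<phi> Z + \<phi> Z'" for Z Z'
        using linear_add[OF lin, of "(0, 0, 0, Z)" "(0, 0, 0, Z')"] by (simp add: \<phi>_def)
      show "\<phi> (c *\<^sub>R Z) = c *\<^sub>R \<phi> Z" for c Z
        using linear_cmul[OF lin, of c "(0, 0, 0, Z)"] by (simp add: \<phi>_def)
    qed
    then obtain N where N: "\<And>L. length L \<noteq> 4 \<Longrightarrow> N L = 0"
      "\<And>a b k l. N [a, b, k, l] = N [b, a, k, l]" "\<And>a b k l. N [a, b, k, l] = N [a, b, l, k]"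
      "\<And>S. (\<And>a b k l. S [a, b, k, l] = S [b, a, k, l]) \<Longrightarrow> (\<And>a b k l. S [a, b, k, l] = S [a, b, l, k]) \<Longrightarrow>
         \<phi> (\<chi> a b k l. S [a, b, k, l]) = (\<Sum>L | length L = 4. N L * S L)"
      by (rule symmetric_representation) blast
    have "((\<lambda>t. T (?jS S t) c0 K) has_real_derivative (\<Sum>L | length L = 4. N L * S c0 L)) (at 0)"
      if S: "S \<in> S22 \<A> x" for S
    proof -
      have Ssym: "S c0 [a, b, k, l] = S c0 [b, a, k, l]" "S c0 [a, b, k, l] = S c0 [a, b, l, k]" for a b k l
        using S unfolding S22_def by blast+
      define e where "e = (0 :: real^'n, 0 :: real^'n^'n, 0 :: real^'n^'n^'n, \<chi> a b k l. S c0 [a, b, k, l])"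
      let ?c = "\<lambda>t. ?J + t *\<^sub>R e"
      have coords: "jet_coords c0 (?jS S t) = ?c t" for t
      proof -
        have "t *\<^sub>R e = (0, 0, 0, \<chi> a b k l. t * S c0 [a, b, k, l])" by (simp add: e_def vec_eq_iff)
        then show ?thesis using add[OF S, of t] ch0 by simp
      qed
      have o: "open (?c -` W)" by (rule open_vimage[OF W(1)]) (intro continuous_intros)
      have z: "0 \<in> ?c -` W" using W(2) by simp
      have eq: "F (?c t) = T (?jS S t) c0 K" if "t \<in> ?c -` W" for t
        using W(4)[of "?jS S t"] add[OF S, of t] that \<open>fst j \<in> cdom c0\<close> coords[of t] fj by simp
      have d: "((\<lambda>t. F (?c t)) has_derivative (\<lambda>t. dd (t *\<^sub>R e) F ?J)) (at 0)"
      proof -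
        have "(?c has_derivative (\<lambda>t. t *\<^sub>R e)) (at 0)" by (auto intro!: derivative_eq_intros)
        from has_derivative_compose[OF this, of F "\<lambda>v. dd v F ?J"] dF show ?thesis by simp
      qed
      have "((\<lambda>t. T (?jS S t) c0 K) has_derivative (\<lambda>t. dd (t *\<^sub>R e) F ?J)) (at 0)"
        by (rule has_derivative_transform_within_open[OF d o z eq])
      moreover have "dd (t *\<^sub>R e) F ?J = (\<Sum>L | length L = 4. N L * S c0 L) * t" for t
        using linear_cmul[OF lin, of t e] N(4)[of "S c0", OF Ssym] by (simp add: \<phi>_def e_def)
      ultimately show ?thesis by (simp add: has_field_derivative_def)
    qed
    then have "Q K N" unfolding Q_def using N(1-3) by blast
    then show ?thesis by (rule exI[of "Q K" N])
  qed
  define N where "N = (\<lambda>K. SOME N. Q K N)"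
  have NQ: "Q K (N K)" if "length K = p" for K
    unfolding N_def by (rule someI_ex[OF ex[OF that]])
  have N: "\<And>K L. length K = p \<Longrightarrow> length L \<noteq> 4 \<Longrightarrow> N K L = 0"
    "\<And>K a b k l. length K = p \<Longrightarrow> N K [a, b, k, l] = N K [b, a, k, l]"
    "\<And>K a b k l. length K = p \<Longrightarrow> N K [a, b, k, l] = N K [a, b, l, k]"
    "\<And>K S. length K = p \<Longrightarrow> S \<in> S22 \<A> x \<Longrightarrow>
      ((\<lambda>t. T (?jS S t) c0 K) has_real_derivative (\<Sum>L | length L = 4. N K L * S c0 L)) (at 0)"
    using NQ unfolding Q_def by blast+
  \<comment> \<open>For K of length p this is the tensor whose only nonzero component in c0 is a 1
    at K. D is the expansion of the derivative in this basis, with coefficients \<nu> K.\<close>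
  define \<epsilon> where "\<epsilon> = (\<lambda>K. ctens_at c0 p x (\<lambda>I. of_bool (I = K)))"
  define \<nu> where "\<nu> = (\<lambda>K. ctens_at c0 4 x (N K))"
  define D where "D = (\<lambda>c L. \<Sum>K | length K = p. \<epsilon> K c (take p L) * \<nu> K c (drop p L))"
  obtain Ks :: "'n list list" where Ks: "set Ks = {K. length K = p}" "distinct Ks"
    using finite_distinct_list[OF finite_lists_length] by blast
  \<comment> \<open>Y is left open: with \<open>S22_dual\<close> the membership identifies D as the
    derivative, with \<open>N2\<close> it is the claim.\<close>
  have D_in: "D \<in> tens_prod \<A> p x Y" if "\<And>K. length K = p \<Longrightarrow> \<nu> K \<in> Y" for Y
  proof -
    let ?ts = "map (\<lambda>K. (\<epsilon> K, \<nu> K)) Ks"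
    have "set ?ts \<subseteq> ctens \<A> p x \<times> Y"
      using that ctens_at_in_ctens[OF ch0] by (auto simp: Ks \<epsilon>_def)
    moreover have "\<forall>c L. D c L = (\<Sum>(t, \<nu>)\<leftarrow>?ts. t c (take p L) * \<nu> c (drop p L))"
      unfolding D_def Ks(1)[symmetric] by (simp add: sum_list_distinct_conv_sum_set[OF Ks(2)] comp_def)
    ultimately show ?thesis unfolding tens_prod_def by blast
  qed
  have D_dual: "D \<in> tens_prod \<A> p x (S22_dual \<A> x)"
  proof (rule D_in)
    fix K :: "'n list" assume "length K = p"
    then show "\<nu> K \<in> S22_dual \<A> x"
      unfolding \<nu>_def by (intro ctens_at_in_S22_dual[OF ch0] N(2,3))
  qed
  have D_deriv: "((\<lambda>t. T (?jS S t) c I) has_real_derivative (\<Sum>L | length L = 4. D c (I @ L) * S c L)) (at 0)"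
    if S: "S \<in> S22 \<A> x" and c: "c \<in> charts_at \<A> x" and I: "length I = p" for S c I
  proof -
    let ?A = "dmat id c0 c x"
    let ?a = "\<lambda>K. \<Prod>i<p. ?A $ (I ! i) $ (K ! i)"
    have Sc: "S \<in> cotens \<A> 4 x" using S unfolding S22_def by blast
    \<comment> \<open>All jets j + t S lie over x, so the Jacobian between the charts does not
      depend on t and the sum can be differentiated term by term.\<close>
    have "T (?jS S t) c I = (\<Sum>K | length K = p. ?a K * T (?jS S t) c0 K)" for t
    proof -
      have "T (?jS S t) \<in> ctens \<A> p x" using tens[of "?jS S t"] add[OF S, of t] by simp
      from ctens_transform[OF this ch0 c] show ?thesis using I by (simp add: tensor_act_def)
    qed
    moreover have "((\<lambda>t. \<Sum>K | length K = p. ?a K * T (?jS S t) c0 K) has_real_derivative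
        (\<Sum>K | length K = p. ?a K * (\<Sum>L | length L = 4. N K L * S c0 L))) (at 0)"
      by (rule DERIV_sum, rule DERIV_cmult) (use N(4)[OF _ S] in simp)
    moreover have "(\<Sum>L | length L = 4. D c (I @ L) * S c L) =
        (\<Sum>K | length K = p. ?a K * (\<Sum>L | length L = 4. N K L * S c0 L))"
    proof -
      have \<epsilon>: "\<epsilon> K c I = ?a K" if "length K = p" for K
      proof -
        have "\<epsilon> K c I = (\<Sum>J | length J = p. ?a J * of_bool (J = K))"
          using c I by (simp add: \<epsilon>_def ctens_at_def tensor_act_def)
        also have "\<dots> = (\<Sum>J | length J = p. if J = K then ?a J else 0)"
          by (intro sum.cong refl) simp
        also have "\<dots> = ?a K" using that by (simp add: finite_lists_length)
        finally show ?thesis .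
      qed
      \<comment> \<open>S transforms by the transposed Jacobian, which
        \<open>tensor_act_adjoint\<close> moves across, so the contraction is the same in c and in
        c0.\<close>
      have \<nu>: "(\<Sum>L | length L = 4. \<nu> K c L * S c L) = (\<Sum>L | length L = 4. N K L * S c0 L)" for K
        unfolding cotens_transform[OF Sc c ch0] using c
        by (simp add: \<nu>_def ctens_at_def tensor_act_adjoint)
      have "(\<Sum>L | length L = 4. D c (I @ L) * S c L) =
          (\<Sum>L | length L = 4. \<Sum>K | length K = p. \<epsilon> K c I * (\<nu> K c L * S c L))"
        unfolding D_def using I by (simp add: sum_distrib_right mult.assoc)
      also have "\<dots> = (\<Sum>K | length K = p. \<epsilon> K c I * (\<Sum>L | length L = 4. \<nu> K c L * S c L))"
        by (subst sum.swap) (simp add: sum_distrib_left)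
      finally show ?thesis unfolding \<nu> by (simp add: \<epsilon>)
    qed
    ultimately show ?thesis by simp
  qed
  have "tensor_deriv \<A> r s p T j = D"
    unfolding tensor_deriv_def fj
  proof (rule the_equality)
    show "D \<in> tens_prod \<A> p x (S22_dual \<A> x) \<and>
      (\<forall>S\<in>S22 \<A> x. \<forall>c\<in>charts_at \<A> x. \<forall>I. length I = p \<longrightarrow>
        ((\<lambda>t. T (?jS S t) c I) has_real_derivative
           (\<Sum>a\<in>UNIV. \<Sum>b\<in>UNIV. \<Sum>k\<in>UNIV. \<Sum>l\<in>UNIV. D c (I @ [a, b, k, l]) * S c [a, b, k, l])) (at 0))"
      using D_dual D_deriv unfolding sum_lists_4 by blast
  next
    fix D' assume D': "D' \<in> tens_prod \<A> p x (S22_dual \<A> x) \<and>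
      (\<forall>S\<in>S22 \<A> x. \<forall>c\<in>charts_at \<A> x. \<forall>I. length I = p \<longrightarrow>
        ((\<lambda>t. T (?jS S t) c I) has_real_derivative
           (\<Sum>a\<in>UNIV. \<Sum>b\<in>UNIV. \<Sum>k\<in>UNIV. \<Sum>l\<in>UNIV. D' c (I @ [a, b, k, l]) * S c [a, b, k, l])) (at 0))"
    show "D' = D"
    proof (rule tens_prod_eqI[OF conjunct1[OF D'] D_dual])
      fix S c and I :: "'n list" assume S: "S \<in> S22 \<A> x" and c: "c \<in> charts_at \<A> x" and I: "length I = p"
      have "((\<lambda>t. T (?jS S t) c I) has_real_derivative (\<Sum>L | length L = 4. D' c (I @ L) * S c L)) (at 0)"
        using D' S c I unfolding sum_lists_4 by blast
      then show "(\<Sum>L | length L = 4. D' c (I @ L) * S c L) = (\<Sum>L | length L = 4. D c (I @ L) * S c L)"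
        using D_deriv[OF S c I] by (rule DERIV_unique)
    qed
  qed
  moreover have "D \<in> tens_prod \<A> p x (N2 \<A> x)"
  proof (rule D_in)
    fix K :: "'n list" assume K: "length K = p"
    have "form4 (N K) w y y y = 0" for w y
      by (rule natural_form4_eq_0[where N = "N K", OF nat tens g c0_def N(2,3)[OF K] N(4)[OF K, unfolded jx]])
    then show "\<nu> K \<in> N2 \<A> x" unfolding \<nu>_def by (rule ctens_at_in_N2[where N = "N K", OF ch0 N(2,3)[OF K]])
  qed
  ultimately show ?thesis by (simp add: fj)
qed

end

theorem proposition2p4:
  fixes \<A> :: "('x::{t2_space, second_countable_topology}, 'n::finite) chart set"
    and r s p :: nat
    and T :: "('x, 'n) jet \<Rightarrow> ('x, 'n) tens"
  assumes "smooth_atlas \<A>"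
    and "second_order_tensor \<A> r s p T"
    and "natural_tensor \<A> r s p T"
  shows "\<forall>j\<in>J2M \<A> r s. tensor_deriv \<A> r s p T j \<in> tens_prod \<A> p (fst j) (N2 \<A> (fst j))"
proof
  interpret smooth_manifold \<A> by unfold_locales (rule assms(1))
  fix j assume "j \<in> J2M \<A> r s"
  then show "tensor_deriv \<A> r s p T j \<in> tens_prod \<A> p (fst j) (N2 \<A> (fst j))"
    by (rule tensor_deriv_in_tens_prod_N2[OF assms(2,3)])
qed

end
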